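(* For every integer $p\ge 2$ and every $K>0$ there exists a constant $C=C(K,p)>0$, depending only on $K$ and $p$, such that the following holds for all positive integers $d,N$. Let $X$ be a mean-zero subgaussian random vector in $\mathbb{R}^d$ with subgaussian constant $K$ and covariance matrix $\Sigma=\mathbb{E}XX^{\mathsf T}$, and let $X_1,\ldots,X_N$ be i.i.d. copies of $X$. Then $$ \mathbb{E}\left\|\frac1N\sum_{i=1}^N X_i^{\otimes p}-\mathbb{E}X^{\otimes p}\right\| \le C\,\|\Sigma\|^{p/2}\left(\frac{r(\Sigma)^{p/2}}{N}+\sqrt{\frac{r(\Sigma)}{N}}\right). $$
   Context: The $\psi_2$ norm and the $L^2$ norm of a real random variable $Y$ are $\|Y\|_{\psi_2}=\inf\{t>0:\mathbb{E}e^{Y^2/t^2}\le 2\}$ and $\|Y\|_{L^2}=(\mathbb{E}|Y|^2)^{1/2}$. A random vector $X$ in $\mathbb{R}^d$ is subgaussian with constant $K>0$ if $\|\langle X,v\rangle\|_{\psi_2}\le K\|\langle X,v\rangle\|_{L^2}$ for every $v\in S^{d-1}$, where $S^{d-1}$ is the Euclidean unit sphere of $\mathbb{R}^d$. The simple tensor $X^{\otimes p}$ is the order-$p$ tensor whose entries are the products of all $p$-tuples of entries of $X$. The norm of the tensor in the claim is defined by $$ \left\|\frac1N\sum_{i=1}^N X_i^{\otimes p}-\mathbb{E}X^{\otimes p}\right\| := \sup_{v\in S^{d-1}}\left|\frac1N\sum_{i=1}^N\langle X_i,v\rangle^p-\mathbb{E}\langle X,v\rangle^p\right|. $$ For the matrix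 $\Sigma$, $\|\Sigma\|$ is the operator (spectral) norm, and $r(\Sigma)=\operatorname{Tr}(\Sigma)/\|\Sigma\|$ is the effective rank. *)

theory Defs
  imports "HOL-Probability.Probability"
begin

text \<open>
  The constant of the theorem must not depend on the dimension \<open>d\<close>, so \<open>d\<close> has to be an ordinary
  variable and not (the cardinality of) a type. A vector of $\mathbb{R}^d$ is therefore a function
  \<open>nat \<Rightarrow> real\<close> that is extensional on \<open>{..<d}\<close>, and the Borel sets of $\mathbb{R}^d$ are the product
  \<open>\<sigma>\<close>-algebra.
\<close>

abbreviation euclid :: "nat \<Rightarrow> (nat \<Rightarrow> real) measure" where
  "euclid d \<equiv> PiM {..<d} (\<lambda>_. borel)"

definition ip :: "nat \<Rightarrow> (nat \<Rightarrow> real) \<Rightarrow> (nat \<Rightarrow> real) \<Rightarrow> real" where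
  "ip d x y = (\<Sum>i<d. x i * y i)"

definition unit_sphere :: "nat \<Rightarrow> (nat \<Rightarrow> real) set" where
  "unit_sphere d = {v \<in> {..<d} \<rightarrow>\<^sub>E UNIV. L2_set v {..<d} = 1}"

definition trace_mat :: "nat \<Rightarrow> (nat \<Rightarrow> nat \<Rightarrow> real) \<Rightarrow> real" where
  "trace_mat d A = (\<Sum>i<d. A i i)"

definition op_norm :: "nat \<Rightarrow> (nat \<Rightarrow> nat \<Rightarrow> real) \<Rightarrow> real" where
  "op_norm d A = (SUP v\<in>unit_sphere d. L2_set (\<lambda>i. \<Sum>j<d. A i j * v j) {..<d})"

text \<open>For the zero matrix this is \<open>0 / 0 = 0\<close>.\<close>

definition eff_rank :: "nat \<Rightarrow> (nat \<Rightarrow> nat \<Rightarrow> real) \<Rightarrow> real" where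
  "eff_rank d A = trace_mat d A / op_norm d A"

text \<open>
  The expectation is a Lebesgue integral in \<open>[0,\<infinity>]\<close> (a Bochner integral would be \<open>0\<close>, hence at most
  \<open>2\<close>, in the divergent case), and the infimum is taken in \<open>[0,\<infinity>]\<close>, so that it is \<open>\<infinity>\<close> if no \<open>t\<close>
  is admissible.
\<close>

definition psi2_norm :: "'a measure \<Rightarrow> ('a \<Rightarrow> real) \<Rightarrow> ennreal" where
  "psi2_norm M Y =
     (INF t\<in>{t::real. t > 0 \<and> (\<integral>\<^sup>+\<omega>. ennreal (exp ((Y \<omega>)\<^sup>2 / t\<^sup>2)) \<partial>M) \<le> 2}. ennreal t)"

definition l2_norm :: "'a measure \<Rightarrow> ('a \<Rightarrow> real) \<Rightarrow> real" where
  "l2_norm M Y = sqrt (\<integral>\<omega>. \<bar>Y \<omega>\<bar>\<^sup>2 \<partial>M)"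

text \<open>
  A vector without finite second moments is not subgaussian: if $\langle X,v\rangle^2$ is not
  integrable, the left-hand side below is \<open>\<infinity>\<close> and the right-hand side is finite. Hence all moments
  occurring below are integrals of integrable functions.
\<close>

definition subgaussian :: "nat \<Rightarrow> real \<Rightarrow> 'a measure \<Rightarrow> ('a \<Rightarrow> nat \<Rightarrow> real) \<Rightarrow> bool" where
  "subgaussian d K M X \<longleftrightarrow>
     (\<forall>v\<in>unit_sphere d.
        psi2_norm M (\<lambda>\<omega>. ip d (X \<omega>) v) \<le> ennreal (K * l2_norm M (\<lambda>\<omega>. ip d (X \<omega>) v)))"

definition mean_zero :: "nat \<Rightarrow> 'a measure \<Rightarrow> ('a \<Rightarrow> nat \<Rightarrow> real) \<Rightarrow> bool" where
  "mean_zero d M X \<longleftrightarrow> (\<forall>i<d. (\<integral>\<omega>. X \<omega> i \<partial>M) = 0)"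

definition cov_mat :: "'a measure \<Rightarrow> ('a \<Rightarrow> nat \<Rightarrow> real) \<Rightarrow> nat \<Rightarrow> nat \<Rightarrow> real" where
  "cov_mat M X i j = (\<integral>\<omega>. X \<omega> i * X \<omega> j \<partial>M)"

definition iid_copies ::
  "nat \<Rightarrow> nat \<Rightarrow> 'a measure \<Rightarrow> ('a \<Rightarrow> nat \<Rightarrow> real) \<Rightarrow> (nat \<Rightarrow> 'a \<Rightarrow> nat \<Rightarrow> real) \<Rightarrow> bool" where
  "iid_copies d N M X Xs \<longleftrightarrow>
     prob_space.indep_vars M (\<lambda>_. euclid d) Xs {1..N} \<and>
     (\<forall>i\<in>{1..N}. distr M (euclid d) (Xs i) = distr M (euclid d) X)"

text \<open>The norm $\|\frac1N\sum_i X_i^{\otimes p}-\mathbb{E}X^{\otimes p}\|$ at the outcome \<open>\<omega>\<close>.\<close>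

definition tensor_deviation ::
  "nat \<Rightarrow> nat \<Rightarrow> nat \<Rightarrow> 'a measure \<Rightarrow> ('a \<Rightarrow> nat \<Rightarrow> real) \<Rightarrow> (nat \<Rightarrow> 'a \<Rightarrow> nat \<Rightarrow> real) \<Rightarrow> 'a \<Rightarrow> real"
where
  "tensor_deviation p d N M X Xs \<omega> =
     (SUP v\<in>unit_sphere d.
        \<bar>1 / real N * (\<Sum>i=1..N. ip d (Xs i \<omega>) v ^ p) - (\<integral>\<omega>'. ip d (X \<omega>') v ^ p \<partial>M)\<bar>)"

text \<open>
  \<open>tensor_bound TYPE('a) p K C\<close>: the inequality of the theorem holds with the constant \<open>C\<close> for all
  \<open>d\<close>, \<open>N\<close> and all random vectors defined on a probability space with underlying type \<open>'a\<close>.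
  The expectation on the left is a Lebesgue integral in \<open>[0,\<infinity>]\<close>, so its finiteness is part of the
  claim.
\<close>

definition tensor_bound :: "'a itself \<Rightarrow> nat \<Rightarrow> real \<Rightarrow> real \<Rightarrow> bool" where
  "tensor_bound (_ :: 'a itself) p K C \<longleftrightarrow>
     (\<forall>d N (M :: 'a measure) X Xs \<Sigma>.
        d > 0 \<longrightarrow> N > 0 \<longrightarrow> prob_space M \<longrightarrow> X \<in> M \<rightarrow>\<^sub>M euclid d \<longrightarrow>
        mean_zero d M X \<longrightarrow> subgaussian d K M X \<longrightarrow> \<Sigma> = cov_mat M X \<longrightarrow>
        iid_copies d N M X Xs \<longrightarrow>
        (\<integral>\<^sup>+\<omega>. ennreal (tensor_deviation p d N M X Xs \<omega>) \<partial>M)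
          \<le> ennreal (C * op_norm d \<Sigma> powr (real p / 2) *
               (eff_rank d \<Sigma> powr (real p / 2) / real N + sqrt (eff_rank d \<Sigma> / real N))))"

text \<open>
  The constant must not depend on the probability space either, but HOL has no quantifier over the
  type \<open>'a\<close> inside a formula, so \<open>\<exists>C. \<forall>'a. tensor_bound TYPE('a) p K C\<close> is expressed by two
  statements: some \<open>C > 0\<close> is valid over \<open>sample\<close>, the type on which the joint law of
  \<open>X, X\<^sub>1, \<dots>, X\<^sub>N\<close> lives, and every constant valid over \<open>sample\<close> is valid over every type \<open>'a\<close>.
\<close>

type_synonym sample = "nat \<Rightarrow> nat \<Rightarrow> real"

end

theory Submission imports Defs begin

text \<open>
  The proof is a PAC-Bayes argument. For a unit vector \<open>v\<close> let $\theta$ be Gaussian with mean \<open>v\<close>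
  and covariance $I/r$, where $\|\Sigma\| = 1$ and $r = r(\Sigma)$; its relative entropy with respect
  to the centred Gaussian is $r/2$, and the variational inequality bounds averages over $\theta$
  uniformly in \<open>v\<close> by one exponential moment under the centred Gaussian.

  Since $\langle x,v\rangle^p$ is the mean of $\prod_j\langle x,\theta_j\rangle$ over independent
  copies $\theta_1,\dots,\theta_p$, it is an average of a random variable that does not depend on
  \<open>v\<close>. Clipping this product at $L = \sqrt{N/r}$ makes exponential moments available and gives a
  fluctuation of order $\sqrt{r/N}$. The clipping error is of the same order, apart from
  $\frac1N\sum_i|\langle X_i,v\rangle|^p$ over those \<open>i\<close> with $|\langle X_i,v\rangle|^p > 2^{-p}L$.
  Because $\ell_p$ norms decrease in \<open>p\<close>, that sum is at most the power $p/2$ of the corresponding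
  sum of squares, and a second variational inequality shows the latter to be of order \<open>r\<close>: the
  event $\langle X,v\rangle^2 > c\,(N/r)^{1/p}$ has probability $O(r/N)$.
\<close>

section \<open>Change of measure for Gaussian shifts\<close>

text \<open>The covariance I/r is matched to the size of X. After normalisation |X|^2 has mean at
  most r, so the noise <X, g> / sqrt r added to <X, v> has order 1, like <X, v> itself, while the
  entropy r/2 takes the place of the dimension d. The p-th power of one perturbed projection would
  have Gaussian correction terms in its mean; with independent copies the noise is centred in every
  factor, and the entropy only grows to p * r/2. The variational bounds are exponential, but the
  theorem concerns a mean. Each exponential moment is therefore normalised to a variable of mean at
  most 1 that enters the final estimate linearly, through y \<le> exp y or
  \<open>sqrt_power_le_scaled_exp\<close>, and no tails are integrated. The second variational
  inequality meets two obstacles: <x, g>^2 need not have a finite exponential moment when x and g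
  are both random, and the noise may cancel <x, v>. The first is met by dividing by a variance that
  depends on g, the second by using both shifts sqrt r * v and - sqrt r * v.\<close>

definition tilted_shift ::
  "'a measure \<Rightarrow> ('a \<Rightarrow> 'a) \<Rightarrow> ('a \<Rightarrow> real) \<Rightarrow> real \<Rightarrow> bool" where
  "tilted_shift M T l c \<longleftrightarrow> prob_space M \<and> T \<in> M \<rightarrow>\<^sub>M M \<and> l \<in> borel_measurable M \<and>
     density M (\<lambda>x. ennreal (exp (l x))) = distr M M T \<and>
     integrable M (\<lambda>x. l (T x)) \<and> (\<integral>x. l (T x) \<partial>M) = c"

text \<open>Jensen's inequality by integrating the tangent of exp at the mean of \<open>Y\<close>.
  Only the case of a finite right-hand side needs an argument, and there exp of \<open>Y\<close> is
  integrable.\<close>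

lemma (in prob_space) exp_integral_le:
  assumes "integrable M Y"
  shows "ennreal (exp (\<integral>x. Y x \<partial>M)) \<le> (\<integral>\<^sup>+x. ennreal (exp (Y x)) \<partial>M)"
proof (cases "(\<integral>\<^sup>+x. ennreal (exp (Y x)) \<partial>M) = \<infinity>")
  case False
  define a where "a = (\<integral>x. Y x \<partial>M)"
  have [measurable]: "Y \<in> borel_measurable M" using assms by simp
  have int: "integrable M (\<lambda>x. exp (Y x))"
    by (rule integrableI_nonneg) (use False in \<open>auto simp: less_top\<close>)
  have "exp a = (\<integral>x. exp a * (1 + (Y x - a)) \<partial>M)"
    using assms by (simp add: a_def prob_space)
  also have "\<dots> \<le> (\<integral>x. exp (Y x) \<partial>M)"
  proof (rule integral_mono)
    fix x
    have "exp a * (1 + (Y x - a)) \<le> exp a * exp (Y x - a)"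
      by (intro mult_left_mono exp_ge_add_one_self) auto
    then show "exp a * (1 + (Y x - a)) \<le> exp (Y x)" by (simp flip: exp_add)
  qed (use assms int in auto)
  finally have "exp a \<le> (\<integral>x. exp (Y x) \<partial>M)" .
  then show ?thesis
    using int by (simp add: a_def nn_integral_eq_integral)
qed simp

text \<open>Jensen's inequality after the change of measure is the variational (Donsker--Varadhan)
  inequality, with \<open>c\<close> the relative entropy of the shifted measure.\<close>

lemma tilted_shift_variational:
  assumes s: "tilted_shift M T l c" and [measurable]: "F \<in> borel_measurable M"
    and int: "integrable M (\<lambda>x. F (T x))"
  shows "ennreal (exp ((\<integral>x. F (T x) \<partial>M) - c)) \<le> (\<integral>\<^sup>+x. ennreal (exp (F x)) \<partial>M)"
proof -
  interpret prob_space M using s by (simp add: tilted_shift_def)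
  have [measurable]: "T \<in> M \<rightarrow>\<^sub>M M" "l \<in> borel_measurable M"
    and d: "density M (\<lambda>x. ennreal (exp (l x))) = distr M M T"
    and il: "integrable M (\<lambda>x. l (T x))" and c: "(\<integral>x. l (T x) \<partial>M) = c"
    using s by (auto simp: tilted_shift_def)
  have "exp ((\<integral>x. F (T x) \<partial>M) - c) = exp (\<integral>x. (F (T x) - l (T x)) \<partial>M)"
    using int il c by simp
  also have "ennreal \<dots> \<le> (\<integral>\<^sup>+x. ennreal (exp (F (T x) - l (T x))) \<partial>M)"
    by (rule exp_integral_le) (use int il in auto)
  also have "\<dots> = (\<integral>\<^sup>+x. ennreal (exp (F x - l x)) \<partial>distr M M T)"
    by (simp add: nn_integral_distr)
  also have "\<dots> = (\<integral>\<^sup>+x. ennreal (exp (l x)) * ennreal (exp (F x - l x)) \<partial>M)"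
    unfolding d[symmetric] by (simp add: nn_integral_density)
  also have "\<dots> = (\<integral>\<^sup>+x. ennreal (exp (F x)) \<partial>M)"
    by (simp flip: ennreal_mult exp_add)
  finally show ?thesis .
qed

text \<open>The density of a probability measure has total mass 1. For Gaussian shifts this is the
  formula for the moment generating function, and \<open>gauss_moment\<close> uses it in that
  way.\<close>

lemma tilted_shift_nn_integral_exp:
  assumes "tilted_shift M T l c"
  shows "(\<integral>\<^sup>+x. ennreal (exp (l x)) \<partial>M) = 1"
proof -
  interpret prob_space M using assms by (simp add: tilted_shift_def)
  have [measurable]: "T \<in> M \<rightarrow>\<^sub>M M" "l \<in> borel_measurable M"
    and d: "density M (\<lambda>x. ennreal (exp (l x))) = distr M M T"
    using assms by (auto simp: tilted_shift_def)
  have "(\<integral>\<^sup>+x. ennreal (exp (l x)) \<partial>M) = emeasure (density M (\<lambda>x. ennreal (exp (l x)))) (space M)"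
    by (simp add: emeasure_density cong: nn_integral_cong)
  also have "\<dots> = 1"
    unfolding d using prob_space.emeasure_space_1[OF prob_space_distr[of T M]] by simp
  finally show ?thesis .
qed

text \<open>Log densities of independent coordinates add, and so do relative entropies. The tilted
  product and the image of the product under the coordinatewise map are both identified with the
  product of the shifted factors, by agreement on boxes.\<close>

lemma tilted_shift_PiM:
  assumes fin: "finite I" and s: "\<And>i. i \<in> I \<Longrightarrow> tilted_shift M (T i) (l i) (c i)" and M: "prob_space M"
  shows "tilted_shift (PiM I (\<lambda>_. M)) (\<lambda>x. \<lambda>i\<in>I. T i (x i)) (\<lambda>x. \<Sum>i\<in>I. l i (x i)) (\<Sum>i\<in>I. c i)"
proof -
  interpret prob_space M by fact
  interpret product_prob_space "\<lambda>_. M" I ..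
  let ?P = "PiM I (\<lambda>_. M)"
  have T[measurable]: "T i \<in> M \<rightarrow>\<^sub>M M" and l[measurable]: "l i \<in> borel_measurable M"
    and d: "density M (\<lambda>x. ennreal (exp (l i x))) = distr M M (T i)"
    and il: "integrable M (\<lambda>x. l i (T i x))" and c: "(\<integral>x. l i (T i x) \<partial>M) = c i" if "i \<in> I" for i
    using s[OF that] by (auto simp: tilted_shift_def)
  have P: "prob_space ?P" by (rule prob_space_PiM) (rule M)
  have TM: "(\<lambda>x. \<lambda>i\<in>I. T i (x i)) \<in> ?P \<rightarrow>\<^sub>M ?P"
    by (rule measurable_restrict) measurable
  have lM: "(\<lambda>x. \<Sum>i\<in>I. l i (x i)) \<in> borel_measurable ?P"
    by (rule borel_measurable_sum) measurable
  \<comment> \<open>Nothing is known about \<open>T i\<close> outside \<open>I\<close>, so the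
    family is padded with \<open>M\<close> to consist of probability measures at every
    index.\<close>
  let ?Q = "\<lambda>i. if i \<in> I then distr M M (T i) else M"
  have Qp: "prob_space (?Q i)" for i
    using prob_space.prob_space_distr[OF M T] M by auto
  interpret Q: product_prob_space ?Q I
    by unfold_locales (use Qp in \<open>auto simp: prob_space.emeasure_space_1 prob_space_def sigma_finite_measure_def finite_measure_def\<close>)
  have Qs: "sets (PiM I ?Q) = sets ?P"
    by (rule sets_PiM_cong) auto
  have e1: "density ?P (\<lambda>x. ennreal (exp (\<Sum>i\<in>I. l i (x i)))) = PiM I ?Q"
  proof (rule Q.PiM_eqI[OF fin])
    show "sets (density ?P (\<lambda>x. ennreal (exp (\<Sum>i\<in>I. l i (x i))))) = sets (PiM I ?Q)"
      using Qs by simp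
    fix A assume A: "\<And>i. i \<in> I \<Longrightarrow> A i \<in> sets (?Q i)"
    have A'[measurable]: "A i \<in> sets M" if "i \<in> I" for i using A[OF that] that by simp
    have AP: "Pi\<^sub>E I A \<in> sets ?P" by (rule sets_PiM_I_finite) (use fin A' in auto)
    have "emeasure (density ?P (\<lambda>x. ennreal (exp (\<Sum>i\<in>I. l i (x i))))) (Pi\<^sub>E I A)
      = (\<integral>\<^sup>+x. ennreal (exp (\<Sum>i\<in>I. l i (x i))) * indicator (Pi\<^sub>E I A) x \<partial>?P)"
      by (rule emeasure_density) (use lM AP in auto)
    also have "\<dots> = (\<integral>\<^sup>+x. (\<Prod>i\<in>I. ennreal (exp (l i (x i))) * indicator (A i) (x i)) \<partial>?P)"
    proof (rule nn_integral_cong)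
      fix x assume "x \<in> space ?P"
      then have "x \<in> extensional I" by (auto simp: space_PiM PiE_def)
      then have "indicator (Pi\<^sub>E I A) x = (\<Prod>i\<in>I. indicator (A i) (x i) :: ennreal)"
        using fin by (auto simp: indicator_def PiE_def Pi_def)
      then show "ennreal (exp (\<Sum>i\<in>I. l i (x i))) * indicator (Pi\<^sub>E I A) x
        = (\<Prod>i\<in>I. ennreal (exp (l i (x i))) * indicator (A i) (x i))"
        by (simp add: prod.distrib exp_sum[OF fin] prod_ennreal)
    qed
    also have "\<dots> = (\<Prod>i\<in>I. \<integral>\<^sup>+x. ennreal (exp (l i x)) * indicator (A i) x \<partial>M)"
      by (rule product_nn_integral_prod[OF fin]) measurable
    also have "\<dots> = (\<Prod>i\<in>I. emeasure (?Q i) (A i))"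
      by (intro prod.cong refl) (simp add: d[symmetric] emeasure_density)
    finally show "emeasure (density ?P (\<lambda>x. ennreal (exp (\<Sum>i\<in>I. l i (x i))))) (Pi\<^sub>E I A)
      = (\<Prod>i\<in>I. emeasure (?Q i) (A i))" .
  qed
  have e2: "distr ?P ?P (\<lambda>x. \<lambda>i\<in>I. T i (x i)) = PiM I ?Q"
  proof (rule Q.PiM_eqI[OF fin])
    show "sets (distr ?P ?P (\<lambda>x. \<lambda>i\<in>I. T i (x i))) = sets (PiM I ?Q)"
      using Qs by simp
    fix A assume A: "\<And>i. i \<in> I \<Longrightarrow> A i \<in> sets (?Q i)"
    have A'[measurable]: "A i \<in> sets M" if "i \<in> I" for i using A[OF that] that by simp
    have AP: "Pi\<^sub>E I A \<in> sets ?P" by (rule sets_PiM_I_finite) (use fin A' in auto)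
    have "emeasure (distr ?P ?P (\<lambda>x. \<lambda>i\<in>I. T i (x i))) (Pi\<^sub>E I A)
      = emeasure ?P ((\<lambda>x. \<lambda>i\<in>I. T i (x i)) -` (Pi\<^sub>E I A) \<inter> space ?P)"
      by (rule emeasure_distr[OF TM AP])
    also have "(\<lambda>x. \<lambda>i\<in>I. T i (x i)) -` (Pi\<^sub>E I A) \<inter> space ?P = (\<Pi>\<^sub>E i\<in>I. T i -` A i \<inter> space M)"
      by (auto simp: space_PiM PiE_def Pi_def extensional_def)
    also have "emeasure ?P \<dots> = (\<Prod>i\<in>I. emeasure M (T i -` A i \<inter> space M))"
      by (rule emeasure_PiM[OF fin]) measurable
    also have "\<dots> = (\<Prod>i\<in>I. emeasure (?Q i) (A i))"
      by (intro prod.cong refl) (simp add: emeasure_distr)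
    finally show "emeasure (distr ?P ?P (\<lambda>x. \<lambda>i\<in>I. T i (x i))) (Pi\<^sub>E I A)
      = (\<Prod>i\<in>I. emeasure (?Q i) (A i))" .
  qed
  have comp: "integrable ?P (\<lambda>x. l i (T i (x i)))" "(\<integral>x. l i (T i (x i)) \<partial>?P) = c i" if i: "i \<in> I" for i
  proof -
    have D: "distr ?P M (\<lambda>x. x i) = M" by (rule PiM_component[OF i])
    have m: "(\<lambda>x. x i) \<in> ?P \<rightarrow>\<^sub>M M" using i by measurable
    have m2: "(\<lambda>y. l i (T i y)) \<in> borel_measurable M" using i by measurable
    show "integrable ?P (\<lambda>x. l i (T i (x i)))"
      using integrable_distr_eq[OF m m2] il[OF i] D by simp
    show "(\<integral>x. l i (T i (x i)) \<partial>?P) = c i"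
      using integral_distr[OF m m2] c[OF i] D by simp
  qed
  show ?thesis
    unfolding tilted_shift_def using P TM lM e1 e2 comp by (simp add: fin cong: sum.cong)
qed

section \<open>Standard Gaussian vectors: shifts and moments\<close>

abbreviation std_normal :: "real measure" where
  "std_normal \<equiv> density lborel (\<lambda>x. ennreal (std_normal_density x))"

lemma prob_space_std_normal: "prob_space std_normal"
  by (rule prob_space_normal_density) simp

lemma std_normal_moments:
  "integrable std_normal (\<lambda>x. x)" "(\<integral>x. x \<partial>std_normal) = 0"
  using integrable_std_normal_moment[of 1] integral_std_normal_moment_odd[of 0]
  by (simp_all add: integrable_density integral_density)

text \<open>Completing the square: \<open>exp (w * x - w\<^sup>2 / 2)\<close> is the density of the
  normal law with mean \<open>w\<close> relative to the centred one. At the shifted point its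
  logarithm is \<open>w\<^sup>2 / 2 + w * x\<close>, and the linear term has mean 0.\<close>

lemma tilted_shift_std_normal:
  "tilted_shift std_normal (\<lambda>x. w + x) (\<lambda>x. w * x - w\<^sup>2 / 2) (w\<^sup>2 / 2)"
proof -
  interpret prob_space std_normal by (rule prob_space_std_normal)
  have "density std_normal (\<lambda>x. ennreal (exp (w * x - w\<^sup>2 / 2))) = distr std_normal std_normal (\<lambda>x. w + x)"
  proof (rule measure_eqI)
    fix A assume "A \<in> sets (density std_normal (\<lambda>x. ennreal (exp (w * x - w\<^sup>2 / 2))))"
    then have A[measurable]: "A \<in> sets borel" by simp
    have "emeasure (distr std_normal std_normal (\<lambda>x. w + x)) A
        = (\<integral>\<^sup>+x. indicator A x \<partial>distr std_normal std_normal (\<lambda>x. w + x))"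
      by simp
    also have "\<dots> = (\<integral>\<^sup>+x. indicator A (w + x) \<partial>std_normal)"
      by (rule nn_integral_distr) measurable
    also have "\<dots> = (\<integral>\<^sup>+x. ennreal (std_normal_density x) * indicator A (w + x) \<partial>lborel)"
      by (simp add: nn_integral_density)
    also have "\<dots> = (\<integral>\<^sup>+x. ennreal (std_normal_density (x - w)) * indicator A x \<partial>lborel)"
      by (subst nn_integral_real_affine[where c=1 and t=w
            and f="\<lambda>x. ennreal (std_normal_density (x - w)) * indicator A x"]) auto
    also have "\<dots> = (\<integral>\<^sup>+x. ennreal (std_normal_density x) * (ennreal (exp (w * x - w\<^sup>2 / 2)) * indicator A x) \<partial>lborel)"
    proof (rule nn_integral_cong)
      fix x
      have "std_normal_density (x - w) = std_normal_density x * exp (w * x - w\<^sup>2 / 2)"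
        by (simp add: std_normal_density_def power2_eq_square field_simps flip: exp_add)
      then show "ennreal (std_normal_density (x - w)) * indicator A x
        = ennreal (std_normal_density x) * (ennreal (exp (w * x - w\<^sup>2 / 2)) * indicator A x)"
        by (simp add: ennreal_mult mult.assoc)
    qed
    also have "\<dots> = emeasure (density std_normal (\<lambda>x. ennreal (exp (w * x - w\<^sup>2 / 2)))) A"
      by (subst emeasure_density) (auto simp: nn_integral_density)
    finally show "emeasure (density std_normal (\<lambda>x. ennreal (exp (w * x - w\<^sup>2 / 2)))) A
      = emeasure (distr std_normal std_normal (\<lambda>x. w + x)) A" ..
  qed simp
  moreover have "(\<lambda>x. w * (w + x) - w\<^sup>2 / 2) = (\<lambda>x. w\<^sup>2 / 2 + w * x)"
    by (auto simp: algebra_simps power2_eq_square)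
  moreover have "integrable std_normal (\<lambda>x. w\<^sup>2 / 2 + w * x)"
    by (intro Bochner_Integration.integrable_add integrable_mult_right std_normal_moments(1) integrable_const)
  moreover have "(\<integral>x. w\<^sup>2 / 2 + w * x \<partial>std_normal) = w\<^sup>2 / 2"
  proof -
    have "(\<integral>x. w\<^sup>2 / 2 + w * x \<partial>std_normal) = (\<integral>x. w\<^sup>2 / 2 \<partial>std_normal) + (\<integral>x. w * x \<partial>std_normal)"
      by (intro Bochner_Integration.integral_add integrable_mult_right std_normal_moments(1) integrable_const)
    also have "\<dots> = w\<^sup>2 / 2"
      unfolding integral_mult_right_zero std_normal_moments(2) lebesgue_integral_const prob_space by simp
    finally show ?thesis .
  qed
  moreover have "(\<lambda>x. w + x) \<in> std_normal \<rightarrow>\<^sub>M std_normal"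
    "(\<lambda>x. w * x - w\<^sup>2 / 2) \<in> borel_measurable std_normal"
    by measurable
  ultimately show ?thesis
    unfolding tilted_shift_def using prob_space_std_normal by (intro conjI) (simp_all only:)
qed

abbreviation gauss :: "nat \<Rightarrow> (nat \<Rightarrow> real) measure" where
  "gauss d \<equiv> PiM {..<d} (\<lambda>_. std_normal)"

lemma sets_gauss [measurable_cong]: "sets (gauss d) = sets (euclid d)"
  by (rule sets_PiM_cong) auto

lemma prob_space_gauss: "prob_space (gauss d)"
  by (rule prob_space_PiM) (rule prob_space_std_normal)

lemma tilted_shift_gauss:
  "tilted_shift (gauss d) (\<lambda>g. \<lambda>i\<in>{..<d}. w i + g i) (\<lambda>g. ip d w g - ip d w w / 2) (ip d w w / 2)"
proof -
  have *: "(\<lambda>g. ip d w g - ip d w w / 2) = (\<lambda>g. \<Sum>i<d. w i * g i - (w i)\<^sup>2 / 2)"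
    "ip d w w / 2 = (\<Sum>i<d. (w i)\<^sup>2 / 2)"
    by (auto simp: ip_def sum_subtractf sum_divide_distrib power2_eq_square)
  show ?thesis
    unfolding *(1) unfolding *(2)
    by (rule tilted_shift_PiM) (auto intro: tilted_shift_std_normal prob_space_std_normal)
qed

lemma measurable_ip [measurable]:
  "f \<in> M \<rightarrow>\<^sub>M euclid d \<Longrightarrow> g \<in> M \<rightarrow>\<^sub>M euclid d \<Longrightarrow> (\<lambda>x. ip d (f x) (g x)) \<in> borel_measurable M"
  unfolding ip_def
  by (intro borel_measurable_sum borel_measurable_times)
     (auto intro: measurable_compose[OF _ measurable_component_singleton])

lemma measurable_ip_const [measurable]:
  "f \<in> M \<rightarrow>\<^sub>M euclid d \<Longrightarrow> (\<lambda>x. ip d (f x) v) \<in> borel_measurable M"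
  "f \<in> M \<rightarrow>\<^sub>M euclid d \<Longrightarrow> (\<lambda>x. ip d v (f x)) \<in> borel_measurable M"
  unfolding ip_def
  by (intro borel_measurable_sum borel_measurable_times borel_measurable_const;
      auto intro: measurable_compose[OF _ measurable_component_singleton])+

lemma gauss_coordinate:
  assumes "i < d"
  shows "integrable (gauss d) (\<lambda>g. g i)" "(\<integral>g. g i \<partial>gauss d) = 0"
proof -
  have D: "distr (gauss d) std_normal (\<lambda>x. x i) = std_normal"
    by (rule distr_PiM_component) (use assms prob_space_std_normal in auto)
  have m: "(\<lambda>x. x i) \<in> gauss d \<rightarrow>\<^sub>M std_normal"
    by (rule measurable_component_singleton) (use assms in simp)
  have "integrable (distr (gauss d) std_normal (\<lambda>x. x i)) (\<lambda>x. x)"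
    unfolding D by (rule std_normal_moments)
  then show "integrable (gauss d) (\<lambda>g. g i)"
    by (rule integrable_distr[OF m])
  have "(\<integral>g. g i \<partial>gauss d) = (\<integral>x. x \<partial>distr (gauss d) std_normal (\<lambda>x. x i))"
    by (rule integral_distr[symmetric, OF m]) measurable
  also have "\<dots> = 0"
    unfolding D by (rule std_normal_moments)
  finally show "(\<integral>g. g i \<partial>gauss d) = 0" .
qed

lemma gauss_ip:
  "integrable (gauss d) (\<lambda>g. ip d u g)" "(\<integral>g. ip d u g \<partial>gauss d) = 0"
proof -
  show "integrable (gauss d) (\<lambda>g. ip d u g)"
    unfolding ip_def by (intro Bochner_Integration.integrable_sum integrable_mult_right gauss_coordinate) simp
  show "(\<integral>g. ip d u g \<partial>gauss d) = 0"
    unfolding ip_def by (subst Bochner_Integration.integral_sum)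
      (auto intro!: integrable_mult_right gauss_coordinate simp: gauss_coordinate)
qed

text \<open>One term of the exponential series is at most the whole. This is the source of the
  factorials in all later constants.\<close>

lemma power_le_fact_exp:
  assumes "(0::real) \<le> y"
  shows "y ^ n \<le> fact n * exp y"
proof -
  have s: "(\<lambda>k. y ^ k /\<^sub>R fact k) sums exp y" by (rule exp_converges)
  have "(\<Sum>k\<in>{n}. y ^ k /\<^sub>R fact k) \<le> exp y"
    unfolding sums_unique[OF s] by (rule sum_le_suminf) (use assms s in \<open>auto simp: sums_iff\<close>)
  then show ?thesis by (simp add: field_simps)
qed

text \<open>A crude constant is enough. After normalising \<open>u\<close>, the power y^(2k) is at
  most (2k)! * exp |y|, and exp |y| is at most exp y + exp (-y). Both exponentials have mean exp
  (1/2) \<le> 2, which gives the 4.\<close>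

lemma gauss_moment:
  "(\<integral>\<^sup>+g. ennreal ((ip d u g) ^ (2 * k)) \<partial>gauss d) \<le> ennreal (4 * fact (2 * k) * (ip d u u) ^ k)"
proof (cases "ip d u u = 0")
  case True
  then have "u i = 0" if "i < d" for i
    using that unfolding ip_def by (subst (asm) sum_nonneg_eq_0_iff) auto
  then have z: "ip d u g = 0" for g by (simp add: ip_def)
  show ?thesis
    using prob_space.emeasure_space_1[OF prob_space_gauss] by (cases k) (auto simp: z intro!: ennreal_leI)
next
  case False
  define c where "c = sqrt (ip d u u)"
  have nn: "0 \<le> ip d u u" by (auto simp: ip_def intro!: sum_nonneg)
  have c: "c > 0" "c\<^sup>2 = ip d u u" using False nn by (auto simp: c_def)
  have mgf: "(\<integral>\<^sup>+g. ennreal (exp (ip d w g)) \<partial>gauss d) = ennreal (exp (ip d w w / 2))" for w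
  proof -
    have [measurable]: "(\<lambda>g. ip d w g) \<in> borel_measurable (gauss d)" by measurable
    have "(\<integral>\<^sup>+g. ennreal (exp (ip d w g)) \<partial>gauss d)
      = (\<integral>\<^sup>+g. ennreal (exp (ip d w w / 2)) * ennreal (exp (ip d w g - ip d w w / 2)) \<partial>gauss d)"
      by (simp flip: ennreal_mult exp_add)
    also have "\<dots> = ennreal (exp (ip d w w / 2))"
      using tilted_shift_nn_integral_exp[OF tilted_shift_gauss[of d w]] by (subst nn_integral_cmult) auto
    finally show ?thesis .
  qed
  define a where "a = (\<lambda>i. u i / c)"
  define b where "b = (\<lambda>i. - u i / c)"
  have ab: "ip d a g = ip d u g / c" "ip d b g = - (ip d u g / c)" for g
    by (auto simp: a_def b_def ip_def sum_divide_distrib sum_negf)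
  have aa: "ip d a a = 1" "ip d b b = 1"
    using False c by (auto simp: a_def b_def ip_def sum_divide_distrib[symmetric] power2_eq_square field_simps)
  have e2: "exp (1/2::real) \<le> 2"
  proof -
    have "exp (1/2::real) ^ 2 = exp 1" by (simp flip: exp_of_nat_mult)
    also have "\<dots> \<le> 2 ^ 2" using exp_le by simp
    finally show ?thesis by (rule power2_le_imp_le) simp
  qed
  have pt: "(ip d u g) ^ (2 * k) \<le> c ^ (2 * k) * fact (2 * k) * (exp (ip d a g) + exp (ip d b g))" for g
  proof -
    let ?y = "\<bar>ip d u g / c\<bar>"
    have "(ip d u g) ^ (2 * k) = c ^ (2 * k) * ?y ^ (2 * k)"
      using c by (simp add: power_divide power_even_abs)
    also have "c ^ (2 * k) * ?y ^ (2 * k) \<le> c ^ (2 * k) * (fact (2 * k) * exp ?y)"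
      using c by (intro mult_left_mono power_le_fact_exp) auto
    also have "\<dots> \<le> c ^ (2 * k) * (fact (2 * k) * (exp (ip d a g) + exp (ip d b g)))"
      using c by (intro mult_left_mono) (auto simp: ab abs_if)
    finally show ?thesis using c by (simp add: mult.assoc)
  qed
  have [measurable]: "(\<lambda>g. ip d w g) \<in> borel_measurable (gauss d)" for w by measurable
  have "(\<integral>\<^sup>+g. ennreal ((ip d u g) ^ (2 * k)) \<partial>gauss d)
     \<le> (\<integral>\<^sup>+g. ennreal (c ^ (2 * k) * fact (2 * k)) * (ennreal (exp (ip d a g)) + ennreal (exp (ip d b g))) \<partial>gauss d)"
  proof (rule nn_integral_mono)
    fix g
    have "ennreal ((ip d u g) ^ (2 * k)) \<le> ennreal (c ^ (2 * k) * fact (2 * k) * (exp (ip d a g) + exp (ip d b g)))"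
      by (rule ennreal_leI) (rule pt)
    also have "\<dots> = ennreal (c ^ (2 * k) * fact (2 * k)) * ennreal (exp (ip d a g) + exp (ip d b g))"
      by (rule ennreal_mult) (use c in auto)
    also have "ennreal (exp (ip d a g) + exp (ip d b g)) = ennreal (exp (ip d a g)) + ennreal (exp (ip d b g))"
      by (rule ennreal_plus) auto
    finally show "ennreal ((ip d u g) ^ (2 * k)) \<le> ennreal (c ^ (2 * k) * fact (2 * k)) * (ennreal (exp (ip d a g)) + ennreal (exp (ip d b g)))" .
  qed
  also have "\<dots> = ennreal (c ^ (2 * k) * fact (2 * k)) * (ennreal (exp (1/2)) + ennreal (exp (1/2)))"
    by (subst nn_integral_cmult, measurable, subst nn_integral_add, measurable) (simp add: mgf aa)
  also have "\<dots> = ennreal (c ^ (2 * k) * fact (2 * k) * (2 * exp (1/2)))"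
    using c(1) by (simp flip: ennreal_plus ennreal_mult)
  also have "\<dots> \<le> ennreal (4 * fact (2 * k) * (ip d u u) ^ k)"
  proof (rule ennreal_leI)
    have "c ^ (2 * k) * fact (2 * k) * (2 * exp (1/2)) \<le> c ^ (2 * k) * fact (2 * k) * (2 * 2)"
      using c e2 by (intro mult_left_mono) auto
    then show "c ^ (2 * k) * fact (2 * k) * (2 * exp (1/2)) \<le> 4 * fact (2 * k) * (ip d u u) ^ k"
      unfolding power_mult[of c 2 k] c(2) by (simp add: mult_ac)
  qed
  finally show ?thesis .
qed

section \<open>Subgaussian laws\<close>

lemma (in prob_space) indep_vars_measurable:
  assumes "indep_vars M' X I" "i \<in> I"
  shows "X i \<in> M \<rightarrow>\<^sub>M M' i"
proof -
  from assms(1) have "\<forall>i\<in>I. X i \<in> M \<rightarrow>\<^sub>M M' i"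
    unfolding indep_vars_def by (rule conjunct1)
  from this assms(2) show ?thesis by (rule bspec)
qed

text \<open>By Tonelli \<open>g\<close> can be frozen first; for fixed \<open>g\<close> the
  exponential of the sum factors over the independent sample, so a bound on one factor that is
  uniform in \<open>g\<close> suffices. Since \<open>G\<close> will be the centred Gaussian, which
  knows nothing of the direction v, this single moment serves all directions.\<close>

lemma (in prob_space) nn_integral_exp_sum_iid:
  assumes I: "finite I" and indep: "indep_vars (\<lambda>_. N) X I"
    and law: "\<And>i. i \<in> I \<Longrightarrow> distr M N (X i) = P"
    and G: "prob_space G" and f[measurable]: "f \<in> borel_measurable (N \<Otimes>\<^sub>M G)"
    and bound: "\<And>g. g \<in> space G \<Longrightarrow> (\<integral>\<^sup>+x. ennreal (exp (f (x, g))) \<partial>P) \<le> ennreal B"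
    and B: "0 \<le> B"
  shows "(\<integral>\<^sup>+\<omega>. \<integral>\<^sup>+g. ennreal (exp (\<Sum>i\<in>I. f (X i \<omega>, g))) \<partial>G \<partial>M) \<le> ennreal (B ^ card I)"
proof -
  interpret G: prob_space G by fact
  interpret pair_sigma_finite M G ..
  have X: "X i \<in> M \<rightarrow>\<^sub>M N" if "i \<in> I" for i
    by (rule indep_vars_measurable[OF indep that])
  have fX: "(\<lambda>z. f (X i (fst z), snd z)) \<in> borel_measurable (M \<Otimes>\<^sub>M G)" if "i \<in> I" for i
    by (rule measurable_compose[OF _ f]) (use X[OF that] in measurable)
  have m: "(\<lambda>z. ennreal (exp (\<Sum>i\<in>I. f (X i (fst z), snd z)))) \<in> borel_measurable (M \<Otimes>\<^sub>M G)"
    using fX by (intro measurable_compose[OF _ measurable_ennreal] measurable_compose[OF _ borel_measurable_exp]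
      borel_measurable_sum)
  have "(\<integral>\<^sup>+\<omega>. \<integral>\<^sup>+g. ennreal (exp (\<Sum>i\<in>I. f (X i \<omega>, g))) \<partial>G \<partial>M)
    = (\<integral>\<^sup>+g. \<integral>\<^sup>+\<omega>. ennreal (exp (\<Sum>i\<in>I. f (X i \<omega>, g))) \<partial>M \<partial>G)"
    using Fubini'[of "\<lambda>\<omega> g. ennreal (exp (\<Sum>i\<in>I. f (X i \<omega>, g)))"] m by (simp add: split_beta')
  also have "\<dots> \<le> (\<integral>\<^sup>+g. ennreal (B ^ card I) \<partial>G)"
  proof (rule nn_integral_mono)
    fix g assume g[measurable]: "g \<in> space G"
    have fg: "(\<lambda>x. f (x, g)) \<in> borel_measurable N"
      using g by measurable
    have eg: "(\<lambda>x. ennreal (exp (f (x, g)))) \<in> N \<rightarrow>\<^sub>M borel"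
      using fg by measurable
    have "(\<integral>\<^sup>+\<omega>. ennreal (exp (\<Sum>i\<in>I. f (X i \<omega>, g))) \<partial>M)
       = (\<integral>\<^sup>+\<omega>. (\<Prod>i\<in>I. ennreal (exp (f (X i \<omega>, g)))) \<partial>M)"
      by (simp add: exp_sum[OF I] prod_ennreal)
    also have "\<dots> = (\<Prod>i\<in>I. \<integral>\<^sup>+\<omega>. ennreal (exp (f (X i \<omega>, g))) \<partial>M)"
      by (rule indep_vars_nn_integral[OF I]) (use indep_vars_compose2[OF indep eg] in auto)
    also have "\<dots> = (\<Prod>i\<in>I. \<integral>\<^sup>+x. ennreal (exp (f (x, g))) \<partial>P)"
    proof (rule prod.cong[OF refl])
      fix i assume i: "i \<in> I"
      show "(\<integral>\<^sup>+\<omega>. ennreal (exp (f (X i \<omega>, g))) \<partial>M) = (\<integral>\<^sup>+x. ennreal (exp (f (x, g))) \<partial>P)"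
        unfolding law[OF i, symmetric] by (subst nn_integral_distr[OF X[OF i]]) (use eg in auto)
    qed
    also have "\<dots> \<le> (\<Prod>i\<in>I. ennreal B)"
      by (rule prod_mono_ennreal) (rule bound[OF g])
    also have "\<dots> = ennreal (B ^ card I)"
      using B by (simp add: ennreal_power)
    finally show "(\<integral>\<^sup>+\<omega>. ennreal (exp (\<Sum>i\<in>I. f (X i \<omega>, g))) \<partial>M) \<le> ennreal (B ^ card I)" .
  qed
  also have "\<dots> = ennreal (B ^ card I)"
    by (simp add: G.emeasure_space_1)
  finally show ?thesis .
qed

lemma ip_self_nonneg [simp]: "0 \<le> ip d v v"
  by (auto simp: ip_def intro!: sum_nonneg)

lemma ip_indicator: "i < d \<Longrightarrow> ip d x (\<lambda>j. if j = i then 1 else 0) = x i"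
  by (simp add: ip_def if_distrib[of "\<lambda>y. _ * y"] sum.delta cong: if_cong)

text \<open>The \<open>Y i\<close> may be dependent: convexity of exp bounds the exponential of the
  average by the average of the exponentials.\<close>

lemma nn_integral_exp_convex_sum_le:
  assumes I: "finite I" "I \<noteq> {}" and a: "\<And>i. i \<in> I \<Longrightarrow> 0 \<le> a i" "sum a I = 1"
    and [measurable]: "\<And>i. i \<in> I \<Longrightarrow> Y i \<in> borel_measurable M"
    and bound: "\<And>i. i \<in> I \<Longrightarrow> (\<integral>\<^sup>+x. ennreal (exp (Y i x)) \<partial>M) \<le> B"
  shows "(\<integral>\<^sup>+x. ennreal (exp (\<Sum>i\<in>I. a i * Y i x)) \<partial>M) \<le> B"
proof -
  have "(\<integral>\<^sup>+x. ennreal (exp (\<Sum>i\<in>I. a i * Y i x)) \<partial>M)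
      \<le> (\<integral>\<^sup>+x. (\<Sum>i\<in>I. ennreal (a i) * ennreal (exp (Y i x))) \<partial>M)"
  proof (rule nn_integral_mono)
    fix x
    have "exp (\<Sum>i\<in>I. a i *\<^sub>R Y i x) \<le> (\<Sum>i\<in>I. a i * exp (Y i x))"
      by (rule convex_on_sum[OF I _ a(2)]) (use a exp_convex in auto)
    then have "ennreal (exp (\<Sum>i\<in>I. a i * Y i x)) \<le> ennreal (\<Sum>i\<in>I. a i * exp (Y i x))"
      by (simp add: ennreal_leI)
    also have "\<dots> = (\<Sum>i\<in>I. ennreal (a i * exp (Y i x)))"
      by (rule sum_ennreal[symmetric]) (use a in auto)
    also have "\<dots> = (\<Sum>i\<in>I. ennreal (a i) * ennreal (exp (Y i x)))"
      by (intro sum.cong refl ennreal_mult) (use a in auto)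
    finally show "ennreal (exp (\<Sum>i\<in>I. a i * Y i x)) \<le> (\<Sum>i\<in>I. ennreal (a i) * ennreal (exp (Y i x)))" .
  qed
  also have "\<dots> = (\<Sum>i\<in>I. \<integral>\<^sup>+x. ennreal (a i) * ennreal (exp (Y i x)) \<partial>M)"
    by (rule nn_integral_sum) measurable
  also have "\<dots> = (\<Sum>i\<in>I. ennreal (a i) * (\<integral>\<^sup>+x. ennreal (exp (Y i x)) \<partial>M))"
    by (intro sum.cong refl nn_integral_cmult) measurable
  also have "\<dots> \<le> (\<Sum>i\<in>I. ennreal (a i) * B)"
    by (intro sum_mono mult_left_mono bound) auto
  also have "\<dots> = ennreal (sum a I) * B"
    by (simp add: sum_distrib_right[symmetric] sum_ennreal a)
  also have "\<dots> = B" by (simp add: a)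
  finally show ?thesis .
qed

text \<open>The law of a subgaussian vector whose covariance has operator norm at most 1 and trace at
  most \<open>r\<close>. The tail condition needs no case distinction for directions of variance 0.\<close>

locale subgaussian_law = prob_space P for P :: "(nat \<Rightarrow> real) measure" +
  fixes d :: nat and K r :: real
  assumes sets_P [measurable_cong]: "sets P = sets (euclid d)"
    and d_pos: "d > 0" and K_pos: "K > 0" and r_ge_1: "r \<ge> 1"
    and variance_le: "\<And>v. (\<integral>x. (ip d x v)\<^sup>2 \<partial>P) \<le> ip d v v"
    and trace_le: "(\<Sum>i<d. \<integral>x. (x i)\<^sup>2 \<partial>P) \<le> r"
    and exp_square_le: "\<And>v s. s > 0 \<Longrightarrow> (\<integral>x. (ip d x v)\<^sup>2 \<partial>P) < s \<Longrightarrow>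
      (\<integral>\<^sup>+x. ennreal (exp ((ip d x v)\<^sup>2 / (K\<^sup>2 * s))) \<partial>P) \<le> 2"
begin

lemma nn_integral_power_le:
  assumes [measurable]: "Y \<in> borel_measurable P" and Y: "\<And>x. 0 \<le> Y x" and c: "0 < c"
    and le: "(\<integral>\<^sup>+x. ennreal (exp (Y x / c)) \<partial>P) \<le> 2"
  shows "(\<integral>\<^sup>+x. ennreal (Y x ^ k) \<partial>P) \<le> ennreal (2 * fact k * c ^ k)"
proof -
  have "(\<integral>\<^sup>+x. ennreal (Y x ^ k) \<partial>P) \<le> (\<integral>\<^sup>+x. ennreal (fact k * c ^ k) * ennreal (exp (Y x / c)) \<partial>P)"
  proof (rule nn_integral_mono)
    fix x
    have "Y x ^ k = c ^ k * (Y x / c) ^ k" using c by (simp add: power_divide)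
    also have "\<dots> \<le> c ^ k * (fact k * exp (Y x / c))"
      using c Y by (intro mult_left_mono power_le_fact_exp) auto
    finally have "ennreal (Y x ^ k) \<le> ennreal ((fact k * c ^ k) * exp (Y x / c))"
      by (simp add: ennreal_leI mult_ac)
    also have "\<dots> = ennreal (fact k * c ^ k) * ennreal (exp (Y x / c))"
      by (rule ennreal_mult) (use c in auto)
    finally show "ennreal (Y x ^ k) \<le> ennreal (fact k * c ^ k) * ennreal (exp (Y x / c))" .
  qed
  also have "\<dots> = ennreal (fact k * c ^ k) * (\<integral>\<^sup>+x. ennreal (exp (Y x / c)) \<partial>P)"
    by (rule nn_integral_cmult) measurable
  also have "\<dots> \<le> ennreal (fact k * c ^ k) * ennreal 2"
    using le by (intro mult_left_mono) auto
  also have "\<dots> = ennreal (2 * fact k * c ^ k)"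
    using c by (subst ennreal_mult[symmetric]) (auto simp: mult_ac)
  finally show ?thesis .
qed

lemma measurable_id [measurable]: "(\<lambda>x. x) \<in> P \<rightarrow>\<^sub>M euclid d"
  by measurable

lemma moment_ip_le:
  assumes "ip d v v \<le> 1"
  shows "(\<integral>\<^sup>+x. ennreal ((ip d x v) ^ (2 * k)) \<partial>P) \<le> ennreal (2 * fact k * (2 * K\<^sup>2) ^ k)"
proof -
  \<comment> \<open>\<open>exp_square_le\<close> asks for a number strictly above the variance,
    which is at most 1. Taking 2 is the origin of the factor \<open>2 * K\<^sup>2\<close>.\<close>
  have "(\<integral>x. (ip d x v)\<^sup>2 \<partial>P) < 2" using variance_le[of v] assms by simp
  then have "(\<integral>\<^sup>+x. ennreal (exp ((ip d x v)\<^sup>2 / (2 * K\<^sup>2))) \<partial>P) \<le> 2"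
    using exp_square_le[of 2 v] by (simp add: mult.commute)
  then have "(\<integral>\<^sup>+x. ennreal (((ip d x v)\<^sup>2) ^ k) \<partial>P) \<le> ennreal (2 * fact k * (2 * K\<^sup>2) ^ k)"
    using K_pos by (intro nn_integral_power_le) auto
  then show ?thesis by (simp add: power_mult)
qed

lemma integrable_square: "integrable P (\<lambda>x. (ip d x v)\<^sup>2)"
proof -
  define s where "s = (\<integral>x. (ip d x v)\<^sup>2 \<partial>P) + 1"
  have s: "s > 0" "(\<integral>x. (ip d x v)\<^sup>2 \<partial>P) < s" by (auto simp: s_def intro!: add_nonneg_pos)
  have "(\<integral>\<^sup>+x. ennreal (((ip d x v)\<^sup>2) ^ 1) \<partial>P) \<le> ennreal (2 * fact 1 * (K\<^sup>2 * s) ^ 1)"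
    using K_pos s exp_square_le[OF s] by (intro nn_integral_power_le) auto
  also have "\<dots> < \<infinity>" by simp
  finally show ?thesis by (intro integrableI_nonneg) auto
qed

text \<open>|x|^2 has exponential moments at the scale of the trace, with no factor
  \<open>d\<close>: |x|^2 divided by \<open>K\<^sup>2 * A\<close> is the convex combination, with
  weights \<open>a i / A\<close>, of the quantities
  \<open>(x i)\<^sup>2 / (K\<^sup>2 * a i)\<close>, each of which has exponential moment at most
  2.\<close>

lemma moment_norm_le:
  "(\<integral>\<^sup>+x. ennreal ((ip d x x) ^ k) \<partial>P) \<le> ennreal (2 * fact k * (2 * K\<^sup>2 * r) ^ k)"
proof -
  define e where "e i = (\<lambda>j. if j = i then 1 else 0 :: real)" for i :: nat
  have e: "ip d x (e i) = x i" if "i < d" for x i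
    unfolding e_def by (rule ip_indicator[OF that])
  \<comment> \<open>The summand \<open>r / d\<close> puts \<open>a i\<close> strictly above the
    variance, even for a degenerate coordinate, and adds only \<open>r\<close> to the sum; hence
    \<open>A \<le> 2 * r\<close>.\<close>
  define a where "a i = (\<integral>x. (x i)\<^sup>2 \<partial>P) + r / d" for i
  define A where "A = (\<Sum>i<d. a i)"
  have a: "0 < a i" "(\<integral>x. (x i)\<^sup>2 \<partial>P) < a i" for i
    using r_ge_1 d_pos by (auto simp: a_def intro!: add_nonneg_pos)
  have A0: "0 < A" unfolding A_def by (rule sum_pos) (use a d_pos in auto)
  have Ar: "A \<le> 2 * r" using trace_le d_pos by (simp add: A_def a_def sum.distrib)
  have "(\<integral>\<^sup>+x. ennreal (exp (\<Sum>i<d. (a i / A) * ((x i)\<^sup>2 / (K\<^sup>2 * a i)))) \<partial>P) \<le> 2"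
  proof (rule nn_integral_exp_convex_sum_le)
    show "(\<Sum>i<d. a i / A) = 1" using A0 by (simp add: A_def sum_divide_distrib[symmetric])
    show "0 \<le> a i / A" for i using A0 a(1)[of i] by simp
    fix i assume "i \<in> {..<d}"
    then have i: "i < d" by simp
    have "(\<lambda>x. ip d x (e i)) \<in> borel_measurable P" by measurable
    then have "(\<lambda>x. x i) \<in> borel_measurable P"
      unfolding e[OF i] .
    then show "(\<lambda>x. (x i)\<^sup>2 / (K\<^sup>2 * a i)) \<in> borel_measurable P"
      by (intro borel_measurable_divide borel_measurable_power borel_measurable_const)
    show "(\<integral>\<^sup>+x. ennreal (exp ((x i)\<^sup>2 / (K\<^sup>2 * a i))) \<partial>P) \<le> 2"
      using exp_square_le[OF a(1), of "e i" i] a(2)[of i] unfolding e[OF i] by blast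
  qed (use d_pos in auto)
  also have "(\<lambda>x. \<Sum>i<d. (a i / A) * ((x i)\<^sup>2 / (K\<^sup>2 * a i))) = (\<lambda>x. ip d x x / (K\<^sup>2 * A))"
  proof
    fix x
    have "(a i / A) * ((x i)\<^sup>2 / (K\<^sup>2 * a i)) = x i * x i / (K\<^sup>2 * A)" for i
      using a(1)[of i] by (simp add: field_simps power2_eq_square)
    then show "(\<Sum>i<d. (a i / A) * ((x i)\<^sup>2 / (K\<^sup>2 * a i))) = ip d x x / (K\<^sup>2 * A)"
      by (simp add: ip_def sum_divide_distrib)
  qed
  finally have "(\<integral>\<^sup>+x. ennreal (exp (ip d x x / (K\<^sup>2 * A))) \<partial>P) \<le> 2" .
  then have "(\<integral>\<^sup>+x. ennreal ((ip d x x) ^ k) \<partial>P) \<le> ennreal (2 * fact k * (K\<^sup>2 * A) ^ k)"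
    using K_pos A0 by (intro nn_integral_power_le) auto
  also have "\<dots> \<le> ennreal (2 * fact k * (2 * K\<^sup>2 * r) ^ k)"
    using K_pos A0 Ar by (intro ennreal_leI mult_left_mono power_mono) auto
  finally show ?thesis .
qed

end

section \<open>Large coordinates\<close>

lemma ip_shift: "ip d x (\<lambda>i\<in>{..<d}. w i + g i) = ip d x w + ip d x g"
  by (simp add: ip_def distrib_left sum.distrib)

lemma ip_scale: "ip d x (\<lambda>i. c * v i) = c * ip d x v"
  by (simp add: ip_def sum_distrib_left mult_ac)

lemma ip_scale_scale: "ip d (\<lambda>i. c * v i) (\<lambda>i. c * v i) = c\<^sup>2 * ip d v v"
  by (simp add: ip_def sum_distrib_left power2_eq_square mult_ac)

definition peak :: "real \<Rightarrow> real \<Rightarrow> real" where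
  "peak \<beta> u = (if u > \<beta> then u else 0)"

lemma peak_nonneg: "0 \<le> u \<Longrightarrow> 0 \<le> peak \<beta> u"
  by (simp add: peak_def)

lemma peak_le: "0 \<le> u \<Longrightarrow> peak \<beta> u \<le> u"
  by (simp add: peak_def)

lemma peak_mono: "0 \<le> u \<Longrightarrow> u \<le> u' \<Longrightarrow> peak \<beta> u \<le> peak \<beta> u'"
  by (simp add: peak_def)

lemma measurable_peak [measurable]: "peak \<beta> \<in> borel_measurable borel"
  unfolding peak_def by measurable

text \<open>The noise \<open>y\<close> cannot bring both |x + y| and |-x + y| below |x|, because the
  larger of the two is |x| + |y|. Whichever shift survives has numerator at least x^2 over a
  denominator at most \<open>Z\<close>.\<close>

lemma peak_max_le:
  assumes "0 \<le> Z" "a \<le> Z" "b \<le> Z" "0 < a" "0 < b"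
  shows "peak \<beta> (x\<^sup>2 / Z) \<le> peak \<beta> ((x + y)\<^sup>2 / a) + peak \<beta> ((- x + y)\<^sup>2 / b)"
proof -
  have frac: "peak \<beta> (x\<^sup>2 / Z) \<le> peak \<beta> (z\<^sup>2 / c)" if "\<bar>x\<bar> \<le> \<bar>z\<bar>" "c \<le> Z" "0 < c" for z c
    using that by (intro peak_mono frac_le) (auto simp: abs_le_square_iff)
  consider "\<bar>x\<bar> \<le> \<bar>x + y\<bar>" | "\<bar>x\<bar> \<le> \<bar>- x + y\<bar>" by linarith
  then show ?thesis
  proof cases
    case 1
    have "0 \<le> peak \<beta> ((- x + y)\<^sup>2 / b)" using assms by (intro peak_nonneg) auto
    then show ?thesis using frac[OF 1 assms(2,4)] by linarith
  next
    case 2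
    have "0 \<le> peak \<beta> ((x + y)\<^sup>2 / a)" using assms by (intro peak_nonneg) auto
    then show ?thesis using frac[OF 2 assms(3,5)] by linarith
  qed
qed

lemma sum_power_le_sqrt_power:
  fixes f :: "'b \<Rightarrow> real"
  assumes I: "finite I" and p: "2 \<le> p"
  shows "(\<Sum>i\<in>I. if Q i then \<bar>f i\<bar> ^ p else 0) \<le> sqrt (\<Sum>i\<in>I. if Q i then (f i)\<^sup>2 else 0) ^ p"
proof -
  define S where "S = (\<Sum>i\<in>I. if Q i then (f i)\<^sup>2 else 0)"
  have S0: "0 \<le> S" by (auto simp: S_def intro!: sum_nonneg)
  have "(\<Sum>i\<in>I. if Q i then \<bar>f i\<bar> ^ p else 0) \<le> (\<Sum>i\<in>I. (if Q i then (f i)\<^sup>2 else 0) * sqrt S ^ (p - 2))"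
  proof (rule sum_mono)
    fix i assume i: "i \<in> I"
    show "(if Q i then \<bar>f i\<bar> ^ p else 0) \<le> (if Q i then (f i)\<^sup>2 else 0) * sqrt S ^ (p - 2)"
    proof (cases "Q i")
      case True
      have "(if Q i then (f i)\<^sup>2 else 0) \<le> S"
        unfolding S_def by (rule member_le_sum) (use i I in auto)
      then have "\<bar>f i\<bar> \<le> sqrt S" using True real_le_rsqrt[of "\<bar>f i\<bar>" S] by simp
      then have "(f i)\<^sup>2 * \<bar>f i\<bar> ^ (p - 2) \<le> (f i)\<^sup>2 * sqrt S ^ (p - 2)"
        by (intro mult_left_mono power_mono) auto
      moreover have "\<bar>f i\<bar> ^ p = (f i)\<^sup>2 * \<bar>f i\<bar> ^ (p - 2)"
        using power_add[of "\<bar>f i\<bar>" 2 "p - 2"] p by (simp only: le_add_diff_inverse power2_abs)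
      ultimately show ?thesis using True by simp
    qed simp
  qed
  also have "\<dots> = S * sqrt S ^ (p - 2)" by (simp add: S_def sum_distrib_right)
  also have "\<dots> = sqrt S ^ 2 * sqrt S ^ (p - 2)" using S0 by simp
  also have "\<dots> = sqrt S ^ p" using power_add[of "sqrt S" 2 "p - 2"] p by (simp only: le_add_diff_inverse)
  finally show ?thesis by (simp add: S_def)
qed

lemma sqrt_power_le_exp:
  assumes "0 \<le> t"
  shows "sqrt t ^ p \<le> fact p * exp (1 + t)"
proof -
  have "t \<le> (1 + t)\<^sup>2" using assms by (simp add: power2_eq_square algebra_simps)
  then have "sqrt t \<le> 1 + t" using assms by (simp add: real_le_lsqrt)
  then have "sqrt t ^ p \<le> (1 + t) ^ p" using assms by (intro power_mono) auto
  also have "\<dots> \<le> fact p * exp (1 + t)" using assms by (intro power_le_fact_exp) auto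
  finally show ?thesis .
qed

text \<open>Only the first power of exp (q - r/2) will have a controlled mean, whereas q^(p/2) has
  to be averaged. With z = q - r/2 - A * r one has q / r = 1/2 + A + z / r, and z / r \<le> max 0 z
  because r \<ge> 1. So the power costs r^(p/2) and one exponential, already discounted by exp (- (A
  * r)).\<close>

lemma sqrt_power_le_scaled_exp:
  assumes r: "1 \<le> r" and q: "0 \<le> q"
  shows "sqrt q ^ p \<le> fact p * exp (2 + A) * sqrt r ^ p * (1 + exp (- (A * r)) * exp (q - r / 2))"
proof -
  define z where "z = q - r / 2 - A * r"
  have t: "q / r = 1 / 2 + A + z / r" using r by (simp add: z_def field_simps)
  have "z / r \<le> max 0 z"
    using r mult_left_mono[of 1 r z] by (cases "0 \<le> z") (auto simp: divide_le_eq max_def divide_nonpos_pos)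
  then have "exp (1 + q / r) \<le> exp (2 + A + max 0 z)" unfolding t by simp
  also have "\<dots> = exp (2 + A) * exp (max 0 z)" by (simp add: exp_add)
  also have "\<dots> \<le> exp (2 + A) * (1 + exp z)" by (intro mult_left_mono) (auto simp: max_def)
  also have "exp z = exp (- (A * r)) * exp (q - r / 2)" by (simp add: z_def flip: exp_add)
  finally have e: "exp (1 + q / r) \<le> exp (2 + A) * (1 + exp (- (A * r)) * exp (q - r / 2))" .
  have "sqrt q ^ p = sqrt r ^ p * sqrt (q / r) ^ p"
    using r by (simp add: real_sqrt_divide power_divide)
  also have "\<dots> \<le> sqrt r ^ p * (fact p * exp (1 + q / r))"
    using r q by (intro mult_left_mono sqrt_power_le_exp) auto
  also have "\<dots> \<le> sqrt r ^ p * (fact p * (exp (2 + A) * (1 + exp (- (A * r)) * exp (q - r / 2))))"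
    using r by (intro mult_left_mono e) auto
  finally show ?thesis by (simp add: mult_ac)
qed

context subgaussian_law
begin

definition variance_along :: "(nat \<Rightarrow> real) \<Rightarrow> real" where
  "variance_along v = (\<integral>x. (ip d x v)\<^sup>2 \<partial>P)"

lemma variance_along_nonneg [simp]: "0 \<le> variance_along v"
  by (simp add: variance_along_def)

lemma measurable_variance_along [measurable]: "variance_along \<in> borel_measurable (gauss d)"
proof -
  have "(\<lambda>z. (ip d (snd z) (fst z))\<^sup>2) \<in> borel_measurable (gauss d \<Otimes>\<^sub>M P)" by measurable
  then have "(\<lambda>g. \<integral>x. (ip d x g)\<^sup>2 \<partial>P) \<in> borel_measurable (gauss d)"
    by (intro borel_measurable_lebesgue_integral) (simp add: split_beta')
  then show ?thesis by (simp add: variance_along_def[abs_def])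
qed

lemma variance_along_shift_le:
  assumes "ip d w w \<le> c"
  shows "variance_along (\<lambda>i\<in>{..<d}. w i + g i) \<le> 2 * c + 2 * variance_along g"
proof -
  have "variance_along (\<lambda>i\<in>{..<d}. w i + g i) \<le> (\<integral>x. 2 * (ip d x w)\<^sup>2 + 2 * (ip d x g)\<^sup>2 \<partial>P)"
    unfolding variance_along_def
  proof (rule integral_mono)
    fix x
    have "0 \<le> (ip d x w - ip d x g)\<^sup>2" by simp
    then show "(ip d x (\<lambda>i\<in>{..<d}. w i + g i))\<^sup>2 \<le> 2 * (ip d x w)\<^sup>2 + 2 * (ip d x g)\<^sup>2"
      unfolding ip_shift by (simp add: power2_eq_square algebra_simps)
  qed (auto intro!: integrable_square)
  also have "\<dots> = 2 * (\<integral>x. (ip d x w)\<^sup>2 \<partial>P) + 2 * variance_along g"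
    by (simp add: integrable_square variance_along_def)
  finally show ?thesis using variance_le[of w] assms by linarith
qed

text \<open>By Tonelli the Gaussian mean may be taken first for fixed x. There
  \<open>gauss_moment\<close> with exponent 2 gives 8 * |x|^2 (the exact value is |x|^2), and |x|^2
  has mean at most \<open>r\<close>.\<close>

lemma variance_along_gauss:
  "integrable (gauss d) variance_along" "(\<integral>g. variance_along g \<partial>gauss d) \<le> 8 * r"
proof -
  interpret G: prob_space "gauss d" by (rule prob_space_gauss)
  interpret pair_sigma_finite P "gauss d" ..
  have int: "integrable P (\<lambda>x. (x i)\<^sup>2)" if "i < d" for i
    using integrable_square[of "\<lambda>j. if j = i then 1 else 0"] by (simp only: ip_indicator[OF that])
  have sq: "ip d x x = (\<Sum>i<d. (x i)\<^sup>2)" for x by (simp add: ip_def power2_eq_square)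
  have intsq: "integrable P (\<lambda>x. ip d x x)"
    unfolding sq by (rule Bochner_Integration.integrable_sum) (use int in auto)
  have "(\<integral>x. ip d x x \<partial>P) \<le> r"
    unfolding sq using trace_le by (subst Bochner_Integration.integral_sum) (use int in auto)
  then have n: "(\<integral>\<^sup>+x. ennreal (ip d x x) \<partial>P) \<le> ennreal r"
    by (subst nn_integral_eq_integral[OF intsq]) (auto intro: ennreal_leI)
  have [measurable]: "(\<lambda>x. ip d x x) \<in> borel_measurable P" by measurable
  have m: "(\<lambda>z. ennreal ((ip d (fst z) (snd z))\<^sup>2)) \<in> borel_measurable (P \<Otimes>\<^sub>M gauss d)" by measurable
  have "(\<integral>\<^sup>+g. ennreal (variance_along g) \<partial>gauss d)
      = (\<integral>\<^sup>+g. \<integral>\<^sup>+x. ennreal ((ip d x g)\<^sup>2) \<partial>P \<partial>gauss d)"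
    unfolding variance_along_def
    by (intro nn_integral_cong nn_integral_eq_integral[symmetric]) (auto intro: integrable_square)
  also have "\<dots> = (\<integral>\<^sup>+x. \<integral>\<^sup>+g. ennreal ((ip d x g)\<^sup>2) \<partial>gauss d \<partial>P)"
    using Fubini'[of "\<lambda>x g. ennreal ((ip d x g)\<^sup>2)"] m by (simp add: split_beta')
  also have "\<dots> \<le> (\<integral>\<^sup>+x. ennreal 8 * ennreal (ip d x x) \<partial>P)"
    using gauss_moment[of d _ 1] by (intro nn_integral_mono) (simp add: ennreal_mult)
  also have "\<dots> = ennreal 8 * (\<integral>\<^sup>+x. ennreal (ip d x x) \<partial>P)"
    by (rule nn_integral_cmult) measurable
  also have "\<dots> \<le> ennreal 8 * ennreal r" by (rule mult_left_mono[OF n]) simp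
  also have "\<dots> = ennreal (8 * r)" using r_ge_1 by (simp add: ennreal_mult)
  finally have le: "(\<integral>\<^sup>+g. ennreal (variance_along g) \<partial>gauss d) \<le> ennreal (8 * r)" .
  have "(\<integral>\<^sup>+g. ennreal (variance_along g) \<partial>gauss d) < \<infinity>"
    by (rule order_le_less_trans[OF le]) simp
  then show i: "integrable (gauss d) variance_along"
    by (intro integrableI_nonneg measurable_variance_along AE_I2 variance_along_nonneg)
  show "(\<integral>g. variance_along g \<partial>gauss d) \<le> 8 * r"
    using le r_ge_1 by (simp add: nn_integral_eq_integral[OF i])
qed

text \<open>The normalisation by \<open>r + variance_along g\<close> keeps the exponential moment finite for every \<open>g\<close>,
  although \<open>variance_along g\<close> is unbounded.\<close>

definition peak_energy :: "real \<Rightarrow> (nat \<Rightarrow> real) \<Rightarrow> (nat \<Rightarrow> real) \<Rightarrow> real" where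
  "peak_energy \<beta> x g = peak \<beta> ((ip d x g)\<^sup>2 / (r + variance_along g)) / (2 * K\<^sup>2)"

lemma measurable_peak_energy:
  assumes f: "f \<in> M \<rightarrow>\<^sub>M euclid d" and g: "g \<in> M \<rightarrow>\<^sub>M gauss d"
  shows "(\<lambda>z. peak_energy \<beta> (f z) (g z)) \<in> borel_measurable M"
proof -
  have g': "g \<in> M \<rightarrow>\<^sub>M euclid d"
    using g by (simp only: measurable_cong_sets[OF refl sets_gauss])
  show ?thesis
    unfolding peak_energy_def
    by (intro borel_measurable_divide measurable_compose[OF _ measurable_peak] borel_measurable_power
      borel_measurable_add borel_measurable_const measurable_ip[OF f g']
      measurable_compose[OF g measurable_variance_along])
qed

lemma measurable_peak_energy_fixed: "peak_energy \<beta> x \<in> borel_measurable (gauss d)"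
proof -
  have id: "(\<lambda>g. g) \<in> gauss d \<rightarrow>\<^sub>M euclid d" by measurable
  have "(\<lambda>g. peak \<beta> ((ip d x g)\<^sup>2 / (r + variance_along g)) / (2 * K\<^sup>2)) \<in> borel_measurable (gauss d)"
    by (intro borel_measurable_divide measurable_compose[OF _ measurable_peak] borel_measurable_power
      borel_measurable_add borel_measurable_const measurable_variance_along measurable_ip_const(2)[OF id])
  then show ?thesis unfolding peak_energy_def[abs_def] .
qed

text \<open>Half of the admissible exponent is sacrificed. For u > \<beta> one has \<open>exp (u /
  (2 * K\<^sup>2)) \<le> exp (- \<beta> / (2 * K\<^sup>2)) * exp (u / K\<^sup>2)\<close>, and
  otherwise the energy is 0, so the exponential moment exceeds 1 only by an exponentially small
  amount. Since r \<ge> 1, the normaliser lies strictly above the variance, as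
  \<open>exp_square_le\<close> demands.\<close>

lemma nn_integral_exp_peak_energy_le:
  "(\<integral>\<^sup>+x. ennreal (exp (peak_energy \<beta> x g)) \<partial>P) \<le> ennreal (exp (2 * exp (- \<beta> / (2 * K\<^sup>2))))"
proof -
  let ?u = "\<lambda>x. (ip d x g)\<^sup>2 / (r + variance_along g)"
  have s: "r + variance_along g > 0" using r_ge_1 by (intro add_pos_nonneg) auto
  have pt: "exp (peak_energy \<beta> x g) \<le> 1 + exp (- \<beta> / (2 * K\<^sup>2)) * exp (?u x / K\<^sup>2)" for x
  proof (cases "?u x > \<beta>")
    case True
    have "u / (2 * K\<^sup>2) \<le> - \<beta> / (2 * K\<^sup>2) + u / K\<^sup>2" if "u > \<beta>" for u
      using that K_pos by (simp add: field_simps)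
    from this[OF True] have "?u x / (2 * K\<^sup>2) \<le> - \<beta> / (2 * K\<^sup>2) + ?u x / K\<^sup>2" .
    then have "exp (?u x / (2 * K\<^sup>2)) \<le> exp (- \<beta> / (2 * K\<^sup>2)) * exp (?u x / K\<^sup>2)"
      by (simp flip: exp_add)
    then show ?thesis using True by (simp add: peak_energy_def peak_def)
  qed (simp add: peak_energy_def peak_def)
  have m: "(\<lambda>x. exp (?u x / K\<^sup>2)) \<in> borel_measurable P" by measurable
  have "(\<integral>\<^sup>+x. ennreal (exp (?u x / K\<^sup>2)) \<partial>P) \<le> 2"
    using exp_square_le[OF s, of g] r_ge_1 by (simp add: variance_along_def mult.commute)
  then have le: "ennreal (exp (- \<beta> / (2 * K\<^sup>2))) * (\<integral>\<^sup>+x. ennreal (exp (?u x / K\<^sup>2)) \<partial>P)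
      \<le> ennreal (exp (- \<beta> / (2 * K\<^sup>2))) * ennreal 2"
    by (intro mult_left_mono) auto
  have "(\<integral>\<^sup>+x. ennreal (exp (peak_energy \<beta> x g)) \<partial>P)
    \<le> (\<integral>\<^sup>+x. 1 + ennreal (exp (- \<beta> / (2 * K\<^sup>2))) * ennreal (exp (?u x / K\<^sup>2)) \<partial>P)"
  proof (rule nn_integral_mono)
    fix x
    have "ennreal (exp (peak_energy \<beta> x g)) \<le> ennreal (1 + exp (- \<beta> / (2 * K\<^sup>2)) * exp (?u x / K\<^sup>2))"
      by (rule ennreal_leI) (rule pt)
    then show "ennreal (exp (peak_energy \<beta> x g)) \<le> 1 + ennreal (exp (- \<beta> / (2 * K\<^sup>2))) * ennreal (exp (?u x / K\<^sup>2))"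
      by (simp add: ennreal_mult)
  qed
  also have "\<dots> = 1 + ennreal (exp (- \<beta> / (2 * K\<^sup>2))) * (\<integral>\<^sup>+x. ennreal (exp (?u x / K\<^sup>2)) \<partial>P)"
    using m by (subst nn_integral_add; simp add: nn_integral_cmult emeasure_space_1)
  also have "\<dots> \<le> 1 + ennreal (exp (- \<beta> / (2 * K\<^sup>2))) * ennreal 2"
    by (rule add_left_mono[OF le])
  also have "\<dots> = ennreal (1 + 2 * exp (- \<beta> / (2 * K\<^sup>2)))"
    by (subst ennreal_mult[symmetric]) (auto simp: mult.commute)
  also have "\<dots> \<le> ennreal (exp (2 * exp (- \<beta> / (2 * K\<^sup>2))))"
    by (intro ennreal_leI exp_ge_add_one_self)
  finally show ?thesis .
qed

lemma integrable_square_gauss: "integrable (gauss d) (\<lambda>g. (a + ip d x g)\<^sup>2)"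
proof -
  have "(\<integral>\<^sup>+g. ennreal ((ip d x g)\<^sup>2) \<partial>gauss d) < \<infinity>"
    using order_le_less_trans[OF gauss_moment[of d x 1], of \<infinity>] by simp
  then have "integrable (gauss d) (\<lambda>g. (ip d x g)\<^sup>2)"
    by (intro integrableI_nonneg) auto
  moreover have "integrable (gauss d) (\<lambda>_. a\<^sup>2)"
    using prob_space.finite_measure[OF prob_space_gauss] by (simp add: finite_measure.integrable_const)
  ultimately have "integrable (gauss d) (\<lambda>g. a\<^sup>2 + 2 * a * ip d x g + (ip d x g)\<^sup>2)"
    by (intro Bochner_Integration.integrable_add integrable_mult_right gauss_ip)
  then show ?thesis by (simp add: power2_eq_square algebra_simps)
qed

lemma integrable_peak_energy_shift:
  "integrable (gauss d) (\<lambda>g. peak_energy \<beta> x (\<lambda>i\<in>{..<d}. w i + g i))"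
proof (rule Bochner_Integration.integrable_bound)
  show "integrable (gauss d) (\<lambda>g. (ip d x w + ip d x g)\<^sup>2 / (2 * K\<^sup>2))"
    by (intro integrable_divide integrable_square_gauss)
  have T: "(\<lambda>g. \<lambda>i\<in>{..<d}. w i + g i) \<in> gauss d \<rightarrow>\<^sub>M gauss d"
    using tilted_shift_gauss by (simp add: tilted_shift_def)
  show "(\<lambda>g. peak_energy \<beta> x (\<lambda>i\<in>{..<d}. w i + g i)) \<in> borel_measurable (gauss d)"
    by (rule measurable_compose[OF T measurable_peak_energy_fixed])
  show "AE g in gauss d. norm (peak_energy \<beta> x (\<lambda>i\<in>{..<d}. w i + g i)) \<le> norm ((ip d x w + ip d x g)\<^sup>2 / (2 * K\<^sup>2))"
  proof (rule AE_I2)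
    fix g
    let ?n = "r + variance_along (\<lambda>i\<in>{..<d}. w i + g i)"
    have n: "1 \<le> ?n" using r_ge_1 by (intro add_increasing2) auto
    have "peak \<beta> ((ip d x w + ip d x g)\<^sup>2 / ?n) \<le> (ip d x w + ip d x g)\<^sup>2 / ?n"
      using n by (intro peak_le divide_nonneg_pos) auto
    also have "\<dots> \<le> (ip d x w + ip d x g)\<^sup>2" using n divide_left_mono[OF n, of "(ip d x w + ip d x g)\<^sup>2"] by simp
    finally show "norm (peak_energy \<beta> x (\<lambda>i\<in>{..<d}. w i + g i)) \<le> norm ((ip d x w + ip d x g)\<^sup>2 / (2 * K\<^sup>2))"
      using n by (simp add: peak_energy_def ip_shift divide_right_mono peak_nonneg)
  qed
qed

text \<open>If \<open>variance_along g \<le> 16 * r\<close>, then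
  \<open>variance_along_shift_le\<close> bounds both normalisers by r + 2 * r + 32 * r = 35 * r, and
  \<open>peak_max_le\<close> applies with the opposite shifts. Such \<open>g\<close> are frequent
  enough to keep half of the value.\<close>

lemma peak_le_integral_peak_energy:
  assumes v: "ip d v v = 1"
  defines "w \<equiv> \<lambda>i. sqrt r * v i" and "w' \<equiv> \<lambda>i. - sqrt r * v i"
  shows "peak \<beta> ((ip d x v)\<^sup>2 / 35) / (4 * K\<^sup>2) \<le>
    (\<integral>g. peak_energy \<beta> x (\<lambda>i\<in>{..<d}. w i + g i) \<partial>gauss d) + (\<integral>g. peak_energy \<beta> x (\<lambda>i\<in>{..<d}. w' i + g i) \<partial>gauss d)"
proof -
  interpret G: prob_space "gauss d" by (rule prob_space_gauss)
  define c where "c = peak \<beta> ((ip d x v)\<^sup>2 / 35) / (2 * K\<^sup>2)"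
  have c0: "0 \<le> c" unfolding c_def by (intro divide_nonneg_nonneg peak_nonneg) auto
  have ww: "ip d w w \<le> r" "ip d w' w' \<le> r"
    using r_ge_1 v by (simp_all only: w_def w'_def ip_scale_scale) auto
  \<comment> \<open>The affine weight stands in for the indicator of
    \<open>variance_along g \<le> 16 * r\<close>: it is at most 1 there and negative elsewhere. Its
    mean is at least 1/2, because \<open>variance_along\<close> has mean at most
    \<open>8 * r\<close>.\<close>
  have pt: "c * (1 - variance_along g / (16 * r)) \<le> peak_energy \<beta> x (\<lambda>i\<in>{..<d}. w i + g i) + peak_energy \<beta> x (\<lambda>i\<in>{..<d}. w' i + g i)" (is "_ \<le> ?R") for g
  proof (cases "variance_along g \<le> 16 * r")
    case False
    then have "1 - variance_along g / (16 * r) \<le> 0" using r_ge_1 by (simp add: field_simps)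
    then have "c * (1 - variance_along g / (16 * r)) \<le> 0" using c0 by (rule mult_nonneg_nonpos[rotated])
    also have "0 \<le> ?R"
      unfolding peak_energy_def using r_ge_1
      by (intro add_nonneg_nonneg divide_nonneg_nonneg peak_nonneg) auto
    finally show ?thesis .
  next
    case True
    let ?a = "r + variance_along (\<lambda>i\<in>{..<d}. w i + g i)" and ?b = "r + variance_along (\<lambda>i\<in>{..<d}. w' i + g i)"
    have ab: "?a \<le> 35 * r" "?b \<le> 35 * r" "0 < ?a" "0 < ?b"
      using variance_along_shift_le[OF ww(1), of g] variance_along_shift_le[OF ww(2), of g] True r_ge_1
      by (auto intro: add_pos_nonneg)
    have "peak \<beta> ((sqrt r * ip d x v)\<^sup>2 / (35 * r)) \<le>
      peak \<beta> ((sqrt r * ip d x v + ip d x g)\<^sup>2 / ?a) + peak \<beta> ((- (sqrt r * ip d x v) + ip d x g)\<^sup>2 / ?b)"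
      by (rule peak_max_le) (use ab r_ge_1 in auto)
    also have "(sqrt r * ip d x v)\<^sup>2 / (35 * r) = (ip d x v)\<^sup>2 / 35"
      using r_ge_1 by (simp add: power_mult_distrib)
    finally have "c \<le> (peak \<beta> ((sqrt r * ip d x v + ip d x g)\<^sup>2 / ?a) + peak \<beta> ((- (sqrt r * ip d x v) + ip d x g)\<^sup>2 / ?b)) / (2 * K\<^sup>2)"
      unfolding c_def by (rule divide_right_mono) simp
    also have "\<dots> = ?R"
      unfolding peak_energy_def ip_shift add_divide_distrib w_def w'_def ip_scale
      by (simp only: mult_minus_left)
    finally have "c \<le> ?R" .
    moreover have "c * (1 - variance_along g / (16 * r)) \<le> c * 1"
      using c0 r_ge_1 by (intro mult_left_mono) auto
    ultimately show ?thesis by simp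
  qed
  have i1: "integrable (gauss d) (\<lambda>g. c * (1 - variance_along g / (16 * r)))"
    using variance_along_gauss(1) by (intro integrable_mult_right Bochner_Integration.integrable_diff integrable_divide) auto
  have "c / 2 \<le> c * (1 - (\<integral>g. variance_along g \<partial>gauss d) / (16 * r))"
  proof -
    have "1 / 2 \<le> 1 - (\<integral>g. variance_along g \<partial>gauss d) / (16 * r)"
      using variance_along_gauss(2) r_ge_1 by (simp add: field_simps)
    then have "c * (1 / 2) \<le> c * (1 - (\<integral>g. variance_along g \<partial>gauss d) / (16 * r))"
      using c0 by (rule mult_left_mono)
    then show ?thesis by simp
  qed
  also have "\<dots> = (\<integral>g. c * (1 - variance_along g / (16 * r)) \<partial>gauss d)"
    using variance_along_gauss(1) by (simp add: G.prob_space)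
  also have "\<dots> \<le> (\<integral>g. peak_energy \<beta> x (\<lambda>i\<in>{..<d}. w i + g i) + peak_energy \<beta> x (\<lambda>i\<in>{..<d}. w' i + g i) \<partial>gauss d)"
    by (intro integral_mono i1 Bochner_Integration.integrable_add integrable_peak_energy_shift pt)
  also have "\<dots> = (\<integral>g. peak_energy \<beta> x (\<lambda>i\<in>{..<d}. w i + g i) \<partial>gauss d) + (\<integral>g. peak_energy \<beta> x (\<lambda>i\<in>{..<d}. w' i + g i) \<partial>gauss d)"
    by (intro Bochner_Integration.integral_add integrable_peak_energy_shift)
  finally show ?thesis by (simp add: c_def)
qed

end

section \<open>Large projections summed over the sample\<close>

locale subgaussian_sample = subgaussian_law P d K r + S: prob_space M
  for P :: "(nat \<Rightarrow> real) measure" and d :: nat and K r :: real and M :: "'a measure" +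
  fixes N :: nat and Xs :: "nat \<Rightarrow> 'a \<Rightarrow> nat \<Rightarrow> real"
  assumes N_pos: "N > 0" and indep: "S.indep_vars (\<lambda>_. euclid d) Xs {1..N}"
    and law: "\<And>i. i \<in> {1..N} \<Longrightarrow> distr M (euclid d) (Xs i) = P"
begin

lemma measurable_Xs: "i \<in> {1..N} \<Longrightarrow> Xs i \<in> M \<rightarrow>\<^sub>M euclid d"
  by (rule S.indep_vars_measurable[OF indep])

text \<open>Summing \<open>peak_le_integral_peak_energy\<close> over the sample bounds the total for
  the two opposite shifts together, so one of them carries at least half; hence 8 instead of 4.
  Which one may depend on \<open>v\<close> and \<omega>, but both have entropy r/2 and the same
  right-hand side.\<close>

lemma exp_peak_energy_ge:
  assumes v: "ip d v v = 1"
  shows "ennreal (exp ((\<Sum>i=1..N. peak \<beta> ((ip d (Xs i \<omega>) v)\<^sup>2 / 35)) / (8 * K\<^sup>2) - r / 2))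
    \<le> (\<integral>\<^sup>+g. ennreal (exp (\<Sum>i=1..N. peak_energy \<beta> (Xs i \<omega>) g)) \<partial>gauss d)"
proof -
  define F where "F g = (\<Sum>i=1..N. peak_energy \<beta> (Xs i \<omega>) g)" for g
  have F: "F \<in> borel_measurable (gauss d)"
    unfolding F_def[abs_def] by (intro borel_measurable_sum measurable_peak_energy_fixed)
  define w where "w = (\<lambda>i. sqrt r * v i)"
  define w' where "w' = (\<lambda>i. - sqrt r * v i)"
  have ww: "ip d w w = r" "ip d w' w' = r"
    using r_ge_1 v by (simp_all only: w_def w'_def ip_scale_scale) auto
  define E where "E u = (\<integral>g. F (\<lambda>i\<in>{..<d}. u i + g i) \<partial>gauss d)" for u
  have E: "E u = (\<Sum>i=1..N. \<integral>g. peak_energy \<beta> (Xs i \<omega>) (\<lambda>i\<in>{..<d}. u i + g i) \<partial>gauss d)" for u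
    unfolding E_def F_def by (rule Bochner_Integration.integral_sum) (rule integrable_peak_energy_shift)
  have le: "ennreal (exp (E u - ip d u u / 2)) \<le> (\<integral>\<^sup>+g. ennreal (exp (F g)) \<partial>gauss d)" for u
    unfolding E_def
    by (rule tilted_shift_variational[OF tilted_shift_gauss F])
       (unfold F_def, intro Bochner_Integration.integrable_sum integrable_peak_energy_shift)
  define Q where "Q = (\<Sum>i=1..N. peak \<beta> ((ip d (Xs i \<omega>) v)\<^sup>2 / 35)) / (8 * K\<^sup>2)"
  have "2 * Q = (\<Sum>i=1..N. peak \<beta> ((ip d (Xs i \<omega>) v)\<^sup>2 / 35) / (4 * K\<^sup>2))"
    by (simp add: Q_def sum_divide_distrib[symmetric])
  also have "\<dots> \<le> E w + E w'"
    unfolding E sum.distrib[symmetric] w_def w'_def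
    by (intro sum_mono peak_le_integral_peak_energy v)
  finally consider "Q \<le> E w" | "Q \<le> E w'" by linarith
  then have "ennreal (exp (Q - r / 2)) \<le> (\<integral>\<^sup>+g. ennreal (exp (F g)) \<partial>gauss d)"
  proof cases
    case 1
    then show ?thesis using le[of w] ww
      by (intro order_trans[OF ennreal_leI le[of w]]) simp
  next
    case 2
    then show ?thesis using le[of w'] ww
      by (intro order_trans[OF ennreal_leI le[of w']]) simp
  qed
  then show ?thesis by (simp add: Q_def F_def)
qed

text \<open>\<open>W\<close> is the exponential moment under the centred Gaussian, discounted by exp
  (- (A * r)). The hypothesis on \<beta> says that the N-fold product of the bounds from
  \<open>nn_integral_exp_peak_energy_le\<close> is at most exp (A * r), so \<open>W\<close> has mean
  at most 1. The constant 280 is 35 * 8, from the threshold scale and the exponent in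
  \<open>exp_peak_energy_ge\<close>.\<close>

lemma peak_part_le:
  assumes p: "2 \<le> p" and \<beta>: "real N * (2 * exp (- \<beta> / (2 * K\<^sup>2))) \<le> A * r"
  obtains W where "W \<in> borel_measurable M" "(\<integral>\<^sup>+\<omega>. W \<omega> \<partial>M) \<le> 1"
    "\<And>\<omega> v. ip d v v = 1 \<Longrightarrow>
      ennreal (\<Sum>i=1..N. if (ip d (Xs i \<omega>) v)\<^sup>2 > 35 * \<beta> then \<bar>ip d (Xs i \<omega>) v\<bar> ^ p else 0)
      \<le> ennreal (sqrt (280 * K\<^sup>2) ^ p * fact p * exp (2 + A) * sqrt r ^ p) * (1 + W \<omega>)"
proof
  interpret G: prob_space "gauss d" by (rule prob_space_gauss)
  define V where "V \<omega> = (\<integral>\<^sup>+g. ennreal (exp (\<Sum>i=1..N. peak_energy \<beta> (Xs i \<omega>) g)) \<partial>gauss d)" for \<omega>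
  define W where "W \<omega> = ennreal (exp (- (A * r))) * V \<omega>" for \<omega>
  have "(\<lambda>z. ennreal (exp (\<Sum>i=1..N. peak_energy \<beta> (Xs i (fst z)) (snd z)))) \<in> borel_measurable (M \<Otimes>\<^sub>M gauss d)"
  proof -
    have "(\<lambda>z. peak_energy \<beta> (Xs i (fst z)) (snd z)) \<in> borel_measurable (M \<Otimes>\<^sub>M gauss d)" if "i \<in> {1..N}" for i
      by (rule measurable_peak_energy) (use measurable_Xs[OF that] in measurable)
    then show ?thesis
      by (intro measurable_compose[OF _ measurable_ennreal] measurable_compose[OF _ borel_measurable_exp]
        borel_measurable_sum)
  qed
  then have "(\<lambda>(\<omega>, g). ennreal (exp (\<Sum>i=1..N. peak_energy \<beta> (Xs i \<omega>) g))) \<in> borel_measurable (M \<Otimes>\<^sub>M gauss d)"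
    unfolding split_beta' .
  from G.borel_measurable_nn_integral[OF this] have V: "V \<in> borel_measurable M"
    unfolding V_def[abs_def] .
  then show "W \<in> borel_measurable M"
    unfolding W_def[abs_def] by (intro borel_measurable_times_ennreal borel_measurable_const)
  have fm: "(\<lambda>z. peak_energy \<beta> (fst z) (snd z)) \<in> borel_measurable (euclid d \<Otimes>\<^sub>M gauss d)"
    by (rule measurable_peak_energy) (rule measurable_fst, rule measurable_snd)
  have "(\<integral>\<^sup>+\<omega>. V \<omega> \<partial>M) \<le> ennreal (exp (2 * exp (- \<beta> / (2 * K\<^sup>2))) ^ card {1..N})"
    unfolding V_def
    by (rule S.nn_integral_exp_sum_iid[OF _ indep law prob_space_gauss fm, unfolded fst_conv snd_conv])
       (use nn_integral_exp_peak_energy_le in auto)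
  also have "exp (2 * exp (- \<beta> / (2 * K\<^sup>2))) ^ card {1..N} = exp (real N * (2 * exp (- \<beta> / (2 * K\<^sup>2))))"
    by (simp flip: exp_of_nat_mult)
  also have "ennreal \<dots> \<le> ennreal (exp (A * r))"
    using \<beta> by (intro ennreal_leI) simp
  finally have "(\<integral>\<^sup>+\<omega>. V \<omega> \<partial>M) \<le> ennreal (exp (A * r))" .
  then have "ennreal (exp (- (A * r))) * (\<integral>\<^sup>+\<omega>. V \<omega> \<partial>M) \<le> ennreal (exp (- (A * r))) * ennreal (exp (A * r))"
    by (rule mult_left_mono) simp
  also have "\<dots> = 1" by (simp flip: ennreal_mult exp_add)
  finally show "(\<integral>\<^sup>+\<omega>. W \<omega> \<partial>M) \<le> 1"
    unfolding W_def by (simp add: nn_integral_cmult[OF V])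
  fix \<omega> v assume v: "ip d v v = 1"
  define q where "q = (\<Sum>i=1..N. peak \<beta> ((ip d (Xs i \<omega>) v)\<^sup>2 / 35)) / (8 * K\<^sup>2)"
  have q0: "0 \<le> q" unfolding q_def by (intro divide_nonneg_nonneg sum_nonneg peak_nonneg) auto
  have "(\<Sum>i=1..N. if (ip d (Xs i \<omega>) v)\<^sup>2 > 35 * \<beta> then (ip d (Xs i \<omega>) v)\<^sup>2 else 0)
      = (\<Sum>i=1..N. 35 * peak \<beta> ((ip d (Xs i \<omega>) v)\<^sup>2 / 35))"
    by (intro sum.cong refl) (auto simp: peak_def)
  also have "\<dots> = 280 * K\<^sup>2 * q"
    using K_pos by (simp add: q_def sum_distrib_left[symmetric])
  finally have q: "(\<Sum>i=1..N. if (ip d (Xs i \<omega>) v)\<^sup>2 > 35 * \<beta> then (ip d (Xs i \<omega>) v)\<^sup>2 else 0) = 280 * K\<^sup>2 * q" .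
  let ?c = "sqrt (280 * K\<^sup>2) ^ p * fact p * exp (2 + A) * sqrt r ^ p"
  have c0: "0 \<le> ?c" using r_ge_1 by (intro mult_nonneg_nonneg) auto
  have "(\<Sum>i=1..N. if (ip d (Xs i \<omega>) v)\<^sup>2 > 35 * \<beta> then \<bar>ip d (Xs i \<omega>) v\<bar> ^ p else 0) \<le> sqrt (280 * K\<^sup>2 * q) ^ p"
    unfolding q[symmetric] by (rule sum_power_le_sqrt_power) (use p in auto)
  also have "\<dots> = sqrt (280 * K\<^sup>2) ^ p * sqrt q ^ p"
    by (simp only: real_sqrt_mult power_mult_distrib)
  also have "\<dots> \<le> sqrt (280 * K\<^sup>2) ^ p * (fact p * exp (2 + A) * sqrt r ^ p * (1 + exp (- (A * r)) * exp (q - r / 2)))"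
    by (intro mult_left_mono sqrt_power_le_scaled_exp r_ge_1 q0) auto
  finally have "ennreal (\<Sum>i=1..N. if (ip d (Xs i \<omega>) v)\<^sup>2 > 35 * \<beta> then \<bar>ip d (Xs i \<omega>) v\<bar> ^ p else 0)
      \<le> ennreal (?c * (1 + exp (- (A * r)) * exp (q - r / 2)))"
    by (intro ennreal_leI) (simp only: mult.assoc)
  also have "\<dots> = ennreal ?c * (1 + ennreal (exp (- (A * r))) * ennreal (exp (q - r / 2)))"
    using c0 by (simp add: ennreal_mult'' ennreal_mult del: exp_le_cancel_iff)
  also have "\<dots> \<le> ennreal ?c * (1 + W \<omega>)"
    unfolding W_def V_def q_def by (intro mult_left_mono add_left_mono exp_peak_energy_ge v) auto
  finally show "ennreal (\<Sum>i=1..N. if (ip d (Xs i \<omega>) v)\<^sup>2 > 35 * \<beta> then \<bar>ip d (Xs i \<omega>) v\<bar> ^ p else 0)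
      \<le> ennreal ?c * (1 + W \<omega>)" .
qed

end

section \<open>Clipped products of Gaussian perturbations\<close>

definition clip :: "real \<Rightarrow> real \<Rightarrow> real" where
  "clip L z = max (- L) (min L z)"

lemma abs_clip_le: "0 \<le> L \<Longrightarrow> \<bar>clip L z\<bar> \<le> L"
  by (auto simp: clip_def)

lemma abs_clip_le_abs: "0 \<le> L \<Longrightarrow> \<bar>clip L z\<bar> \<le> \<bar>z\<bar>"
  by (auto simp: clip_def)

lemma abs_diff_clip_le: "0 \<le> L \<Longrightarrow> \<bar>z - clip L z\<bar> \<le> (if \<bar>z\<bar> > L then \<bar>z\<bar> else 0)"
  by (auto simp: clip_def)

lemma measurable_clip [measurable]: "clip L \<in> borel_measurable borel"
  unfolding clip_def by measurable

text \<open>For negative z, (1 + z + z^2) * (1 - z) = 1 - z^3 \<ge> 1, and 1 - z \<le> exp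
  (-z).\<close>

lemma exp_le_quadratic:
  assumes "\<bar>z::real\<bar> \<le> 1"
  shows "exp z \<le> 1 + z + z\<^sup>2"
proof (cases "0 \<le> z")
  case True
  then show ?thesis using exp_bound[of z] assms by simp
next
  case False
  have "(1 + z + z\<^sup>2) * (1 - z) = 1 - z ^ 3" by (simp add: algebra_simps power2_eq_square power3_eq_cube)
  also have "z ^ 3 \<le> 0" using False by (simp add: power_le_zero_eq)
  then have "1 \<le> 1 - z ^ 3" by simp
  finally have "1 \<le> (1 + z + z\<^sup>2) * (1 - z)" .
  also have "\<dots> \<le> (1 + z + z\<^sup>2) * exp (- z)"
  proof (rule mult_left_mono)
    show "1 - z \<le> exp (- z)" using exp_ge_add_one_self[of "- z"] by simp
    show "0 \<le> 1 + z + z\<^sup>2" using assms False by simp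
  qed
  finally show ?thesis by (simp add: exp_minus field_simps)
qed

lemma (in prob_space) integrable_bounded:
  fixes f :: "'a \<Rightarrow> real"
  assumes "f \<in> borel_measurable M" "\<And>x. \<bar>f x\<bar> \<le> B"
  shows "integrable M f"
  by (rule integrable_const_bound[where B=B]) (use assms in auto)

lemma (in prob_space) abs_integral_le:
  fixes f :: "'a \<Rightarrow> real"
  assumes "f \<in> borel_measurable M" "\<And>x. \<bar>f x\<bar> \<le> B"
  shows "\<bar>\<integral>x. f x \<partial>M\<bar> \<le> B"
proof -
  have "\<bar>\<integral>x. f x \<partial>M\<bar> \<le> (\<integral>x. \<bar>f x\<bar> \<partial>M)" by (rule integral_abs_bound)
  also have "\<dots> \<le> (\<integral>x. B \<partial>M)"
    by (rule integral_mono) (use assms integrable_bounded[OF assms] in auto)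
  finally show ?thesis by (simp add: prob_space)
qed

text \<open>Integrating \<open>exp_le_quadratic\<close> bounds the exponential moment by 1 + m + q
  \<le> exp (m + q), with m and q the first two moments. Subtracting both in the exponent leaves
  exactly the bound 1, which does not deteriorate when N independent factors are multiplied.\<close>

lemma (in prob_space) nn_integral_exp_centered_le_1:
  assumes Y: "Y \<in> borel_measurable M" and bound: "\<And>x. \<bar>Y x\<bar> \<le> 1"
  shows "(\<integral>\<^sup>+x. ennreal (exp (Y x - (\<integral>x. Y x \<partial>M) - (\<integral>x. (Y x)\<^sup>2 \<partial>M))) \<partial>M) \<le> 1"
proof -
  define m where "m = (\<integral>x. Y x \<partial>M)"
  define q where "q = (\<integral>x. (Y x)\<^sup>2 \<partial>M)"
  have i1: "integrable M Y" by (rule integrable_bounded[OF Y bound])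
  have b2: "\<bar>(Y x)\<^sup>2\<bar> \<le> 1" for x using bound[of x] by (simp add: abs_square_le_1)
  have i2: "integrable M (\<lambda>x. (Y x)\<^sup>2)" by (rule integrable_bounded[OF _ b2]) (use Y in measurable)
  have "\<bar>exp (Y x)\<bar> \<le> exp 1" for x using bound[of x] by simp
  then have i3: "integrable M (\<lambda>x. exp (Y x))"
    by (intro integrable_bounded[where B="exp 1"]) (use Y in measurable)
  have "(\<integral>x. exp (Y x) \<partial>M) \<le> (\<integral>x. 1 + Y x + (Y x)\<^sup>2 \<partial>M)"
    by (rule integral_mono) (use i1 i2 i3 bound exp_le_quadratic in auto)
  also have "\<dots> = 1 + m + q" using i1 i2 by (simp add: m_def q_def prob_space)
  also have "\<dots> \<le> exp (m + q)" using exp_ge_add_one_self[of "m + q"] by (simp add: add.assoc)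
  finally have le: "(\<integral>x. exp (Y x) \<partial>M) \<le> exp (m + q)" .
  have e: "exp (Y x - m - q) = exp (- (m + q)) * exp (Y x)" for x by (simp flip: exp_add)
  have "(\<integral>x. exp (Y x - m - q) \<partial>M) = exp (- (m + q)) * (\<integral>x. exp (Y x) \<partial>M)"
    unfolding e by simp
  also have "\<dots> \<le> exp (- (m + q)) * exp (m + q)" by (rule mult_left_mono[OF le]) simp
  finally have "(\<integral>x. exp (Y x - m - q) \<partial>M) \<le> 1" by (simp flip: exp_add)
  moreover have "integrable M (\<lambda>x. exp (Y x - m - q))" unfolding e using i3 by simp
  ultimately show ?thesis
    unfolding m_def[symmetric] q_def[symmetric] by (simp add: nn_integral_eq_integral)
qed

text \<open>Every factor is at most twice the largest of |x| and the |y j|. The alternatives record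
  whether the signal or one of the noises attains the maximum, since the two are treated
  differently.\<close>

lemma abs_prod_add_le:
  fixes x :: real and y :: "nat \<Rightarrow> real"
  obtains "\<bar>\<Prod>j<p. x + y j\<bar> \<le> 2 ^ p * \<bar>x\<bar> ^ p"
  | k where "k < p" "\<bar>\<Prod>j<p. x + y j\<bar> \<le> 2 ^ p * \<bar>y k\<bar> ^ p"
proof -
  define a where "a = Max (insert \<bar>x\<bar> ((\<lambda>j. \<bar>y j\<bar>) ` {..<p}))"
  have "a \<in> insert \<bar>x\<bar> ((\<lambda>j. \<bar>y j\<bar>) ` {..<p})" unfolding a_def by (rule Max_in) auto
  then consider "a = \<bar>x\<bar>" | k where "k < p" "a = \<bar>y k\<bar>" by auto
  moreover have "\<bar>\<Prod>j<p. x + y j\<bar> \<le> 2 ^ p * a ^ p"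
  proof -
    have "\<bar>x + y j\<bar> \<le> 2 * a" if "j < p" for j
    proof -
      have "\<bar>x\<bar> \<le> a" "\<bar>y j\<bar> \<le> a" unfolding a_def using that by (auto intro!: Max_ge)
      then show ?thesis by linarith
    qed
    then have "(\<Prod>j<p. \<bar>x + y j\<bar>) \<le> (\<Prod>j<p. 2 * a)" by (intro prod_mono) auto
    then show ?thesis by (simp add: abs_prod power_mult_distrib)
  qed
  ultimately show thesis by (cases; use that in blast)
qed

text \<open>When a noise dominates, a value t > L is at most t^2 / L, which the Gaussian moments can
  average. When x dominates, the term is left as it is: it depends on the direction, and its sum
  over the sample must be bounded uniformly by the estimate for large projections.\<close>

lemma excess_prod_add_le:
  fixes x :: real and y :: "nat \<Rightarrow> real"
  assumes L: "0 < L"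
  shows "\<bar>(\<Prod>j<p. x + y j) - clip L (\<Prod>j<p. x + y j)\<bar> \<le>
    (if 2 ^ p * \<bar>x\<bar> ^ p > L then 2 ^ p * \<bar>x\<bar> ^ p else 0) + (\<Sum>j<p. 4 ^ p * y j ^ (2 * p) / L)" (is "?l \<le> ?a + ?b")
proof -
  have b0: "0 \<le> ?b" using L by (intro sum_nonneg) auto
  have a0: "0 \<le> ?a" by auto
  show ?thesis
  proof (cases "\<bar>\<Prod>j<p. x + y j\<bar> > L")
    case False
    then show ?thesis using abs_diff_clip_le[of L "\<Prod>j<p. x + y j"] L a0 b0 by simp
  next
    case True
    then have l: "?l \<le> \<bar>\<Prod>j<p. x + y j\<bar>" using abs_diff_clip_le[of L "\<Prod>j<p. x + y j"] L by simp
    show ?thesis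
    proof (rule abs_prod_add_le[where x=x and y=y and p=p])
      assume "\<bar>\<Prod>j<p. x + y j\<bar> \<le> 2 ^ p * \<bar>x\<bar> ^ p"
      then show ?thesis using True l b0 by simp
    next
      fix k assume k: "k < p" and le: "\<bar>\<Prod>j<p. x + y j\<bar> \<le> 2 ^ p * \<bar>y k\<bar> ^ p"
      define t where "t = 2 ^ p * \<bar>y k\<bar> ^ p"
      have tL: "t > L" using True le by (simp add: t_def)
      have "t \<le> t\<^sup>2 / L" using tL L by (simp add: power2_eq_square field_simps)
      also have "t\<^sup>2 = 4 ^ p * y k ^ (2 * p)"
        by (simp add: t_def power_mult_distrib power_mult[symmetric] mult.commute[of _ "2::nat"] power_even_abs)
           (simp add: power_mult)
      also have "4 ^ p * y k ^ (2 * p) / L \<le> ?b"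
        by (rule member_le_sum[of k "{..<p}" "\<lambda>j. 4 ^ p * y j ^ (2 * p) / L"]) (use k L in auto)
      finally show ?thesis using l le a0 by (simp add: t_def)
    qed
  qed
qed

lemma prod_add_square_le:
  fixes x :: real and y :: "nat \<Rightarrow> real"
  shows "(\<Prod>j<p. x + y j)\<^sup>2 \<le> 4 ^ p * x ^ (2 * p) + (\<Sum>j<p. 4 ^ p * y j ^ (2 * p))"
proof -
  have sq: "z\<^sup>2 \<le> 4 ^ p * u ^ (2 * p)" if "\<bar>z\<bar> \<le> 2 ^ p * \<bar>u\<bar> ^ p" for z u :: real
  proof -
    have "z\<^sup>2 \<le> (2 ^ p * \<bar>u\<bar> ^ p)\<^sup>2" using that power_mono[of "\<bar>z\<bar>" _ 2] by fastforce
    also have "\<dots> = 4 ^ p * u ^ (2 * p)"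
      by (simp add: power_mult_distrib power_mult[symmetric] mult.commute[of _ "2::nat"] power_even_abs)
         (simp add: power_mult)
    finally show ?thesis .
  qed
  show ?thesis
  proof (rule abs_prod_add_le[where x=x and y=y and p=p])
    assume "\<bar>\<Prod>j<p. x + y j\<bar> \<le> 2 ^ p * \<bar>x\<bar> ^ p"
    from sq[OF this] show ?thesis by (intro add_increasing2 sum_nonneg) auto
  next
    fix k assume k: "k < p" and le: "\<bar>\<Prod>j<p. x + y j\<bar> \<le> 2 ^ p * \<bar>y k\<bar> ^ p"
    note sq[OF le]
    also have "4 ^ p * y k ^ (2 * p) \<le> (\<Sum>j<p. 4 ^ p * y j ^ (2 * p))"
      by (rule member_le_sum[of k "{..<p}" "\<lambda>j. 4 ^ p * y j ^ (2 * p)"]) (use k in auto)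
    finally show ?thesis by (intro add_increasing) auto
  qed
qed

abbreviation gauss_copies :: "nat \<Rightarrow> nat \<Rightarrow> (nat \<Rightarrow> nat \<Rightarrow> real) measure" where
  "gauss_copies p d \<equiv> PiM {..<p} (\<lambda>_. gauss d)"

lemma prob_space_gauss_copies: "prob_space (gauss_copies p d)"
  by (rule prob_space_PiM) (rule prob_space_gauss)

lemma nn_integral_gauss_copies_component:
  assumes "j < p" "f \<in> borel_measurable (gauss d)"
  shows "(\<integral>\<^sup>+g. f (g j) \<partial>gauss_copies p d) = (\<integral>\<^sup>+g. f g \<partial>gauss d)"
proof -
  have D: "distr (gauss_copies p d) (gauss d) (\<lambda>x. x j) = gauss d"
    by (rule distr_PiM_component) (use assms prob_space_gauss in auto)
  have m: "(\<lambda>x. x j) \<in> gauss_copies p d \<rightarrow>\<^sub>M gauss d"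
    by (rule measurable_component_singleton) (use assms in simp)
  show ?thesis
    using nn_integral_distr[OF m, of f] assms(2) unfolding D by simp
qed

context subgaussian_law
begin

text \<open>The reference Gaussian stays standard. The division by \<open>sqrt r\<close> turns the
  shift \<open>sqrt r * v\<close> of \<open>shift_copies\<close> into \<open>v\<close> and the noise
  covariance into I/r.\<close>

definition prod_form :: "nat \<Rightarrow> (nat \<Rightarrow> real) \<Rightarrow> (nat \<Rightarrow> nat \<Rightarrow> real) \<Rightarrow> real" where
  "prod_form p x g = (\<Prod>j<p. ip d x (g j) / sqrt r)"

definition shift_copies :: "nat \<Rightarrow> (nat \<Rightarrow> real) \<Rightarrow> (nat \<Rightarrow> nat \<Rightarrow> real) \<Rightarrow> nat \<Rightarrow> nat \<Rightarrow> real" where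
  "shift_copies p v g = (\<lambda>j\<in>{..<p}. \<lambda>i\<in>{..<d}. sqrt r * v i + g j i)"

lemma prod_form_shift_copies:
  "prod_form p x (shift_copies p v g) = (\<Prod>j<p. ip d x v + ip d x (g j) / sqrt r)"
proof -
  have "sqrt r \<noteq> 0" using r_ge_1 by simp
  then show ?thesis
    unfolding prod_form_def shift_copies_def
    by (intro prod.cong refl)
       (simp only: restrict_apply' ip_shift ip_scale add_divide_distrib, simp)
qed

lemma tilted_shift_copies:
  assumes "ip d v v = 1"
  shows "tilted_shift (gauss_copies p d) (shift_copies p v)
    (\<lambda>g. \<Sum>j<p. ip d (\<lambda>i. sqrt r * v i) (g j) - r / 2) (real p * r / 2)"
proof -
  have w: "ip d (\<lambda>i. sqrt r * v i) (\<lambda>i. sqrt r * v i) = r"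
    unfolding ip_scale_scale using r_ge_1 assms by simp
  have "tilted_shift (gauss_copies p d) (\<lambda>g. \<lambda>j\<in>{..<p}. (\<lambda>g. \<lambda>i\<in>{..<d}. sqrt r * v i + g i) (g j))
    (\<lambda>g. \<Sum>j\<in>{..<p}. (\<lambda>g. ip d (\<lambda>i. sqrt r * v i) g - r / 2) (g j)) (\<Sum>j\<in>{..<p}. r / 2)"
    by (rule tilted_shift_PiM[OF finite_lessThan tilted_shift_gauss[of d "\<lambda>i. sqrt r * v i", unfolded w] prob_space_gauss])
  moreover have "(\<Sum>j\<in>{..<p}. r / 2) = real p * r / 2" by simp
  ultimately show ?thesis unfolding shift_copies_def[abs_def] by (simp only:)
qed

lemma measurable_shift_copies:
  assumes "ip d v v = 1"
  shows "shift_copies p v \<in> gauss_copies p d \<rightarrow>\<^sub>M gauss_copies p d"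
  using tilted_shift_copies[OF assms] unfolding tilted_shift_def by blast

lemma measurable_component_euclid: "j < p \<Longrightarrow> (\<lambda>g. g j) \<in> gauss_copies p d \<rightarrow>\<^sub>M euclid d"
  using measurable_component_singleton[of j "{..<p}" "\<lambda>_. gauss d"]
  by (simp only: measurable_cong_sets[OF refl sets_gauss] lessThan_iff)

lemma measurable_prod_form:
  assumes f: "f \<in> M \<rightarrow>\<^sub>M euclid d" and g: "g \<in> M \<rightarrow>\<^sub>M gauss_copies p d"
  shows "(\<lambda>z. prod_form p (f z) (g z)) \<in> borel_measurable M"
  unfolding prod_form_def
  by (intro borel_measurable_prod borel_measurable_divide borel_measurable_const measurable_ip[OF f]
    measurable_compose[OF g measurable_component_euclid]) simp

lemma measurable_prod_form_left: "prod_form p x \<in> borel_measurable (gauss_copies p d)"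
  unfolding prod_form_def[abs_def]
  by (intro borel_measurable_prod borel_measurable_divide borel_measurable_const measurable_ip_const(2)
    measurable_component_euclid) simp

lemma measurable_prod_form_right: "(\<lambda>x. prod_form p x g) \<in> borel_measurable P"
  unfolding prod_form_def[abs_def]
  by (intro borel_measurable_prod borel_measurable_divide borel_measurable_const measurable_ip_const(1) measurable_id)

text \<open>Dividing by \<open>L\<close> puts the clipped product into [-1, 1], where
  \<open>exp_le_quadratic\<close> is available; the sign \<open>s\<close> lets one exponential bound
  serve deviations in both directions.\<close>

definition score :: "nat \<Rightarrow> real \<Rightarrow> real \<Rightarrow> (nat \<Rightarrow> real) \<Rightarrow> (nat \<Rightarrow> nat \<Rightarrow> real) \<Rightarrow> real" where
  "score p L s x g = s * clip L (prod_form p x g) / L"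

lemma abs_score_le:
  assumes "0 < L" "\<bar>s\<bar> = 1"
  shows "\<bar>score p L s x g\<bar> \<le> 1"
  using assms abs_clip_le[of L "prod_form p x g"] by (simp add: score_def abs_mult)

lemma measurable_score:
  assumes f: "f \<in> M \<rightarrow>\<^sub>M euclid d" and g: "g \<in> M \<rightarrow>\<^sub>M gauss_copies p d"
  shows "(\<lambda>z. score p L s (f z) (g z)) \<in> borel_measurable M"
  unfolding score_def
  by (intro borel_measurable_times borel_measurable_divide borel_measurable_const
    measurable_compose[OF _ measurable_clip] measurable_prod_form[OF f g])

lemma measurable_score_left: "score p L s x \<in> borel_measurable (gauss_copies p d)"
  unfolding score_def[abs_def]
  by (intro borel_measurable_times borel_measurable_divide borel_measurable_const
    measurable_compose[OF _ measurable_clip] measurable_prod_form_left)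

lemma measurable_score_right: "(\<lambda>x. score p L s x g) \<in> borel_measurable P"
  unfolding score_def[abs_def]
  by (intro borel_measurable_times borel_measurable_divide borel_measurable_const
    measurable_compose[OF _ measurable_clip] measurable_prod_form_right)

definition score_mean :: "nat \<Rightarrow> real \<Rightarrow> real \<Rightarrow> (nat \<Rightarrow> nat \<Rightarrow> real) \<Rightarrow> real" where
  "score_mean p L s g = (\<integral>x. score p L s x g \<partial>P)"

definition score_square :: "nat \<Rightarrow> real \<Rightarrow> real \<Rightarrow> (nat \<Rightarrow> nat \<Rightarrow> real) \<Rightarrow> real" where
  "score_square p L s g = (\<integral>x. (score p L s x g)\<^sup>2 \<partial>P)"

lemma measurable_score_pair:
  "(\<lambda>(g, x). score p L s x g) \<in> borel_measurable (gauss_copies p d \<Otimes>\<^sub>M P)"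
proof -
  have "snd \<in> gauss_copies p d \<Otimes>\<^sub>M P \<rightarrow>\<^sub>M euclid d"
    using measurable_snd[of "gauss_copies p d" P] by (simp only: measurable_cong_sets[OF refl sets_P])
  then show ?thesis unfolding split_beta' by (rule measurable_score) (rule measurable_fst)
qed

lemma measurable_score_mean: "score_mean p L s \<in> borel_measurable (gauss_copies p d)"
  unfolding score_mean_def[abs_def] by (rule borel_measurable_lebesgue_integral[OF measurable_score_pair])

lemma measurable_score_square: "score_square p L s \<in> borel_measurable (gauss_copies p d)"
proof -
  have "(\<lambda>(g, x). (score p L s x g)\<^sup>2) \<in> borel_measurable (gauss_copies p d \<Otimes>\<^sub>M P)"
    using borel_measurable_power[OF measurable_score_pair, of p L s 2] by (simp only: split_beta')
  then show ?thesis
    unfolding score_square_def[abs_def] by (rule borel_measurable_lebesgue_integral)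
qed

lemma abs_score_mean_le: "0 < L \<Longrightarrow> \<bar>s\<bar> = 1 \<Longrightarrow> \<bar>score_mean p L s g\<bar> \<le> 1"
  unfolding score_mean_def by (rule abs_integral_le[OF measurable_score_right abs_score_le])

lemma abs_score_square_le: "0 < L \<Longrightarrow> \<bar>s\<bar> = 1 \<Longrightarrow> \<bar>score_square p L s g\<bar> \<le> 1"
  unfolding score_square_def
  by (rule abs_integral_le[OF borel_measurable_power[OF measurable_score_right]])
     (use abs_score_le in \<open>simp add: abs_square_le_1\<close>)

text \<open>The two compensating terms are those of \<open>nn_integral_exp_centered_le_1\<close>,
  taken at fixed \<open>g\<close>.\<close>

definition tilt :: "nat \<Rightarrow> real \<Rightarrow> real \<Rightarrow> (nat \<Rightarrow> real) \<Rightarrow> (nat \<Rightarrow> nat \<Rightarrow> real) \<Rightarrow> real" where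
  "tilt p L s x g = score p L s x g - score_mean p L s g - score_square p L s g"

lemma nn_integral_exp_tilt_le:
  assumes "0 < L" "\<bar>s\<bar> = 1"
  shows "(\<integral>\<^sup>+x. ennreal (exp (tilt p L s x g)) \<partial>P) \<le> 1"
  unfolding tilt_def score_mean_def score_square_def
  by (rule nn_integral_exp_centered_le_1[OF measurable_score_right abs_score_le[OF assms]])

end

section \<open>Bias and second moment of the smoothed powers\<close>

definition excess :: "nat \<Rightarrow> real \<Rightarrow> real \<Rightarrow> real" where
  "excess p L u = (if 2 ^ p * \<bar>u\<bar> ^ p > L then 2 ^ p * \<bar>u\<bar> ^ p else 0)"

lemma excess_nonneg: "0 \<le> excess p L u"
  by (simp add: excess_def)

text \<open>Serves the mean over \<open>P\<close> at one fixed direction, where the 2p-th moment is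
  available. For the sample, uniformly in the direction, the excess is bounded by
  \<open>excess_sum_le\<close> instead.\<close>

lemma excess_le:
  assumes "0 < L"
  shows "excess p L u \<le> 4 ^ p * u ^ (2 * p) / L"
proof (cases "2 ^ p * \<bar>u\<bar> ^ p > L")
  case True
  define t where "t = 2 ^ p * \<bar>u\<bar> ^ p"
  have "t > L" using True by (simp add: t_def)
  then have "t \<le> t\<^sup>2 / L" using assms by (simp add: power2_eq_square field_simps)
  also have "t\<^sup>2 = 4 ^ p * u ^ (2 * p)"
    by (simp add: t_def power_mult_distrib power_mult[symmetric] mult.commute[of _ "2::nat"] power_even_abs)
       (simp add: power_mult)
  finally show ?thesis using True by (simp add: excess_def t_def)
qed (use assms in \<open>simp add: excess_def\<close>)

lemma ennreal_lincomb:
  assumes "0 \<le> a" "0 \<le> b" "0 \<le> c" "0 \<le> d"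
  shows "ennreal a * ennreal b + ennreal c * ennreal d = ennreal (a * b + c * d)"
  using assms by (simp add: ennreal_mult ennreal_plus)

text \<open>\<open>4 ^ p\<close> is the square of the factor 2^p in \<open>abs_prod_add_le\<close>,
  \<open>p\<close> counts the noises, and \<open>4 * fact (2 * p)\<close> is the constant of
  \<open>gauss_moment\<close>.\<close>

definition noise_const :: "nat \<Rightarrow> real" where
  "noise_const p = 4 ^ p * real p * (4 * fact (2 * p))"

text \<open>Signal and noise contributions, both multiplied by the common constant of
  \<open>moment_ip_le\<close> and \<open>moment_norm_le\<close>. The power r^p in the moment of
  |x|^(2p) cancels against the r^p by which the noise is divided.\<close>

definition moment_const :: "real \<Rightarrow> nat \<Rightarrow> real" where
  "moment_const K p = (4 ^ p + noise_const p) * (2 * fact p * (2 * K\<^sup>2) ^ p)"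

lemma noise_const_nonneg: "0 \<le> noise_const p"
  by (simp add: noise_const_def)

lemma moment_const_nonneg: "0 \<le> moment_const K p"
  by (simp add: moment_const_def noise_const_def)

context subgaussian_law
begin

text \<open>A bounded surrogate of <x, v>^p: without \<open>clip\<close> it would equal that power,
  by \<open>prod_form_shift_copies_integral\<close>.\<close>

definition smoothed :: "nat \<Rightarrow> real \<Rightarrow> (nat \<Rightarrow> real) \<Rightarrow> (nat \<Rightarrow> real) \<Rightarrow> real" where
  "smoothed p L v x = (\<integral>g. clip L (prod_form p x (shift_copies p v g)) \<partial>gauss_copies p d)"

lemma power_moments_le:
  assumes v: "ip d v v = 1"
  shows "(\<integral>\<^sup>+x. ennreal (4 ^ p * (ip d x v) ^ (2 * p) + noise_const p / r ^ p * (ip d x x) ^ p) \<partial>P)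
    \<le> ennreal (moment_const K p)"
proof -
  have m1: "(\<lambda>x. ennreal ((ip d x v) ^ (2 * p))) \<in> borel_measurable P"
    by (intro measurable_compose[OF _ measurable_ennreal] borel_measurable_power measurable_ip_const(1) measurable_id)
  have m2: "(\<lambda>x. ennreal ((ip d x x) ^ p)) \<in> borel_measurable P"
    by (intro measurable_compose[OF _ measurable_ennreal] borel_measurable_power measurable_ip measurable_id)
  have c: "0 \<le> noise_const p / r ^ p" using r_ge_1 noise_const_nonneg by simp
  have "(\<integral>\<^sup>+x. ennreal (4 ^ p * (ip d x v) ^ (2 * p) + noise_const p / r ^ p * (ip d x x) ^ p) \<partial>P)
    = (\<integral>\<^sup>+x. ennreal (4 ^ p) * ennreal ((ip d x v) ^ (2 * p)) + ennreal (noise_const p / r ^ p) * ennreal ((ip d x x) ^ p) \<partial>P)"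
    using c by (intro nn_integral_cong) (simp only: ennreal_mult[symmetric] ennreal_plus[symmetric]
      mult_nonneg_nonneg zero_le_power ip_self_nonneg zero_le_even_power' zero_le_numeral)
  also have "\<dots> = ennreal (4 ^ p) * (\<integral>\<^sup>+x. ennreal ((ip d x v) ^ (2 * p)) \<partial>P)
      + ennreal (noise_const p / r ^ p) * (\<integral>\<^sup>+x. ennreal ((ip d x x) ^ p) \<partial>P)"
    by (subst nn_integral_add) (intro borel_measurable_times_ennreal borel_measurable_const m1 m2
      | simp only: nn_integral_cmult[OF m1] nn_integral_cmult[OF m2])+
  also have "\<dots> \<le> ennreal (4 ^ p) * ennreal (2 * fact p * (2 * K\<^sup>2) ^ p)
      + ennreal (noise_const p / r ^ p) * ennreal (2 * fact p * (2 * K\<^sup>2 * r) ^ p)"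
    using v by (intro add_mono mult_left_mono moment_ip_le moment_norm_le) auto
  also have "\<dots> = ennreal (4 ^ p * (2 * fact p * (2 * K\<^sup>2) ^ p) + noise_const p / r ^ p * (2 * fact p * (2 * K\<^sup>2 * r) ^ p))"
    using c K_pos r_ge_1 by (intro ennreal_lincomb) auto
  also have "4 ^ p * (2 * fact p * (2 * K\<^sup>2) ^ p) + noise_const p / r ^ p * (2 * fact p * (2 * K\<^sup>2 * r) ^ p) = moment_const K p"
    using r_ge_1 by (simp add: moment_const_def power_mult_distrib field_simps)
  finally show ?thesis .
qed

text \<open>For fixed x each noise is Gaussian of variance |x|^2 / r, so its 2p-th moment is
  governed by (|x|^2 / r)^p. The factor \<open>c\<close> will be \<open>1 / L\<close> for the
  clipping error and \<open>1 / L\<^sup>2\<close> for the second moment of the score.\<close>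

lemma nn_integral_noise_le:
  assumes c: "0 \<le> c" and a: "0 \<le> a"
  shows "(\<integral>\<^sup>+g. ennreal (a + (\<Sum>j<p. 4 ^ p * (ip d x (g j) / sqrt r) ^ (2 * p) * c)) \<partial>gauss_copies p d)
    \<le> ennreal (a + noise_const p / r ^ p * (ip d x x) ^ p * c)"
proof -
  interpret G: prob_space "gauss_copies p d" by (rule prob_space_gauss_copies)
  define k where "k = 4 ^ p * c / r ^ p"
  have k: "0 \<le> k" using c r_ge_1 by (simp add: k_def)
  have term_eq: "4 ^ p * (ip d x u / sqrt r) ^ (2 * p) * c = k * (ip d x u) ^ (2 * p)" for u
  proof -
    have "sqrt r ^ (2 * p) = r ^ p" using r_ge_1 by (simp add: power_mult)
    then show ?thesis by (simp add: k_def power_divide)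
  qed
  have mg: "(\<lambda>u. ennreal ((ip d x u) ^ (2 * p))) \<in> borel_measurable (gauss d)"
    by (intro measurable_compose[OF _ measurable_ennreal] borel_measurable_power measurable_ip_const(2))
       (simp only: measurable_cong_sets[OF refl sets_gauss[symmetric]] measurable_ident_sets[OF refl, unfolded id_def])
  have m: "(\<lambda>g. ennreal (k * (ip d x (g j)) ^ (2 * p))) \<in> borel_measurable (gauss_copies p d)" if "j < p" for j
    by (intro measurable_compose[OF _ measurable_ennreal] borel_measurable_times borel_measurable_const
      borel_measurable_power measurable_ip_const(2) measurable_component_euclid that)
  have "(\<integral>\<^sup>+g. ennreal (a + (\<Sum>j<p. 4 ^ p * (ip d x (g j) / sqrt r) ^ (2 * p) * c)) \<partial>gauss_copies p d)
    = (\<integral>\<^sup>+g. ennreal a + (\<Sum>j<p. ennreal (k * (ip d x (g j)) ^ (2 * p))) \<partial>gauss_copies p d)"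
    unfolding term_eq using a k by (intro nn_integral_cong) (simp add: ennreal_plus sum_nonneg sum_ennreal)
  also have "\<dots> = ennreal a + (\<Sum>j<p. \<integral>\<^sup>+g. ennreal (k * (ip d x (g j)) ^ (2 * p)) \<partial>gauss_copies p d)"
  proof -
    have "(\<integral>\<^sup>+g. ennreal a + (\<Sum>j<p. ennreal (k * (ip d x (g j)) ^ (2 * p))) \<partial>gauss_copies p d)
      = (\<integral>\<^sup>+g. ennreal a \<partial>gauss_copies p d) + (\<integral>\<^sup>+g. (\<Sum>j<p. ennreal (k * (ip d x (g j)) ^ (2 * p))) \<partial>gauss_copies p d)"
      by (rule nn_integral_add) (intro borel_measurable_const, intro borel_measurable_sum m, simp)
    also have "(\<integral>\<^sup>+g. (\<Sum>j<p. ennreal (k * (ip d x (g j)) ^ (2 * p))) \<partial>gauss_copies p d)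
      = (\<Sum>j<p. \<integral>\<^sup>+g. ennreal (k * (ip d x (g j)) ^ (2 * p)) \<partial>gauss_copies p d)"
      by (rule nn_integral_sum) (intro m, simp)
    finally show ?thesis by (simp add: G.emeasure_space_1)
  qed
  also have "\<dots> \<le> ennreal a + (\<Sum>j<p. ennreal (k * (4 * fact (2 * p) * (ip d x x) ^ p)))"
  proof (intro add_left_mono sum_mono)
    fix j assume j: "j \<in> {..<p}"
    have "(\<integral>\<^sup>+g. ennreal (k * (ip d x (g j)) ^ (2 * p)) \<partial>gauss_copies p d)
      = (\<integral>\<^sup>+g. ennreal (k * (ip d x g) ^ (2 * p)) \<partial>gauss d)"
      using j k by (intro nn_integral_gauss_copies_component)
        (simp_all only: lessThan_iff ennreal_mult zero_le_even_power' borel_measurable_times_ennreal[OF borel_measurable_const mg])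
    also have "\<dots> = ennreal k * (\<integral>\<^sup>+g. ennreal ((ip d x g) ^ (2 * p)) \<partial>gauss d)"
      using k by (simp only: ennreal_mult zero_le_even_power' nn_integral_cmult[OF mg])
    also have "\<dots> \<le> ennreal k * ennreal (4 * fact (2 * p) * (ip d x x) ^ p)"
      by (rule mult_left_mono[OF gauss_moment]) simp
    also have "\<dots> = ennreal (k * (4 * fact (2 * p) * (ip d x x) ^ p))"
      using k by (simp add: ennreal_mult)
    finally show "(\<integral>\<^sup>+g. ennreal (k * (ip d x (g j)) ^ (2 * p)) \<partial>gauss_copies p d)
      \<le> ennreal (k * (4 * fact (2 * p) * (ip d x x) ^ p))" .
  qed
  also have "\<dots> = ennreal (a + real p * (k * (4 * fact (2 * p) * (ip d x x) ^ p)))"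
    using a k by (simp add: ennreal_plus ennreal_mult ennreal_of_nat_eq_real_of_nat)
  also have "real p * (k * (4 * fact (2 * p) * (ip d x x) ^ p)) = noise_const p / r ^ p * (ip d x x) ^ p * c"
    by (simp add: k_def noise_const_def)
  finally show ?thesis .
qed

lemma prod_form_shift_copies_integral:
  "integrable (gauss_copies p d) (\<lambda>g. prod_form p x (shift_copies p v g))"
  "(\<integral>g. prod_form p x (shift_copies p v g) \<partial>gauss_copies p d) = (ip d x v) ^ p"
proof -
  interpret G: prob_space "gauss d" by (rule prob_space_gauss)
  interpret product_sigma_finite "\<lambda>_. gauss d" ..
  have i: "integrable (gauss d) (\<lambda>u. ip d x v + ip d x u / sqrt r)"
    by (intro Bochner_Integration.integrable_add G.integrable_const integrable_divide gauss_ip)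
  have e: "(\<integral>u. ip d x v + ip d x u / sqrt r \<partial>gauss d) = ip d x v"
  proof -
    have "(\<integral>u. ip d x v + ip d x u / sqrt r \<partial>gauss d) = (\<integral>u. ip d x v \<partial>gauss d) + (\<integral>u. ip d x u / sqrt r \<partial>gauss d)"
      by (intro Bochner_Integration.integral_add G.integrable_const integrable_divide gauss_ip)
    then show ?thesis by (simp add: gauss_ip G.prob_space)
  qed
  show "integrable (gauss_copies p d) (\<lambda>g. prod_form p x (shift_copies p v g))"
    unfolding prod_form_shift_copies by (rule product_integrable_prod[OF finite_lessThan i])
  show "(\<integral>g. prod_form p x (shift_copies p v g) \<partial>gauss_copies p d) = (ip d x v) ^ p"
    unfolding prod_form_shift_copies
    by (subst product_integral_prod[OF finite_lessThan i]) (simp add: e)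
qed

text \<open>With x fixed, the clipping error is averaged over the Gaussian copies. The noise part
  becomes a multiple of |x|^(2p) and loses its dependence on v, so that only the excess is left to
  be controlled uniformly in v.\<close>

lemma abs_power_diff_smoothed_le:
  assumes v: "ip d v v = 1" and L: "0 < L"
  shows "\<bar>(ip d x v) ^ p - smoothed p L v x\<bar> \<le> excess p L (ip d x v) + noise_const p / r ^ p * (ip d x x) ^ p / L"
proof -
  interpret G: prob_space "gauss_copies p d" by (rule prob_space_gauss_copies)
  let ?H = "\<lambda>g. prod_form p x (shift_copies p v g)"
  have mH: "?H \<in> borel_measurable (gauss_copies p d)"
    by (rule measurable_compose[OF measurable_shift_copies[OF v] measurable_prod_form_left])
  have ic: "integrable (gauss_copies p d) (\<lambda>g. clip L (?H g))"
    by (rule G.integrable_bounded[where B=L, OF measurable_compose[OF mH measurable_clip] abs_clip_le]) (use L in simp)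
  have id: "integrable (gauss_copies p d) (\<lambda>g. ?H g - clip L (?H g))"
    by (intro Bochner_Integration.integrable_diff prod_form_shift_copies_integral ic)
  have "(ip d x v) ^ p - smoothed p L v x = (\<integral>g. ?H g - clip L (?H g) \<partial>gauss_copies p d)"
    unfolding smoothed_def prod_form_shift_copies_integral(2)[symmetric]
    by (intro Bochner_Integration.integral_diff[symmetric] prod_form_shift_copies_integral ic)
  then have "ennreal \<bar>(ip d x v) ^ p - smoothed p L v x\<bar> \<le> (\<integral>\<^sup>+g. ennreal \<bar>?H g - clip L (?H g)\<bar> \<partial>gauss_copies p d)"
    using integral_norm_bound_ennreal[OF id] by (simp only: real_norm_def)
  also have "\<dots> \<le> (\<integral>\<^sup>+g. ennreal (excess p L (ip d x v) + (\<Sum>j<p. 4 ^ p * (ip d x (g j) / sqrt r) ^ (2 * p) * (1 / L))) \<partial>gauss_copies p d)"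
  proof (intro nn_integral_mono ennreal_leI)
    fix g
    show "\<bar>?H g - clip L (?H g)\<bar> \<le> excess p L (ip d x v) + (\<Sum>j<p. 4 ^ p * (ip d x (g j) / sqrt r) ^ (2 * p) * (1 / L))"
      using excess_prod_add_le[OF L, of "ip d x v" "\<lambda>j. ip d x (g j) / sqrt r" p]
      unfolding prod_form_shift_copies excess_def by (simp only: times_divide_eq_right mult_1_right)
  qed
  also have "\<dots> \<le> ennreal (excess p L (ip d x v) + noise_const p / r ^ p * (ip d x x) ^ p * (1 / L))"
    by (rule nn_integral_noise_le) (use L excess_nonneg in auto)
  finally show ?thesis
    using L r_ge_1 noise_const_nonneg[of p] excess_nonneg[of p L "ip d x v"]
    by (subst (asm) ennreal_le_iff) auto
qed

lemma measurable_smoothed: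
  assumes v: "ip d v v = 1"
  shows "smoothed p L v \<in> borel_measurable P"
proof -
  interpret G: prob_space "gauss_copies p d" by (rule prob_space_gauss_copies)
  have f: "fst \<in> P \<Otimes>\<^sub>M gauss_copies p d \<rightarrow>\<^sub>M euclid d"
    using measurable_fst[of P "gauss_copies p d"] by (simp only: measurable_cong_sets[OF refl sets_P])
  have "(\<lambda>z. clip L (prod_form p (fst z) (shift_copies p v (snd z)))) \<in> borel_measurable (P \<Otimes>\<^sub>M gauss_copies p d)"
    by (intro measurable_compose[OF _ measurable_clip] measurable_prod_form f
      measurable_compose[OF measurable_snd measurable_shift_copies[OF v]])
  then have "(\<lambda>(x, g). clip L (prod_form p x (shift_copies p v g))) \<in> borel_measurable (P \<Otimes>\<^sub>M gauss_copies p d)"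
    unfolding split_beta' .
  from G.borel_measurable_lebesgue_integral[OF this] show ?thesis
    unfolding smoothed_def[abs_def] .
qed

lemma abs_smoothed_le:
  assumes v: "ip d v v = 1" and L: "0 < L"
  shows "\<bar>smoothed p L v x\<bar> \<le> L"
  unfolding smoothed_def
  by (rule prob_space.abs_integral_le[OF prob_space_gauss_copies])
     (rule measurable_compose[OF measurable_compose[OF measurable_shift_copies[OF v] measurable_prod_form_left] measurable_clip],
      use L in \<open>simp add: abs_clip_le\<close>)

lemma integrable_ip_power:
  assumes v: "ip d v v = 1"
  shows "integrable P (\<lambda>x. (ip d x v) ^ p)"
proof (rule Bochner_Integration.integrable_bound)
  have m: "(\<lambda>x. ip d x v) \<in> borel_measurable P" by (rule measurable_ip_const(1)[OF measurable_id])
  have "(\<integral>\<^sup>+x. ennreal ((ip d x v) ^ (2 * p)) \<partial>P) \<le> ennreal (2 * fact p * (2 * K\<^sup>2) ^ p)"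
    by (rule moment_ip_le) (use v in simp)
  also have "\<dots> < \<infinity>" by simp
  finally have "integrable P (\<lambda>x. (ip d x v) ^ (2 * p))"
    by (intro integrableI_nonneg borel_measurable_power m) auto
  then show "integrable P (\<lambda>x. 1 + (ip d x v) ^ (2 * p))"
    by (intro Bochner_Integration.integrable_add integrable_const)
  show "(\<lambda>x. (ip d x v) ^ p) \<in> borel_measurable P" by (intro borel_measurable_power m)
  show "AE x in P. norm ((ip d x v) ^ p) \<le> norm (1 + (ip d x v) ^ (2 * p))"
  proof (rule AE_I2)
    fix x
    define t where "t = \<bar>ip d x v\<bar> ^ p"
    have "t\<^sup>2 = (ip d x v) ^ (2 * p)"
      by (simp add: t_def power_mult[symmetric] mult.commute[of _ "2::nat"] power_even_abs)
    moreover have "t \<le> 1 + t\<^sup>2"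
    proof -
      have "0 \<le> (t - 1)\<^sup>2" by simp
      then have "2 * t \<le> 1 + t\<^sup>2" by (simp add: power2_eq_square algebra_simps)
      moreover have "0 \<le> t" by (simp add: t_def)
      ultimately show ?thesis by linarith
    qed
    ultimately show "norm ((ip d x v) ^ p) \<le> norm (1 + (ip d x v) ^ (2 * p))"
      by (simp add: t_def power_abs)
  qed
qed

lemma abs_integral_diff_smoothed_le:
  assumes v: "ip d v v = 1" and L: "0 < L"
  shows "\<bar>(\<integral>x. (ip d x v) ^ p \<partial>P) - (\<integral>x. smoothed p L v x \<partial>P)\<bar> \<le> moment_const K p / L"
proof -
  have ism: "integrable P (smoothed p L v)"
    by (rule integrable_bounded[OF measurable_smoothed[OF v] abs_smoothed_le[OF v L]])
  have id: "integrable P (\<lambda>x. (ip d x v) ^ p - smoothed p L v x)"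
    by (intro Bochner_Integration.integrable_diff integrable_ip_power v ism)
  define Y where "Y x = 4 ^ p * (ip d x v) ^ (2 * p) + noise_const p / r ^ p * (ip d x x) ^ p" for x
  have mY: "(\<lambda>x. ennreal (Y x)) \<in> borel_measurable P"
    unfolding Y_def
    by (intro measurable_compose[OF _ measurable_ennreal] borel_measurable_add borel_measurable_times borel_measurable_const
      borel_measurable_power measurable_ip_const(1) measurable_ip measurable_id)
  have "ennreal \<bar>(\<integral>x. (ip d x v) ^ p \<partial>P) - (\<integral>x. smoothed p L v x \<partial>P)\<bar>
     = ennreal (norm (\<integral>x. (ip d x v) ^ p - smoothed p L v x \<partial>P))"
    using integrable_ip_power[OF v] ism by simp
  also have "\<dots> \<le> (\<integral>\<^sup>+x. ennreal (norm ((ip d x v) ^ p - smoothed p L v x)) \<partial>P)"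
    by (rule integral_norm_bound_ennreal[OF id])
  also have "\<dots> \<le> (\<integral>\<^sup>+x. ennreal (1 / L) * ennreal (Y x) \<partial>P)"
  proof (rule nn_integral_mono)
    fix x
    have "norm ((ip d x v) ^ p - smoothed p L v x) \<le> 1 / L * Y x"
      using abs_power_diff_smoothed_le[OF v L, of x p] excess_le[OF L, of p "ip d x v"]
      by (simp add: Y_def add_divide_distrib)
    then show "ennreal (norm ((ip d x v) ^ p - smoothed p L v x)) \<le> ennreal (1 / L) * ennreal (Y x)"
      using L by (subst ennreal_mult'[symmetric]) (auto intro: ennreal_leI)
  qed
  also have "\<dots> = ennreal (1 / L) * (\<integral>\<^sup>+x. ennreal (Y x) \<partial>P)"
    by (rule nn_integral_cmult[OF mY])
  also have "\<dots> \<le> ennreal (1 / L) * ennreal (moment_const K p)"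
    unfolding Y_def by (rule mult_left_mono[OF power_moments_le[OF v]]) simp
  also have "\<dots> = ennreal (moment_const K p / L)"
    using L moment_const_nonneg[of K p] by (simp flip: ennreal_mult)
  finally show ?thesis
    using L moment_const_nonneg[of K p] by (subst (asm) ennreal_le_iff) auto
qed

lemma integral_score_shift:
  "(\<integral>g. score p L s x (shift_copies p v g) \<partial>gauss_copies p d) = s / L * smoothed p L v x"
proof -
  have "(\<lambda>g. score p L s x (shift_copies p v g)) = (\<lambda>g. (s / L) * clip L (prod_form p x (shift_copies p v g)))"
    by (simp add: score_def)
  then show ?thesis unfolding smoothed_def by simp
qed

lemma measurable_score_shift_pair:
  assumes v: "ip d v v = 1"
  shows "(\<lambda>(x, g). score p L s x (shift_copies p v g)) \<in> borel_measurable (P \<Otimes>\<^sub>M gauss_copies p d)"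
proof -
  have f: "fst \<in> P \<Otimes>\<^sub>M gauss_copies p d \<rightarrow>\<^sub>M euclid d"
    using measurable_fst[of P "gauss_copies p d"] by (simp only: measurable_cong_sets[OF refl sets_P])
  show ?thesis
    unfolding split_beta'
    by (intro measurable_score f measurable_compose[OF measurable_snd measurable_shift_copies[OF v]])
qed

lemma integral_score_mean_shift:
  assumes v: "ip d v v = 1" and L: "0 < L" and s: "\<bar>s\<bar> = 1"
  shows "(\<integral>g. score_mean p L s (shift_copies p v g) \<partial>gauss_copies p d) = s / L * (\<integral>x. smoothed p L v x \<partial>P)"
proof -
  interpret G: prob_space "gauss_copies p d" by (rule prob_space_gauss_copies)
  interpret PG: pair_prob_space P "gauss_copies p d" ..
  have "integrable (P \<Otimes>\<^sub>M gauss_copies p d) (\<lambda>(x, g). score p L s x (shift_copies p v g))"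
    by (rule PG.integrable_bounded[where B=1, OF measurable_score_shift_pair[OF v]])
       (use abs_score_le[OF L s] in \<open>simp add: split_beta'\<close>)
  from PG.Fubini_integral[OF this]
  have "(\<integral>g. score_mean p L s (shift_copies p v g) \<partial>gauss_copies p d)
    = (\<integral>x. (\<integral>g. score p L s x (shift_copies p v g) \<partial>gauss_copies p d) \<partial>P)"
    unfolding score_mean_def .
  also have "\<dots> = s / L * (\<integral>x. smoothed p L v x \<partial>P)"
    unfolding integral_score_shift by (rule integral_mult_right_zero)
  finally show ?thesis .
qed

text \<open>Tonelli exchanges the sample point with the Gaussian copies. Clipping only shrinks the
  product, so its square is bounded by 2p-th moments of signal and noise; division by
  \<open>L\<close> in the score gives \<open>L\<^sup>2\<close>.\<close>

lemma integral_score_square_shift_le: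
  assumes v: "ip d v v = 1" and L: "0 < L" and s: "\<bar>s\<bar> = 1"
  shows "(\<integral>g. score_square p L s (shift_copies p v g) \<partial>gauss_copies p d) \<le> moment_const K p / L\<^sup>2"
proof -
  interpret G: prob_space "gauss_copies p d" by (rule prob_space_gauss_copies)
  interpret PG: pair_sigma_finite P "gauss_copies p d" ..
  have nn: "0 \<le> score_square p L s g" for g
    unfolding score_square_def by (rule integral_nonneg_AE) simp
  have m: "(\<lambda>g. score_square p L s (shift_copies p v g)) \<in> borel_measurable (gauss_copies p d)"
    by (rule measurable_compose[OF measurable_shift_copies[OF v] measurable_score_square])
  have i: "integrable (gauss_copies p d) (\<lambda>g. score_square p L s (shift_copies p v g))"
    by (rule G.integrable_bounded[OF m abs_score_square_le[OF L s]])
  have i2: "integrable P (\<lambda>x. (score p L s x g)\<^sup>2)" for g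
    by (rule integrable_bounded[where B=1, OF borel_measurable_power[OF measurable_score_right]])
       (use abs_score_le[OF L s] in \<open>simp add: abs_square_le_1\<close>)
  define Y where "Y x = 4 ^ p * (ip d x v) ^ (2 * p) + noise_const p / r ^ p * (ip d x x) ^ p" for x
  have mY: "(\<lambda>x. ennreal (Y x)) \<in> borel_measurable P"
    unfolding Y_def
    by (intro measurable_compose[OF _ measurable_ennreal] borel_measurable_add borel_measurable_times borel_measurable_const
      borel_measurable_power measurable_ip_const(1) measurable_ip measurable_id)
  have Y0: "0 \<le> Y x" for x
    unfolding Y_def using noise_const_nonneg[of p] r_ge_1 by (intro add_nonneg_nonneg mult_nonneg_nonneg) auto
  have mm: "(\<lambda>(x, g). ennreal ((score p L s x (shift_copies p v g))\<^sup>2)) \<in> borel_measurable (P \<Otimes>\<^sub>M gauss_copies p d)"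
    using measurable_compose[OF borel_measurable_power[OF measurable_score_shift_pair[OF v], of p L s 2] measurable_ennreal]
    by (simp only: split_beta')
  have inner: "(\<integral>\<^sup>+g. ennreal ((score p L s x (shift_copies p v g))\<^sup>2) \<partial>gauss_copies p d) \<le> ennreal (1 / L\<^sup>2) * ennreal (Y x)" for x
  proof -
    let ?H = "\<lambda>g. prod_form p x (shift_copies p v g)"
    have "(\<integral>\<^sup>+g. ennreal ((score p L s x (shift_copies p v g))\<^sup>2) \<partial>gauss_copies p d)
      \<le> (\<integral>\<^sup>+g. ennreal (4 ^ p * (ip d x v) ^ (2 * p) / L\<^sup>2 + (\<Sum>j<p. 4 ^ p * (ip d x (g j) / sqrt r) ^ (2 * p) * (1 / L\<^sup>2))) \<partial>gauss_copies p d)"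
    proof (intro nn_integral_mono ennreal_leI)
      fix g
      have "s\<^sup>2 = 1" using s by (metis power2_abs power_one)
      then have "(score p L s x (shift_copies p v g))\<^sup>2 = (clip L (?H g))\<^sup>2 / L\<^sup>2"
        by (simp add: score_def power_divide power_mult_distrib)
      also have "\<dots> \<le> (?H g)\<^sup>2 / L\<^sup>2"
        using abs_clip_le_abs[of L "?H g"] L by (intro divide_right_mono) (auto simp: abs_le_square_iff)
      also have "(?H g)\<^sup>2 \<le> 4 ^ p * (ip d x v) ^ (2 * p) + (\<Sum>j<p. 4 ^ p * (ip d x (g j) / sqrt r) ^ (2 * p))"
        unfolding prod_form_shift_copies by (rule prod_add_square_le)
      finally show "(score p L s x (shift_copies p v g))\<^sup>2 \<le>
         4 ^ p * (ip d x v) ^ (2 * p) / L\<^sup>2 + (\<Sum>j<p. 4 ^ p * (ip d x (g j) / sqrt r) ^ (2 * p) * (1 / L\<^sup>2))"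
        using L by (simp add: divide_right_mono add_divide_distrib sum_divide_distrib)
    qed
    also have "\<dots> \<le> ennreal (4 ^ p * (ip d x v) ^ (2 * p) / L\<^sup>2 + noise_const p / r ^ p * (ip d x x) ^ p * (1 / L\<^sup>2))"
      by (rule nn_integral_noise_le) (use L in auto)
    also have "\<dots> = ennreal (1 / L\<^sup>2 * Y x)"
      by (simp add: Y_def add_divide_distrib)
    also have "\<dots> = ennreal (1 / L\<^sup>2) * ennreal (Y x)"
      using Y0 by (intro ennreal_mult) auto
    finally show ?thesis .
  qed
  have "ennreal (\<integral>g. score_square p L s (shift_copies p v g) \<partial>gauss_copies p d)
    = (\<integral>\<^sup>+g. ennreal (score_square p L s (shift_copies p v g)) \<partial>gauss_copies p d)"
    using nn_integral_eq_integral[OF i] nn by simp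
  also have "\<dots> = (\<integral>\<^sup>+g. \<integral>\<^sup>+x. ennreal ((score p L s x (shift_copies p v g))\<^sup>2) \<partial>P \<partial>gauss_copies p d)"
    unfolding score_square_def
    by (intro nn_integral_cong nn_integral_eq_integral[symmetric] i2) auto
  also have "\<dots> = (\<integral>\<^sup>+x. \<integral>\<^sup>+g. ennreal ((score p L s x (shift_copies p v g))\<^sup>2) \<partial>gauss_copies p d \<partial>P)"
    by (rule PG.Fubini'[OF mm])
  also have "\<dots> \<le> (\<integral>\<^sup>+x. ennreal (1 / L\<^sup>2) * ennreal (Y x) \<partial>P)"
    by (intro nn_integral_mono inner)
  also have "\<dots> = ennreal (1 / L\<^sup>2) * (\<integral>\<^sup>+x. ennreal (Y x) \<partial>P)"
    by (rule nn_integral_cmult[OF mY])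
  also have "\<dots> \<le> ennreal (1 / L\<^sup>2) * ennreal (moment_const K p)"
    unfolding Y_def by (rule mult_left_mono[OF power_moments_le[OF v]]) simp
  also have "\<dots> = ennreal (moment_const K p / L\<^sup>2)"
    using L moment_const_nonneg[of K p] by (simp flip: ennreal_mult)
  finally show ?thesis
    using L moment_const_nonneg[of K p] by (subst (asm) ennreal_le_iff) auto
qed

end

lemma unit_sphere_ip: "v \<in> unit_sphere d \<Longrightarrow> ip d v v = 1"
  by (auto simp: unit_sphere_def L2_set_def ip_def power2_eq_square)

lemma abs_ip_le_L2_set:
  assumes "ip d v v = 1"
  shows "\<bar>ip d x v\<bar> \<le> L2_set x {..<d}"
proof -
  have "\<bar>ip d x v\<bar> \<le> (\<Sum>k<d. \<bar>x k\<bar> * \<bar>v k\<bar>)"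
    unfolding ip_def using sum_abs[of "\<lambda>k. x k * v k"] by (simp add: abs_mult)
  also have "\<dots> \<le> L2_set x {..<d} * L2_set v {..<d}" by (rule L2_set_mult_ineq)
  also have "L2_set v {..<d} = 1" using assms by (simp add: L2_set_def ip_def power2_eq_square)
  finally show ?thesis by simp
qed

lemma unit_sphere_nonempty:
  assumes "d > 0"
  shows "unit_sphere d \<noteq> {}"
proof -
  have "(\<lambda>i\<in>{..<d}. if i = 0 then 1 else 0 :: real) \<in> unit_sphere d"
  proof -
    have "(\<Sum>i<d. (restrict (\<lambda>i. if i = 0 then 1 else 0 :: real) {..<d} i)\<^sup>2) = (\<Sum>i<d. if i = 0 then 1 else 0)"
      by (intro sum.cong) auto
    also have "\<dots> = 1" using assms by (simp add: sum.delta)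
    finally show ?thesis by (simp add: unit_sphere_def L2_set_def)
  qed
  then show ?thesis by blast
qed

text \<open>With y the p-th root of t this bounds y^p * exp (- a * y). It shows that a threshold of
  order (N/r)^(1/p) is high enough: for t = N/r the product N * exp (- a * y) is then of order
  r.\<close>

lemma root_exp_decay:
  assumes a: "0 < a" and p: "0 < p" and t: "0 < t"
  shows "t * exp (- (a * root p t)) \<le> fact p / a ^ p"
proof -
  have y: "0 \<le> root p t" "root p t ^ p = t" using t p by (auto simp: real_root_pow_pos2)
  have "(a * root p t) ^ p \<le> fact p * exp (a * root p t)"
    by (rule power_le_fact_exp) (use a y in auto)
  then have "a ^ p * t \<le> fact p * exp (a * root p t)" by (simp add: power_mult_distrib y)
  then show ?thesis using a by (simp add: exp_minus field_simps)
qed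

lemma power_le_of_square_le_root:
  assumes p: "0 < p" and L: "0 < L" and u: "u\<^sup>2 \<le> root p (L\<^sup>2) / 4"
  shows "2 ^ p * \<bar>u\<bar> ^ p \<le> L"
proof -
  have "(2 * \<bar>u\<bar>)\<^sup>2 \<le> root p (L\<^sup>2)" using u by (simp add: power_mult_distrib)
  then have "((2 * \<bar>u\<bar>)\<^sup>2) ^ p \<le> root p (L\<^sup>2) ^ p" by (intro power_mono) auto
  also have "\<dots> = L\<^sup>2" using p L by (simp add: real_root_pow_pos2)
  finally have "((2 * \<bar>u\<bar>) ^ p)\<^sup>2 \<le> L\<^sup>2" by (simp only: power_mult[symmetric] mult.commute)
  then have "(2 * \<bar>u\<bar>) ^ p \<le> L" by (rule power2_le_imp_le) (use L in simp)
  then show ?thesis by (simp add: power_mult_distrib)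
qed

text \<open>The leading 2^p comes from \<open>excess\<close>; the rest is the constant of
  \<open>peak_part_le\<close> for the value \<open>A\<close> chosen in
  \<open>excess_sum_le\<close>.\<close>

definition peak_const :: "real \<Rightarrow> nat \<Rightarrow> real" where
  "peak_const K p = 2 ^ p * (sqrt (280 * K\<^sup>2) ^ p * fact p * exp (2 + 2 * fact p * (280 * K\<^sup>2) ^ p))"

lemma peak_const_nonneg: "0 \<le> peak_const K p"
  by (simp add: peak_const_def)

text \<open>The three moment terms are the second moment of the score, the bias of the smoothed mean
  and the noise part of the clipping error; p/2 is the entropy of the copies. The 2 and the factor 2
  of \<open>peak_const\<close> are bounds for the means of \<open>V\<close> and of 1 + W in
  \<open>deviation_envelope\<close>.\<close>

definition deviation_const :: "real \<Rightarrow> nat \<Rightarrow> real" where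
  "deviation_const K p = 3 * moment_const K p + real p / 2 + 2 + 2 * peak_const K p"

section \<open>Bounds over the sample, uniform in the direction\<close>

context subgaussian_sample
begin

lemma measurable_tilt: "(\<lambda>z. tilt p L s (fst z) (snd z)) \<in> borel_measurable (euclid d \<Otimes>\<^sub>M gauss_copies p d)"
  unfolding tilt_def
  by (intro borel_measurable_diff measurable_score measurable_fst measurable_snd
    measurable_compose[OF measurable_snd measurable_score_mean] measurable_compose[OF measurable_snd measurable_score_square])

text \<open>The variational inequality yields exp y \<le> V, where y is the deviation scaled by s /
  L minus the compensating terms and the entropy p * r/2. Using y \<le> exp y makes the bound linear
  in \<open>V\<close>, and multiplying by \<open>L\<close> undoes the scaling of the score.\<close>

lemma one_sided_bulk_le:
  assumes L: "0 < L" and s: "\<bar>s\<bar> = 1"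
  obtains V where "V \<in> borel_measurable M" "(\<integral>\<^sup>+\<omega>. V \<omega> \<partial>M) \<le> 1"
    "\<And>\<omega> v. ip d v v = 1 \<Longrightarrow>
      ennreal (s * ((\<Sum>i=1..N. smoothed p L v (Xs i \<omega>)) - real N * (\<integral>x. smoothed p L v x \<partial>P)))
      \<le> ennreal (real N * moment_const K p / L + L * (real p * r / 2)) + ennreal L * V \<omega>"
proof
  interpret G: prob_space "gauss_copies p d" by (rule prob_space_gauss_copies)
  define V where "V \<omega> = (\<integral>\<^sup>+g. ennreal (exp (\<Sum>i=1..N. tilt p L s (Xs i \<omega>) g)) \<partial>gauss_copies p d)" for \<omega>
  have "(\<lambda>z. ennreal (exp (\<Sum>i=1..N. tilt p L s (Xs i (fst z)) (snd z)))) \<in> borel_measurable (M \<Otimes>\<^sub>M gauss_copies p d)"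
  proof -
    have "(\<lambda>z. tilt p L s (Xs i (fst z)) (snd z)) \<in> borel_measurable (M \<Otimes>\<^sub>M gauss_copies p d)" if "i \<in> {1..N}" for i
      using measurable_compose[OF measurable_Pair[OF measurable_compose[OF measurable_fst measurable_Xs[OF that]] measurable_snd]
        measurable_tilt] by (simp only: fst_conv snd_conv)
    then show ?thesis
      by (intro measurable_compose[OF _ measurable_ennreal] measurable_compose[OF _ borel_measurable_exp]
        borel_measurable_sum)
  qed
  then have "(\<lambda>(\<omega>, g). ennreal (exp (\<Sum>i=1..N. tilt p L s (Xs i \<omega>) g))) \<in> borel_measurable (M \<Otimes>\<^sub>M gauss_copies p d)"
    unfolding split_beta' .
  from G.borel_measurable_nn_integral[OF this] show "V \<in> borel_measurable M"
    unfolding V_def[abs_def] .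
  have "(\<integral>\<^sup>+\<omega>. V \<omega> \<partial>M) \<le> ennreal (1 ^ card {1..N})"
    unfolding V_def
    by (rule S.nn_integral_exp_sum_iid[OF _ indep law prob_space_gauss_copies measurable_tilt, unfolded fst_conv snd_conv])
       (use nn_integral_exp_tilt_le[OF L s] in auto)
  then show "(\<integral>\<^sup>+\<omega>. V \<omega> \<partial>M) \<le> 1" by simp
  fix \<omega> v assume v: "ip d v v = 1"
  define F where "F g = (\<Sum>i=1..N. tilt p L s (Xs i \<omega>) g)" for g
  define m where "m = (\<integral>x. smoothed p L v x \<partial>P)"
  define \<Delta> where "\<Delta> = (\<Sum>i=1..N. smoothed p L v (Xs i \<omega>)) - real N * m"
  define Q where "Q = (\<integral>g. score_square p L s (shift_copies p v g) \<partial>gauss_copies p d)"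
  note T = measurable_shift_copies[OF v, of p]
  have i1: "integrable (gauss_copies p d) (\<lambda>g. score p L s x (shift_copies p v g))" for x
    by (rule G.integrable_bounded[OF measurable_compose[OF T measurable_score_left] abs_score_le[OF L s]])
  have i2: "integrable (gauss_copies p d) (\<lambda>g. score_mean p L s (shift_copies p v g))"
    by (rule G.integrable_bounded[OF measurable_compose[OF T measurable_score_mean] abs_score_mean_le[OF L s]])
  have i3: "integrable (gauss_copies p d) (\<lambda>g. score_square p L s (shift_copies p v g))"
    by (rule G.integrable_bounded[OF measurable_compose[OF T measurable_score_square] abs_score_square_le[OF L s]])
  have it: "integrable (gauss_copies p d) (\<lambda>g. tilt p L s x (shift_copies p v g))" for x
    unfolding tilt_def by (intro Bochner_Integration.integrable_diff i1 i2 i3)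
  have et: "(\<integral>g. tilt p L s x (shift_copies p v g) \<partial>gauss_copies p d) = s / L * smoothed p L v x - s / L * m - Q" for x
  proof -
    have "(\<integral>g. tilt p L s x (shift_copies p v g) \<partial>gauss_copies p d)
      = (\<integral>g. score p L s x (shift_copies p v g) - score_mean p L s (shift_copies p v g) \<partial>gauss_copies p d) - Q"
      unfolding tilt_def Q_def by (intro Bochner_Integration.integral_diff Bochner_Integration.integrable_diff i1 i2 i3)
    also have "(\<integral>g. score p L s x (shift_copies p v g) - score_mean p L s (shift_copies p v g) \<partial>gauss_copies p d)
      = s / L * smoothed p L v x - s / L * m"
      unfolding m_def integral_score_shift[symmetric] integral_score_mean_shift[OF v L s, symmetric]
      by (intro Bochner_Integration.integral_diff i1 i2)
    finally show ?thesis .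
  qed
  have mF: "F \<in> borel_measurable (gauss_copies p d)"
    unfolding F_def[abs_def] tilt_def[abs_def]
    by (intro borel_measurable_sum borel_measurable_diff measurable_score_left measurable_score_mean measurable_score_square)
  have iF: "integrable (gauss_copies p d) (\<lambda>g. F (shift_copies p v g))"
    unfolding F_def by (intro Bochner_Integration.integrable_sum it)
  have EF: "(\<integral>g. F (shift_copies p v g) \<partial>gauss_copies p d) = s / L * \<Delta> - real N * Q"
  proof -
    have "(\<integral>g. F (shift_copies p v g) \<partial>gauss_copies p d) = (\<Sum>i=1..N. s / L * smoothed p L v (Xs i \<omega>) - s / L * m - Q)"
      unfolding F_def et[symmetric] by (rule Bochner_Integration.integral_sum) (rule it)
    also have "\<dots> = s / L * \<Delta> - real N * Q"
      by (simp add: \<Delta>_def sum_subtractf sum_distrib_left[symmetric] sum_divide_distrib[symmetric] algebra_simps diff_divide_distrib)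
    finally show ?thesis .
  qed
  define y where "y = s / L * \<Delta> - real N * Q - real p * r / 2"
  have V: "ennreal (exp y) \<le> V \<omega>"
    using tilted_shift_variational[OF tilted_shift_copies[OF v] mF iF]
    unfolding EF unfolding y_def V_def F_def .
  have Q: "real N * Q \<le> real N * (moment_const K p / L\<^sup>2)"
    unfolding Q_def by (intro mult_left_mono integral_score_square_shift_le v L s) simp
  have "s / L * \<Delta> \<le> real N * (moment_const K p / L\<^sup>2) + real p * r / 2 + exp y"
    using exp_ge_add_one_self[of y] Q y_def by linarith
  then have "L * (s / L * \<Delta>) \<le> L * (real N * (moment_const K p / L\<^sup>2) + real p * r / 2 + exp y)"
    using L by (intro mult_left_mono) auto
  moreover have "L * (s / L * \<Delta>) = s * \<Delta>" using L by simp
  moreover have "L * (real N * (moment_const K p / L\<^sup>2) + real p * r / 2 + exp y)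
      = (real N * moment_const K p / L + L * (real p * r / 2)) + L * exp y"
    using L by (simp add: distrib_left power2_eq_square)
  ultimately have "s * \<Delta> \<le> (real N * moment_const K p / L + L * (real p * r / 2)) + L * exp y"
    by (simp only:)
  then have "ennreal (s * \<Delta>) \<le> ennreal ((real N * moment_const K p / L + L * (real p * r / 2)) + L * exp y)"
    by (rule ennreal_leI)
  also have "\<dots> = ennreal (real N * moment_const K p / L + L * (real p * r / 2)) + ennreal L * ennreal (exp y)"
    using L r_ge_1 moment_const_nonneg[of K p] by (simp add: ennreal_plus ennreal_mult)
  also have "\<dots> \<le> ennreal (real N * moment_const K p / L + L * (real p * r / 2)) + ennreal L * V \<omega>"
    by (intro add_left_mono mult_left_mono V) simp
  finally show "ennreal (s * ((\<Sum>i=1..N. smoothed p L v (Xs i \<omega>)) - real N * (\<integral>x. smoothed p L v x \<partial>P)))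
      \<le> ennreal (real N * moment_const K p / L + L * (real p * r / 2)) + ennreal L * V \<omega>"
    by (simp only: \<Delta>_def m_def)
qed

lemma bulk_part_le:
  assumes L: "0 < L"
  obtains V where "V \<in> borel_measurable M" "(\<integral>\<^sup>+\<omega>. V \<omega> \<partial>M) \<le> 2"
    "\<And>\<omega> v. ip d v v = 1 \<Longrightarrow>
      ennreal \<bar>(\<Sum>i=1..N. smoothed p L v (Xs i \<omega>)) - real N * (\<integral>x. smoothed p L v x \<partial>P)\<bar>
      \<le> ennreal (real N * moment_const K p / L + L * (real p * r / 2)) + ennreal L * V \<omega>"
proof -
  let ?a = "ennreal (real N * moment_const K p / L + L * (real p * r / 2))"
  obtain V where V: "V \<in> borel_measurable M" "(\<integral>\<^sup>+\<omega>. V \<omega> \<partial>M) \<le> 1"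
    and V': "\<And>\<omega> v. ip d v v = 1 \<Longrightarrow>
      ennreal (1 * ((\<Sum>i=1..N. smoothed p L v (Xs i \<omega>)) - real N * (\<integral>x. smoothed p L v x \<partial>P))) \<le> ?a + ennreal L * V \<omega>"
    using one_sided_bulk_le[OF L, of 1 p] by auto
  obtain U where U: "U \<in> borel_measurable M" "(\<integral>\<^sup>+\<omega>. U \<omega> \<partial>M) \<le> 1"
    and U': "\<And>\<omega> v. ip d v v = 1 \<Longrightarrow>
      ennreal (- 1 * ((\<Sum>i=1..N. smoothed p L v (Xs i \<omega>)) - real N * (\<integral>x. smoothed p L v x \<partial>P))) \<le> ?a + ennreal L * U \<omega>"
    using one_sided_bulk_le[OF L, of "- 1" p] by auto
  show thesis
  proof (rule that[of "\<lambda>\<omega>. V \<omega> + U \<omega>"])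
    show "(\<lambda>\<omega>. V \<omega> + U \<omega>) \<in> borel_measurable M" using V(1) U(1) by (rule borel_measurable_add)
    have "(\<integral>\<^sup>+\<omega>. V \<omega> + U \<omega> \<partial>M) \<le> 1 + 1"
      unfolding nn_integral_add[OF V(1) U(1)] by (intro add_mono V(2) U(2))
    then show "(\<integral>\<^sup>+\<omega>. V \<omega> + U \<omega> \<partial>M) \<le> 2" by simp
    fix \<omega> v assume v: "ip d v v = 1"
    let ?z = "(\<Sum>i=1..N. smoothed p L v (Xs i \<omega>)) - real N * (\<integral>x. smoothed p L v x \<partial>P)"
    have "ennreal L * V \<omega> \<le> ennreal L * (V \<omega> + U \<omega>)" "ennreal L * U \<omega> \<le> ennreal L * (V \<omega> + U \<omega>)"
      by (intro mult_left_mono; simp)+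
    then have "ennreal (1 * ?z) \<le> ?a + ennreal L * (V \<omega> + U \<omega>)" "ennreal (- 1 * ?z) \<le> ?a + ennreal L * (V \<omega> + U \<omega>)"
      using order_trans[OF V'[OF v, of \<omega>] add_left_mono] order_trans[OF U'[OF v, of \<omega>] add_left_mono] by blast+
    then show "ennreal \<bar>?z\<bar> \<le> ?a + ennreal L * (V \<omega> + U \<omega>)"
      by (cases "0 \<le> ?z") simp_all
  qed
qed

lemma excess_sum_le:
  assumes p: "2 \<le> p"
  obtains W where "W \<in> borel_measurable M" "(\<integral>\<^sup>+\<omega>. W \<omega> \<partial>M) \<le> 1"
    "\<And>\<omega> v. ip d v v = 1 \<Longrightarrow>
      ennreal (\<Sum>i=1..N. excess p (sqrt (real N / r)) (ip d (Xs i \<omega>) v)) \<le> ennreal (peak_const K p * sqrt r ^ p) * (1 + W \<omega>)"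
proof -
  define t where "t = real N / r"
  \<comment> \<open>140 = 4 * 35: if u^2 \<le> 35 * \<beta>, which is a quarter of
    \<open>root p t\<close>, then \<open>power_le_of_square_le_root\<close> gives 2^p * |u|^p \<le>
    sqrt t and the excess vanishes. Only the projections counted in \<open>peak_part_le\<close>
    remain.\<close>
  define \<beta> where "\<beta> = root p t / 140"
  \<comment> \<open>\<open>\<beta> / (2 * K\<^sup>2)\<close> equals
    \<open>root p t / (280 * K\<^sup>2)\<close>, and N = r * t; \<open>A\<close> is then what
    \<open>root_exp_decay\<close> delivers, doubled.\<close>
  define A where "A = 2 * fact p * (280 * K\<^sup>2) ^ p"
  have t: "0 < t" using N_pos r_ge_1 by (simp add: t_def)
  have "t * exp (- (1 / (280 * K\<^sup>2) * root p t)) \<le> fact p / (1 / (280 * K\<^sup>2)) ^ p"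
    by (rule root_exp_decay) (use K_pos p t in auto)
  then have "2 * (r * (t * exp (- (1 / (280 * K\<^sup>2) * root p t)))) \<le> 2 * (r * (fact p / (1 / (280 * K\<^sup>2)) ^ p))"
    using r_ge_1 by (intro mult_left_mono) auto
  moreover have "- (1 / (280 * K\<^sup>2) * root p t) = - \<beta> / (2 * K\<^sup>2)" by (simp add: \<beta>_def)
  moreover have "2 * (r * (fact p / (1 / (280 * K\<^sup>2)) ^ p)) = A * r"
    using K_pos by (simp add: A_def power_divide)
  moreover have "2 * (r * (t * e)) = real N * (2 * e)" for e using r_ge_1 by (simp add: t_def)
  ultimately have b: "real N * (2 * exp (- \<beta> / (2 * K\<^sup>2))) \<le> A * r" by (simp only:)
  obtain W where W: "W \<in> borel_measurable M" "(\<integral>\<^sup>+\<omega>. W \<omega> \<partial>M) \<le> 1"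
    and le: "\<And>\<omega> v. ip d v v = 1 \<Longrightarrow>
      ennreal (\<Sum>i=1..N. if (ip d (Xs i \<omega>) v)\<^sup>2 > 35 * \<beta> then \<bar>ip d (Xs i \<omega>) v\<bar> ^ p else 0)
      \<le> ennreal (sqrt (280 * K\<^sup>2) ^ p * fact p * exp (2 + A) * sqrt r ^ p) * (1 + W \<omega>)"
    using peak_part_le[OF p b] by blast
  show thesis
  proof (rule that[OF W])
    fix \<omega> v assume v: "ip d v v = 1"
    have ex: "excess p (sqrt t) u \<le> 2 ^ p * (if u\<^sup>2 > 35 * \<beta> then \<bar>u\<bar> ^ p else 0)" for u
    proof (cases "u\<^sup>2 > 35 * \<beta>")
      case False
      then have "2 ^ p * \<bar>u\<bar> ^ p \<le> sqrt t"
        using t p by (intro power_le_of_square_le_root) (auto simp: \<beta>_def)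
      then show ?thesis by (simp add: excess_def)
    qed (simp add: excess_def)
    have "ennreal (\<Sum>i=1..N. excess p (sqrt t) (ip d (Xs i \<omega>) v))
      \<le> ennreal (2 ^ p * (\<Sum>i=1..N. if (ip d (Xs i \<omega>) v)\<^sup>2 > 35 * \<beta> then \<bar>ip d (Xs i \<omega>) v\<bar> ^ p else 0))"
      unfolding sum_distrib_left by (intro ennreal_leI sum_mono ex)
    also have "\<dots> = ennreal (2 ^ p) * ennreal (\<Sum>i=1..N. if (ip d (Xs i \<omega>) v)\<^sup>2 > 35 * \<beta> then \<bar>ip d (Xs i \<omega>) v\<bar> ^ p else 0)"
      by (intro ennreal_mult sum_nonneg) auto
    also have "\<dots> \<le> ennreal (2 ^ p) * (ennreal (sqrt (280 * K\<^sup>2) ^ p * fact p * exp (2 + A) * sqrt r ^ p) * (1 + W \<omega>))"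
      by (intro mult_left_mono le v) simp
    also have "\<dots> = ennreal (peak_const K p * sqrt r ^ p) * (1 + W \<omega>)"
      unfolding mult.assoc[symmetric]
      by (subst ennreal_mult[symmetric]) (use r_ge_1 in \<open>auto simp: peak_const_def A_def mult_ac\<close>)
    finally show "ennreal (\<Sum>i=1..N. excess p (sqrt (real N / r)) (ip d (Xs i \<omega>) v)) \<le> ennreal (peak_const K p * sqrt r ^ p) * (1 + W \<omega>)"
      by (simp only: t_def)
  qed
qed

text \<open>The noise part of the clipping error does not depend on the direction, so for it a plain
  mean over the sample replaces a uniform bound.\<close>

lemma nn_integral_norm_sum_le:
  "(\<integral>\<^sup>+\<omega>. (\<Sum>i=1..N. ennreal ((ip d (Xs i \<omega>) (Xs i \<omega>)) ^ p)) \<partial>M) \<le> ennreal (real N * (2 * fact p * (2 * K\<^sup>2 * r) ^ p))"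
proof -
  have id: "(\<lambda>x. x) \<in> euclid d \<rightarrow>\<^sub>M euclid d" by (rule measurable_ident_sets[OF refl])
  have m: "(\<lambda>x. ennreal ((ip d x x) ^ p)) \<in> borel_measurable (euclid d)"
    by (intro measurable_compose[OF _ measurable_ennreal] borel_measurable_power measurable_ip id)
  have "(\<integral>\<^sup>+\<omega>. (\<Sum>i=1..N. ennreal ((ip d (Xs i \<omega>) (Xs i \<omega>)) ^ p)) \<partial>M)
    = (\<Sum>i=1..N. \<integral>\<^sup>+\<omega>. ennreal ((ip d (Xs i \<omega>) (Xs i \<omega>)) ^ p) \<partial>M)"
    by (rule nn_integral_sum) (rule measurable_compose[OF measurable_Xs m])
  also have "\<dots> = (\<Sum>i=1..N. \<integral>\<^sup>+x. ennreal ((ip d x x) ^ p) \<partial>P)"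
  proof (rule sum.cong[OF refl])
    fix i assume i: "i \<in> {1..N}"
    have m': "(\<lambda>x. ennreal ((ip d x x) ^ p)) \<in> borel_measurable (distr M (euclid d) (Xs i))"
      using m by (simp only: measurable_distr_eq1)
    show "(\<integral>\<^sup>+\<omega>. ennreal ((ip d (Xs i \<omega>) (Xs i \<omega>)) ^ p) \<partial>M) = (\<integral>\<^sup>+x. ennreal ((ip d x x) ^ p) \<partial>P)"
      using nn_integral_distr[OF measurable_Xs[OF i] m'] unfolding law[OF i] by (rule sym)
  qed
  also have "\<dots> \<le> (\<Sum>i=1..N. ennreal (2 * fact p * (2 * K\<^sup>2 * r) ^ p))"
    by (intro sum_mono moment_norm_le)
  also have "\<dots> = ennreal (real N * (2 * fact p * (2 * K\<^sup>2 * r) ^ p))"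
    using K_pos r_ge_1 by (simp add: ennreal_of_nat_eq_real_of_nat ennreal_mult)
  finally show ?thesis .
qed

text \<open>The sample average is compared with its smoothed version, that with the smoothed mean,
  and that with the true mean. Every error is bounded by a variable free of \<open>v\<close>, so a
  single measurable \<open>B\<close> dominates all directions and the mean of the supremum reduces
  to the mean of \<open>B\<close>.\<close>

lemma deviation_envelope:
  assumes p: "2 \<le> p"
  obtains B where "B \<in> borel_measurable M"
    "(\<integral>\<^sup>+\<omega>. B \<omega> \<partial>M) \<le> ennreal (deviation_const K p * (sqrt r ^ p / real N + sqrt (r / real N)))"
    "\<And>\<omega> v. ip d v v = 1 \<Longrightarrow>
      ennreal \<bar>1 / real N * (\<Sum>i=1..N. (ip d (Xs i \<omega>) v) ^ p) - (\<integral>x. (ip d x v) ^ p \<partial>P)\<bar> \<le> B \<omega>"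
proof -
  \<comment> \<open>This level balances the errors: N / L = L * r, so the moment terms and the
    entropy term agree in order and become sqrt (r / N) after division by N.\<close>
  define L where "L = sqrt (real N / r)"
  have L: "0 < L" using N_pos r_ge_1 by (simp add: L_def)
  obtain V where V: "V \<in> borel_measurable M" "(\<integral>\<^sup>+\<omega>. V \<omega> \<partial>M) \<le> 2"
    and bulk: "\<And>\<omega> v. ip d v v = 1 \<Longrightarrow>
      ennreal \<bar>(\<Sum>i=1..N. smoothed p L v (Xs i \<omega>)) - real N * (\<integral>x. smoothed p L v x \<partial>P)\<bar>
      \<le> ennreal (real N * moment_const K p / L + L * (real p * r / 2)) + ennreal L * V \<omega>"
    using bulk_part_le[OF L, of p] by blast
  obtain W where W: "W \<in> borel_measurable M" "(\<integral>\<^sup>+\<omega>. W \<omega> \<partial>M) \<le> 1"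
    and excess: "\<And>\<omega> v. ip d v v = 1 \<Longrightarrow>
      ennreal (\<Sum>i=1..N. excess p L (ip d (Xs i \<omega>) v)) \<le> ennreal (peak_const K p * sqrt r ^ p) * (1 + W \<omega>)"
    using excess_sum_le[OF p] unfolding L_def by blast
  define R where "R \<omega> = (\<Sum>i=1..N. ennreal ((ip d (Xs i \<omega>) (Xs i \<omega>)) ^ p))" for \<omega>
  have R: "R \<in> borel_measurable M"
    unfolding R_def[abs_def]
    by (intro borel_measurable_sum measurable_compose[OF _ measurable_ennreal] borel_measurable_power
      measurable_ip measurable_Xs)
  \<comment> \<open>The moment term is doubled: once from the bulk estimate, once from the bias of
    the smoothed mean.\<close>
  define a where "a = 2 * (real N * moment_const K p / L) + L * (real p * r / 2)"
  define b where "b = peak_const K p * sqrt r ^ p"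
  define c where "c = noise_const p / r ^ p / L"
  have nn: "0 \<le> a" "0 \<le> b" "0 \<le> c"
    using L r_ge_1 moment_const_nonneg[of K p] peak_const_nonneg[of K p] noise_const_nonneg[of p]
    by (auto simp: a_def b_def c_def)
  define B where "B \<omega> = ennreal (1 / real N) * (ennreal a + ennreal L * V \<omega> + ennreal b * (1 + W \<omega>) + ennreal c * R \<omega>)" for \<omega>
  have BM: "B \<in> borel_measurable M"
    unfolding B_def[abs_def]
    by (intro borel_measurable_times_ennreal borel_measurable_add borel_measurable_const V(1) W(1) R)
  have pt: "ennreal \<bar>1 / real N * (\<Sum>i=1..N. (ip d (Xs i \<omega>) v) ^ p) - (\<integral>x. (ip d x v) ^ p \<partial>P)\<bar> \<le> B \<omega>"
    if v: "ip d v v = 1" for v \<omega>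
  proof -
    define m where "m = (\<integral>x. (ip d x v) ^ p \<partial>P)"
    define sm where "sm = (\<integral>x. smoothed p L v x \<partial>P)"
    define S where "S = (\<Sum>i=1..N. (ip d (Xs i \<omega>) v) ^ p)"
    define T where "T = (\<Sum>i=1..N. smoothed p L v (Xs i \<omega>))"
    define ex where "ex = (\<Sum>i=1..N. excess p L (ip d (Xs i \<omega>) v))"
    define Rr where "Rr = (\<Sum>i=1..N. (ip d (Xs i \<omega>) (Xs i \<omega>)) ^ p)"
    have ex0: "0 \<le> ex" unfolding ex_def by (intro sum_nonneg excess_nonneg)
    have Rr0: "0 \<le> Rr" unfolding Rr_def by (intro sum_nonneg) simp
    have ST: "\<bar>S - T\<bar> \<le> ex + c * Rr"
    proof -
      have "\<bar>S - T\<bar> \<le> (\<Sum>i=1..N. \<bar>(ip d (Xs i \<omega>) v) ^ p - smoothed p L v (Xs i \<omega>)\<bar>)"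
        unfolding S_def T_def sum_subtractf[symmetric] by (rule sum_abs)
      also have "\<dots> \<le> (\<Sum>i=1..N. excess p L (ip d (Xs i \<omega>) v) + c * (ip d (Xs i \<omega>) (Xs i \<omega>)) ^ p)"
      proof (rule sum_mono)
        fix i
        show "\<bar>(ip d (Xs i \<omega>) v) ^ p - smoothed p L v (Xs i \<omega>)\<bar> \<le> excess p L (ip d (Xs i \<omega>) v) + c * (ip d (Xs i \<omega>) (Xs i \<omega>)) ^ p"
          using abs_power_diff_smoothed_le[OF v L, of "Xs i \<omega>" p] by (simp add: c_def)
      qed
      also have "\<dots> = ex + c * Rr" by (simp add: ex_def Rr_def sum.distrib sum_distrib_left)
      finally show ?thesis .
    qed
    have "\<bar>m - sm\<bar> \<le> moment_const K p / L"
      unfolding m_def sm_def by (rule abs_integral_diff_smoothed_le[OF v L])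
    then have "real N * \<bar>m - sm\<bar> \<le> real N * (moment_const K p / L)" by (intro mult_left_mono) auto
    then have Nm: "\<bar>real N * m - real N * sm\<bar> \<le> real N * moment_const K p / L"
      by (simp add: right_diff_distrib[symmetric] abs_mult)
    have "1 / real N * S - m = 1 / real N * (S - real N * m)"
      using N_pos by (simp add: field_simps)
    then have "\<bar>1 / real N * S - m\<bar> = 1 / real N * \<bar>S - real N * m\<bar>"
      by (simp only: abs_mult) simp
    also have "\<bar>S - real N * m\<bar> \<le> \<bar>T - real N * sm\<bar> + (ex + c * Rr + real N * moment_const K p / L)"
      using ST Nm by linarith
    finally have "ennreal \<bar>1 / real N * S - m\<bar> \<le> ennreal (1 / real N * (\<bar>T - real N * sm\<bar> + (ex + c * Rr + real N * moment_const K p / L)))"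
      by (intro ennreal_leI) (simp add: divide_right_mono)
    also have "\<dots> = ennreal (1 / real N) * (ennreal \<bar>T - real N * sm\<bar> + (ennreal ex + ennreal c * ennreal Rr + ennreal (real N * moment_const K p / L)))"
      using ex0 Rr0 nn L moment_const_nonneg[of K p] by (simp add: ennreal_mult' ennreal_mult ennreal_plus del: times_divide_eq_left mult_1)
    also have "\<dots> \<le> ennreal (1 / real N) * ((ennreal (real N * moment_const K p / L + L * (real p * r / 2)) + ennreal L * V \<omega>)
      + (ennreal b * (1 + W \<omega>) + ennreal c * R \<omega> + ennreal (real N * moment_const K p / L)))"
    proof (intro mult_left_mono add_mono order_refl)
      show "ennreal \<bar>T - real N * sm\<bar> \<le> ennreal (real N * moment_const K p / L + L * (real p * r / 2)) + ennreal L * V \<omega>"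
        unfolding T_def sm_def by (rule bulk[OF v])
      show "ennreal ex \<le> ennreal b * (1 + W \<omega>)"
        unfolding ex_def b_def by (rule excess[OF v])
      show "ennreal Rr \<le> R \<omega>" unfolding Rr_def R_def by (simp add: sum_ennreal)
    qed simp_all
    also have "\<dots> = B \<omega>"
    proof -
      have "ennreal a = ennreal (real N * moment_const K p / L + L * (real p * r / 2)) + ennreal (real N * moment_const K p / L)"
        using L r_ge_1 moment_const_nonneg[of K p] by (subst ennreal_plus[symmetric]) (auto simp: a_def)
      then show ?thesis unfolding B_def by (simp only: ac_simps)
    qed
    finally show ?thesis by (simp only: S_def m_def)
  qed
  have IR: "(\<integral>\<^sup>+\<omega>. R \<omega> \<partial>M) \<le> ennreal (real N * (2 * fact p * (2 * K\<^sup>2 * r) ^ p))"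
    unfolding R_def by (rule nn_integral_norm_sum_le)
  have "(\<integral>\<^sup>+\<omega>. B \<omega> \<partial>M) = ennreal (1 / real N) * (ennreal a + ennreal L * (\<integral>\<^sup>+\<omega>. V \<omega> \<partial>M) + ennreal b * (1 + (\<integral>\<^sup>+\<omega>. W \<omega> \<partial>M)) + ennreal c * (\<integral>\<^sup>+\<omega>. R \<omega> \<partial>M))"
  proof -
    note [measurable] = V(1) W(1) R
    show ?thesis
      unfolding B_def
      by (subst nn_integral_cmult, measurable) (simp add: nn_integral_add nn_integral_cmult S.emeasure_space_1)
  qed
  also have "\<dots> \<le> ennreal (1 / real N) * (ennreal a + ennreal L * ennreal 2 + ennreal b * ennreal 2 + ennreal c * ennreal (real N * (2 * fact p * (2 * K\<^sup>2 * r) ^ p)))"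
  proof (intro mult_left_mono add_mono order_refl IR)
    show "(\<integral>\<^sup>+\<omega>. V \<omega> \<partial>M) \<le> ennreal 2" using V(2) by simp
    have "1 + (\<integral>\<^sup>+\<omega>. W \<omega> \<partial>M) \<le> 1 + 1" by (intro add_left_mono W(2))
    then show "1 + (\<integral>\<^sup>+\<omega>. W \<omega> \<partial>M) \<le> ennreal 2" by simp
  qed simp_all
  also have "\<dots> = ennreal (1 / real N * (a + L * 2 + b * 2 + c * (real N * (2 * fact p * (2 * K\<^sup>2 * r) ^ p))))"
  proof -
    define e where "e = real N * (2 * fact p * (2 * K\<^sup>2 * r) ^ p)"
    have "0 \<le> e" using r_ge_1 by (simp add: e_def)
    then show ?thesis
      unfolding e_def[symmetric] using nn L
      by (simp add: ennreal_mult ennreal_plus del: times_divide_eq_left mult_1 ennreal_numeral)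
  qed
  also have "\<dots> \<le> ennreal (deviation_const K p * (sqrt r ^ p / real N + sqrt (r / real N)))"
  proof (rule ennreal_leI)
    define h where "h = sqrt (r / real N)"
    have h0: "0 \<le> h" using r_ge_1 by (simp add: h_def)
    have rN: "sqrt r > 0" "sqrt (real N) > 0" "r > 0" "real N > 0" using r_ge_1 N_pos by auto
    have hL: "h = 1 / L" by (simp add: h_def L_def real_sqrt_divide)
    have L2: "L * L = real N / r" using rN by (simp add: L_def)
    have Lr: "L * r / real N = h"
    proof -
      have "L * (L * r / real N) = L * h" unfolding hL using L2 L rN by (simp add: field_simps)
      then show ?thesis using L by (metis mult_left_cancel less_irrefl)
    qed
    \<comment> \<open>r \<ge> 1 absorbs the contribution of \<open>V\<close> into the entropy term L
      * r / N.\<close>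
    have LN: "L / real N \<le> h"
      unfolding Lr[symmetric] using L r_ge_1 by (intro divide_right_mono) (auto simp: mult_le_cancel_left1)
    have ca: "1 / real N * a = 2 * moment_const K p * h + real p / 2 * h"
    proof -
      have "1 / real N * a = 2 * moment_const K p * (1 / L) + real p / 2 * (L * r / real N)"
        using L rN by (simp add: a_def field_simps)
      then show ?thesis by (simp only: hL[symmetric] Lr)
    qed
    have cc: "1 / real N * (c * (real N * (2 * fact p * (2 * K\<^sup>2 * r) ^ p))) = noise_const p * (2 * fact p * (2 * K\<^sup>2) ^ p) * h"
      unfolding c_def hL using L rN by (simp add: power_mult_distrib field_simps)
    have "0 \<le> 4 ^ p * (2 * fact p * (2 * K\<^sup>2) ^ p) * h" using h0 K_pos by simp
    then have nl: "noise_const p * (2 * fact p * (2 * K\<^sup>2) ^ p) * h \<le> moment_const K p * h"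
      by (simp add: moment_const_def algebra_simps)
    have total: "1 / real N * (a + L * 2 + b * 2 + c * (real N * (2 * fact p * (2 * K\<^sup>2 * r) ^ p)))
      = 1 / real N * a + 2 * (L / real N) + 2 * peak_const K p * (sqrt r ^ p / real N)
        + 1 / real N * (c * (real N * (2 * fact p * (2 * K\<^sup>2 * r) ^ p)))"
      by (simp add: b_def add_divide_distrib mult_ac)
    have "1 / real N * (a + L * 2 + b * 2 + c * (real N * (2 * fact p * (2 * K\<^sup>2 * r) ^ p)))
      \<le> (3 * moment_const K p + real p / 2 + 2) * h + 2 * peak_const K p * (sqrt r ^ p / real N)"
      unfolding total ca cc distrib_right using nl LN by linarith
    also have "\<dots> \<le> deviation_const K p * h + deviation_const K p * (sqrt r ^ p / real N)"
      using h0 rN moment_const_nonneg[of K p] peak_const_nonneg[of K p]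
      by (intro add_mono mult_right_mono) (auto simp: deviation_const_def)
    finally show "1 / real N * (a + L * 2 + b * 2 + c * (real N * (2 * fact p * (2 * K\<^sup>2 * r) ^ p)))
      \<le> deviation_const K p * (sqrt r ^ p / real N + sqrt (r / real N))"
      by (simp add: h_def distrib_left add.commute)
  qed
  finally have IB: "(\<integral>\<^sup>+\<omega>. B \<omega> \<partial>M) \<le> ennreal (deviation_const K p * (sqrt r ^ p / real N + sqrt (r / real N)))" .
  show thesis by (rule that[OF BM IB pt])
qed

end

section \<open>Normalisation\<close>

lemma ip_eq_0:
  assumes "ip d v v = 0"
  shows "ip d x v = 0"
proof -
  have "\<forall>i<d. v i = 0" using assms unfolding ip_def by (simp add: sum_nonneg_eq_0_iff)
  then show ?thesis by (simp add: ip_def)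
qed

lemma ip_unit_direction:
  assumes "ip d v v \<noteq> 0"
  obtains c u where "0 < c" "c\<^sup>2 = ip d v v" "u \<in> unit_sphere d" "\<And>x. ip d x v = c * ip d x u"
proof -
  define c where "c = sqrt (ip d v v)"
  have c: "0 < c" "c\<^sup>2 = ip d v v" using assms by (auto simp: c_def order_less_le)
  define u where "u = (\<lambda>i\<in>{..<d}. v i / c)"
  have "(\<Sum>i<d. (u i)\<^sup>2) = ip d v v / c\<^sup>2"
    by (simp add: u_def ip_def power_divide sum_divide_distrib power2_eq_square)
  also have "\<dots> = 1" using assms by (simp add: c)
  finally have "u \<in> unit_sphere d" by (simp add: unit_sphere_def u_def L2_set_def)
  moreover have "ip d x v = c * ip d x u" for x
    using c by (simp add: u_def ip_def sum_distrib_left)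
  ultimately show thesis using that c by blast
qed

text \<open>The comparison is pointwise. Where \<open>B\<close> is finite it bounds the whole
  family, so the real \<open>SUP\<close> is a genuine least upper bound; where it is \<top> there is
  nothing to show.\<close>

lemma nn_integral_SUP_le:
  fixes f :: "'v \<Rightarrow> 'a \<Rightarrow> real"
  assumes "V \<noteq> {}" and le: "\<And>v \<omega>. v \<in> V \<Longrightarrow> ennreal (f v \<omega>) \<le> B \<omega>"
    and f: "\<And>v \<omega>. v \<in> V \<Longrightarrow> 0 \<le> f v \<omega>"
  shows "(\<integral>\<^sup>+\<omega>. ennreal (SUP v\<in>V. f v \<omega>) \<partial>M) \<le> (\<integral>\<^sup>+\<omega>. B \<omega> \<partial>M)"
proof (rule nn_integral_mono)
  fix \<omega>
  show "ennreal (SUP v\<in>V. f v \<omega>) \<le> B \<omega>"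
  proof (cases "B \<omega> = \<top>")
    case False
    then obtain z where z: "0 \<le> z" "B \<omega> = ennreal z" by (cases "B \<omega>") auto
    have "(SUP v\<in>V. f v \<omega>) \<le> z"
      by (rule cSUP_least[OF assms(1)]) (use le[of _ \<omega>] z in \<open>auto simp: ennreal_le_iff\<close>)
    then show ?thesis unfolding z(2) by (rule ennreal_leI)
  qed simp
qed

text \<open>A variance strictly below \<open>s\<close> puts K times the L2 norm of the unit
  projection strictly below \<open>t\<close>, so the infimum in \<open>psi2_norm\<close> provides an
  admissible t' < t without having to be attained. A square that is not integrable has Bochner
  integral 0 and is covered too, which is why integrability can be deduced from this lemma
  afterwards.\<close>

lemma subgaussian_exp_square_le:
  assumes sub: "subgaussian d K M X" and M: "prob_space M" and K: "0 < K" and s: "0 < s"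
    and var: "(\<integral>\<omega>. (ip d (X \<omega>) v)\<^sup>2 \<partial>M) < s"
  shows "(\<integral>\<^sup>+\<omega>. ennreal (exp ((ip d (X \<omega>) v)\<^sup>2 / (K\<^sup>2 * s))) \<partial>M) \<le> 2"
proof -
  interpret prob_space M by fact
  show ?thesis
  proof (cases "ip d v v = 0")
    case True
    then show ?thesis by (simp add: ip_eq_0 emeasure_space_1)
  next
    case False
    from ip_unit_direction[OF this] obtain c u
      where c: "0 < c" "c\<^sup>2 = ip d v v" and u: "u \<in> unit_sphere d" and vu: "\<And>x. ip d x v = c * ip d x u"
      by blast
    define t where "t = K * sqrt (s / c\<^sup>2)"
    have "l2_norm M (\<lambda>\<omega>. ip d (X \<omega>) u) < sqrt (s / c\<^sup>2)"
    proof -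
      have "(\<integral>\<omega>. (ip d (X \<omega>) v)\<^sup>2 \<partial>M) = c\<^sup>2 * (\<integral>\<omega>. (ip d (X \<omega>) u)\<^sup>2 \<partial>M)"
        unfolding vu by (simp add: power_mult_distrib)
      then have "(\<integral>\<omega>. (ip d (X \<omega>) u)\<^sup>2 \<partial>M) < s / c\<^sup>2"
        using var c(1) by (simp add: field_simps)
      then show ?thesis unfolding l2_norm_def by simp
    qed
    then have lt: "K * l2_norm M (\<lambda>\<omega>. ip d (X \<omega>) u) < t"
      using K by (simp add: t_def)
    have t0: "0 < t" using K s c(1) by (simp add: t_def)
    have "psi2_norm M (\<lambda>\<omega>. ip d (X \<omega>) u) \<le> ennreal (K * l2_norm M (\<lambda>\<omega>. ip d (X \<omega>) u))"
      using sub u by (simp add: subgaussian_def)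
    also have "\<dots> < ennreal t"
      using lt t0 by (simp add: ennreal_lessI)
    finally obtain t' where t': "0 < t'" "(\<integral>\<^sup>+\<omega>. ennreal (exp ((ip d (X \<omega>) u)\<^sup>2 / t'\<^sup>2)) \<partial>M) \<le> 2" "ennreal t' < ennreal t"
      unfolding psi2_norm_def INF_less_iff by auto
    have tt: "t' \<le> t" using t' by (simp add: ennreal_less_iff)
    have "(\<integral>\<^sup>+\<omega>. ennreal (exp ((ip d (X \<omega>) v)\<^sup>2 / (K\<^sup>2 * s))) \<partial>M) \<le> (\<integral>\<^sup>+\<omega>. ennreal (exp ((ip d (X \<omega>) u)\<^sup>2 / t'\<^sup>2)) \<partial>M)"
    proof (intro nn_integral_mono ennreal_leI)
      fix \<omega>
      have "(ip d (X \<omega>) v)\<^sup>2 / (K\<^sup>2 * s) = (ip d (X \<omega>) u)\<^sup>2 / t\<^sup>2"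
        using c(1) s by (simp add: vu t_def power_mult_distrib field_simps)
      also have "\<dots> \<le> (ip d (X \<omega>) u)\<^sup>2 / t'\<^sup>2"
        using tt t' by (intro divide_left_mono power_mono mult_pos_pos zero_less_power) auto
      finally show "exp ((ip d (X \<omega>) v)\<^sup>2 / (K\<^sup>2 * s)) \<le> exp ((ip d (X \<omega>) u)\<^sup>2 / t'\<^sup>2)" by simp
    qed
    then show ?thesis using t'(2) by (rule order_trans)
  qed
qed

lemma abs_mult_le_half_squares: "\<bar>a * b\<bar> \<le> 1 / 2 * a\<^sup>2 + 1 / 2 * b\<^sup>2" for a b :: real
proof -
  have "0 \<le> (\<bar>a\<bar> - \<bar>b\<bar>)\<^sup>2" by simp
  then show ?thesis by (simp add: power2_diff abs_mult)
qed

locale subgaussian_vector = prob_space M for M :: "'a measure" +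
  fixes d :: nat and K :: real and X :: "'a \<Rightarrow> nat \<Rightarrow> real"
  assumes d_pos: "d > 0" and K_pos: "K > 0" and measurable_X: "X \<in> M \<rightarrow>\<^sub>M euclid d"
    and sub: "subgaussian d K M X"
begin

lemma integrable_ip_square: "integrable M (\<lambda>\<omega>. (ip d (X \<omega>) v)\<^sup>2)"
proof -
  define s where "s = (\<integral>\<omega>. (ip d (X \<omega>) v)\<^sup>2 \<partial>M) + 1"
  have s: "s > 0" "(\<integral>\<omega>. (ip d (X \<omega>) v)\<^sup>2 \<partial>M) < s" by (auto simp: s_def intro!: add_nonneg_pos)
  have m: "(\<lambda>\<omega>. (ip d (X \<omega>) v)\<^sup>2) \<in> borel_measurable M"
    by (intro borel_measurable_power measurable_ip_const(1) measurable_X)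
  have m2: "(\<lambda>\<omega>. ennreal (exp ((ip d (X \<omega>) v)\<^sup>2 / (K\<^sup>2 * s)))) \<in> borel_measurable M"
    using m by measurable
  have "(\<integral>\<^sup>+\<omega>. ennreal ((ip d (X \<omega>) v)\<^sup>2) \<partial>M) \<le> (\<integral>\<^sup>+\<omega>. ennreal (K\<^sup>2 * s) * ennreal (exp ((ip d (X \<omega>) v)\<^sup>2 / (K\<^sup>2 * s))) \<partial>M)"
  proof (rule nn_integral_mono)
    fix \<omega>
    have "(ip d (X \<omega>) v)\<^sup>2 / (K\<^sup>2 * s) \<le> exp ((ip d (X \<omega>) v)\<^sup>2 / (K\<^sup>2 * s))"
      using exp_ge_add_one_self[of "(ip d (X \<omega>) v)\<^sup>2 / (K\<^sup>2 * s)"] by linarith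
    then have "(ip d (X \<omega>) v)\<^sup>2 \<le> (K\<^sup>2 * s) * exp ((ip d (X \<omega>) v)\<^sup>2 / (K\<^sup>2 * s))"
      using K_pos s(1) by (subst (asm) pos_divide_le_eq) (auto simp: mult.commute)
    then have "ennreal ((ip d (X \<omega>) v)\<^sup>2) \<le> ennreal ((K\<^sup>2 * s) * exp ((ip d (X \<omega>) v)\<^sup>2 / (K\<^sup>2 * s)))"
      by (rule ennreal_leI)
    also have "\<dots> = ennreal (K\<^sup>2 * s) * ennreal (exp ((ip d (X \<omega>) v)\<^sup>2 / (K\<^sup>2 * s)))"
      using s(1) by (intro ennreal_mult) auto
    finally show "ennreal ((ip d (X \<omega>) v)\<^sup>2) \<le> ennreal (K\<^sup>2 * s) * ennreal (exp ((ip d (X \<omega>) v)\<^sup>2 / (K\<^sup>2 * s)))" .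
  qed
  also have "\<dots> = ennreal (K\<^sup>2 * s) * (\<integral>\<^sup>+\<omega>. ennreal (exp ((ip d (X \<omega>) v)\<^sup>2 / (K\<^sup>2 * s))) \<partial>M)"
    by (rule nn_integral_cmult[OF m2])
  also have "\<dots> \<le> ennreal (K\<^sup>2 * s) * 2"
    by (intro mult_left_mono subgaussian_exp_square_le[OF sub _ K_pos s] prob_space_axioms) simp
  also have "\<dots> < \<infinity>" by (simp add: ennreal_mult_less_top)
  finally show ?thesis by (intro integrableI_nonneg m) auto
qed

lemma measurable_coordinate: "i < d \<Longrightarrow> (\<lambda>\<omega>. X \<omega> i) \<in> borel_measurable M"
  by (rule measurable_compose[OF measurable_X measurable_component_singleton]) simp

lemma integrable_coordinate_square:
  assumes "i < d"
  shows "integrable M (\<lambda>\<omega>. (X \<omega> i)\<^sup>2)"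
proof -
  show ?thesis
    using integrable_ip_square[of "\<lambda>j. if j = i then 1 else 0"] by (simp only: ip_indicator[OF assms])
qed

lemma integrable_coordinate_prod:
  assumes "i < d" "j < d"
  shows "integrable M (\<lambda>\<omega>. X \<omega> i * X \<omega> j)"
proof (rule Bochner_Integration.integrable_bound)
  show "integrable M (\<lambda>\<omega>. (X \<omega> i)\<^sup>2 + (X \<omega> j)\<^sup>2)"
    by (intro Bochner_Integration.integrable_add integrable_coordinate_square assms)
  show "(\<lambda>\<omega>. X \<omega> i * X \<omega> j) \<in> borel_measurable M"
    by (intro borel_measurable_times measurable_coordinate assms)
  have "\<bar>a * b\<bar> \<le> a\<^sup>2 + b\<^sup>2" for a b :: real
    using abs_mult_le_half_squares[of a b] zero_le_power2[of a] zero_le_power2[of b] by linarith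
  then show "AE \<omega> in M. norm (X \<omega> i * X \<omega> j) \<le> norm ((X \<omega> i)\<^sup>2 + (X \<omega> j)\<^sup>2)"
    by (intro AE_I2) simp
qed

lemma bilinear_cov_mat:
  "(\<Sum>i<d. u i * (\<Sum>j<d. cov_mat M X i j * v j)) = (\<integral>\<omega>. ip d (X \<omega>) u * ip d (X \<omega>) v \<partial>M)"
proof -
  have "(\<Sum>i<d. u i * (\<Sum>j<d. cov_mat M X i j * v j)) = (\<Sum>i<d. \<Sum>j<d. \<integral>\<omega>. u i * v j * (X \<omega> i * X \<omega> j) \<partial>M)"
    unfolding cov_mat_def sum_distrib_left by (intro sum.cong refl) simp
  also have "\<dots> = (\<Sum>i<d. \<integral>\<omega>. (\<Sum>j<d. u i * v j * (X \<omega> i * X \<omega> j)) \<partial>M)"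
    by (intro sum.cong refl Bochner_Integration.integral_sum[symmetric] integrable_mult_right integrable_coordinate_prod) auto
  also have "\<dots> = (\<integral>\<omega>. (\<Sum>i<d. \<Sum>j<d. u i * v j * (X \<omega> i * X \<omega> j)) \<partial>M)"
    by (intro Bochner_Integration.integral_sum[symmetric] Bochner_Integration.integrable_sum integrable_mult_right integrable_coordinate_prod) auto
  also have "\<dots> = (\<integral>\<omega>. ip d (X \<omega>) u * ip d (X \<omega>) v \<partial>M)"
    by (simp add: ip_def sum_product mult_ac)
  finally show ?thesis .
qed

abbreviation "\<Sigma> \<equiv> cov_mat M X"
abbreviation "image_norm v \<equiv> L2_set (\<lambda>i. \<Sum>j<d. \<Sigma> i j * v j) {..<d}"

lemma trace_nonneg: "0 \<le> trace_mat d \<Sigma>"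
  unfolding trace_mat_def cov_mat_def by (intro sum_nonneg) simp

lemma variance_le_trace:
  assumes "ip d v v = 1"
  shows "(\<integral>\<omega>. (ip d (X \<omega>) v)\<^sup>2 \<partial>M) \<le> trace_mat d \<Sigma>"
proof -
  have "(\<integral>\<omega>. (ip d (X \<omega>) v)\<^sup>2 \<partial>M) \<le> (\<integral>\<omega>. (\<Sum>i<d. X \<omega> i * X \<omega> i) \<partial>M)"
  proof (intro integral_mono integrable_ip_square Bochner_Integration.integrable_sum integrable_coordinate_prod)
    fix \<omega>
    have "\<bar>ip d (X \<omega>) v\<bar> \<le> L2_set (X \<omega>) {..<d}" by (rule abs_ip_le_L2_set[OF assms])
    then have "(ip d (X \<omega>) v)\<^sup>2 \<le> (L2_set (X \<omega>) {..<d})\<^sup>2"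
      by (rule power2_le_iff_abs_le[THEN iffD2, rotated]) (rule L2_set_nonneg)
    also have "\<dots> = (\<Sum>i<d. X \<omega> i * X \<omega> i)"
      by (simp add: L2_set_def sum_nonneg power2_eq_square)
    finally show "(ip d (X \<omega>) v)\<^sup>2 \<le> (\<Sum>i<d. X \<omega> i * X \<omega> i)" .
  qed auto
  also have "\<dots> = trace_mat d \<Sigma>"
    unfolding trace_mat_def cov_mat_def
    by (rule Bochner_Integration.integral_sum) (auto intro: integrable_coordinate_prod)
  finally show ?thesis .
qed

text \<open>With u the normalised image of v, the norm is the bilinear form of the covariance at u
  and v, that is, the mean of <X, u> <X, v>. This is at most the average of two variances, and each
  is at most the trace. The bound makes the \<open>SUP\<close> in \<open>op_norm\<close> a genuine
  supremum and gives effective rank at least 1.\<close>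

lemma image_norm_le_trace:
  assumes v: "v \<in> unit_sphere d"
  shows "image_norm v \<le> trace_mat d \<Sigma>"
proof (cases "image_norm v = 0")
  case False
  define s where "s = image_norm v"
  have s: "0 < s" using False L2_set_nonneg[of _ "{..<d}"] by (simp add: s_def order_less_le)
  define u where "u i = (\<Sum>j<d. \<Sigma> i j * v j) / s" for i
  have ss: "(\<Sum>i<d. (\<Sum>j<d. \<Sigma> i j * v j) * (\<Sum>j<d. \<Sigma> i j * v j)) = s\<^sup>2"
    by (simp add: s_def L2_set_def sum_nonneg power2_eq_square)
  have uu: "ip d u u = 1"
    using ss s by (simp add: ip_def u_def sum_divide_distrib[symmetric] power2_eq_square)
  have i: "integrable M (\<lambda>\<omega>. 1 / 2 * (ip d (X \<omega>) u)\<^sup>2 + 1 / 2 * (ip d (X \<omega>) v)\<^sup>2)"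
    by (intro Bochner_Integration.integrable_add integrable_mult_right integrable_ip_square)
  have ip: "integrable M (\<lambda>\<omega>. ip d (X \<omega>) u * ip d (X \<omega>) v)"
  proof (rule Bochner_Integration.integrable_bound[OF i])
    show "(\<lambda>\<omega>. ip d (X \<omega>) u * ip d (X \<omega>) v) \<in> borel_measurable M"
      by (intro borel_measurable_times measurable_ip_const(1) measurable_X)
    show "AE \<omega> in M. norm (ip d (X \<omega>) u * ip d (X \<omega>) v) \<le> norm (1 / 2 * (ip d (X \<omega>) u)\<^sup>2 + 1 / 2 * (ip d (X \<omega>) v)\<^sup>2)"
    proof (rule AE_I2)
      fix \<omega>
      show "norm (ip d (X \<omega>) u * ip d (X \<omega>) v) \<le> norm (1 / 2 * (ip d (X \<omega>) u)\<^sup>2 + 1 / 2 * (ip d (X \<omega>) v)\<^sup>2)"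
        using abs_mult_le_half_squares[of "ip d (X \<omega>) u" "ip d (X \<omega>) v"] unfolding real_norm_def by (rule order_trans[OF _ abs_ge_self])
    qed
  qed
  have "s = (\<Sum>i<d. u i * (\<Sum>j<d. \<Sigma> i j * v j))"
    using ss s by (simp add: u_def sum_divide_distrib[symmetric] power2_eq_square)
  also have "\<dots> = (\<integral>\<omega>. ip d (X \<omega>) u * ip d (X \<omega>) v \<partial>M)" by (rule bilinear_cov_mat)
  also have "\<dots> \<le> (\<integral>\<omega>. 1 / 2 * (ip d (X \<omega>) u)\<^sup>2 + 1 / 2 * (ip d (X \<omega>) v)\<^sup>2 \<partial>M)"
    by (intro integral_mono i ip order_trans[OF abs_ge_self abs_mult_le_half_squares])
  also have "\<dots> = 1 / 2 * (\<integral>\<omega>. (ip d (X \<omega>) u)\<^sup>2 \<partial>M) + 1 / 2 * (\<integral>\<omega>. (ip d (X \<omega>) v)\<^sup>2 \<partial>M)"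
    by (simp add: integrable_ip_square)
  also have "\<dots> \<le> trace_mat d \<Sigma>"
    using variance_le_trace[OF uu] variance_le_trace[OF unit_sphere_ip[OF v]] by linarith
  finally show ?thesis by (simp add: s_def)
qed (simp add: trace_nonneg)

lemma op_norm_le_trace: "op_norm d \<Sigma> \<le> trace_mat d \<Sigma>"
  unfolding op_norm_def by (rule cSUP_least[OF unit_sphere_nonempty[OF d_pos] image_norm_le_trace])

lemma image_norm_le_op_norm: "v \<in> unit_sphere d \<Longrightarrow> image_norm v \<le> op_norm d \<Sigma>"
  unfolding op_norm_def
  by (rule cSUP_upper) (auto intro: bdd_aboveI2[OF image_norm_le_trace])

lemma op_norm_nonneg: "0 \<le> op_norm d \<Sigma>"
proof -
  obtain v where "v \<in> unit_sphere d" using unit_sphere_nonempty[OF d_pos] by blast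
  from L2_set_nonneg image_norm_le_op_norm[OF this] show ?thesis by (rule order_trans)
qed

lemma unit_variance_le_op_norm:
  assumes v: "v \<in> unit_sphere d"
  shows "(\<integral>\<omega>. (ip d (X \<omega>) v)\<^sup>2 \<partial>M) \<le> op_norm d \<Sigma>"
proof -
  have "(\<integral>\<omega>. (ip d (X \<omega>) v)\<^sup>2 \<partial>M) = (\<Sum>i<d. v i * (\<Sum>j<d. \<Sigma> i j * v j))"
    unfolding bilinear_cov_mat by (simp add: power2_eq_square)
  also have "\<dots> \<le> (\<Sum>i<d. \<bar>v i\<bar> * \<bar>\<Sum>j<d. \<Sigma> i j * v j\<bar>)"
    by (intro sum_mono) (simp add: abs_mult[symmetric])
  also have "\<dots> \<le> L2_set v {..<d} * image_norm v" by (rule L2_set_mult_ineq)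
  also have "\<dots> = image_norm v" using v by (simp add: unit_sphere_def)
  also have "\<dots> \<le> op_norm d \<Sigma>" by (rule image_norm_le_op_norm[OF v])
  finally show ?thesis .
qed

lemma variance_le_op_norm: "(\<integral>\<omega>. (ip d (X \<omega>) v)\<^sup>2 \<partial>M) \<le> op_norm d \<Sigma> * ip d v v"
proof -
  show ?thesis
  proof (cases "ip d v v = 0")
    case True
    then show ?thesis by (simp add: ip_eq_0)
  next
    case False
    from ip_unit_direction[OF this] obtain c u
      where c: "0 < c" "c\<^sup>2 = ip d v v" and u: "u \<in> unit_sphere d" and vu: "\<And>x. ip d x v = c * ip d x u"
      by blast
    have "(\<integral>\<omega>. (ip d (X \<omega>) v)\<^sup>2 \<partial>M) = c\<^sup>2 * (\<integral>\<omega>. (ip d (X \<omega>) u)\<^sup>2 \<partial>M)"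
      unfolding vu by (simp add: power_mult_distrib)
    also have "\<dots> \<le> c\<^sup>2 * op_norm d \<Sigma>"
      by (intro mult_left_mono unit_variance_le_op_norm u) simp
    finally show ?thesis by (simp add: c mult.commute)
  qed
qed

text \<open>\<open>X\<close> is divided by \<open>sqrt \<tau>\<close>; any \<open>\<tau> > 0\<close> above the operator norm is allowed, so that a zero
  covariance matrix is covered by letting \<open>\<tau>\<close> tend to 0.\<close>

lemma tensor_deviation_le_scaled:
  assumes p: "2 \<le> p" and N: "0 < N" and iid: "iid_copies d N M X Xs"
    and tau: "0 < \<tau>" "op_norm d \<Sigma> \<le> \<tau>" and r: "1 \<le> r" "trace_mat d \<Sigma> \<le> r * \<tau>"
  shows "(\<integral>\<^sup>+\<omega>. ennreal (tensor_deviation p d N M X Xs \<omega>) \<partial>M)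
    \<le> ennreal (sqrt \<tau> ^ p * (deviation_const K p * (sqrt r ^ p / real N + sqrt (r / real N))))"
proof -
  define q where "q = sqrt \<tau>"
  have q: "0 < q" "q\<^sup>2 = \<tau>" using tau by (auto simp: q_def)
  define sc where "sc x = (\<lambda>i\<in>{..<d}. x i / q)" for x :: "nat \<Rightarrow> real"
  have sc: "sc \<in> euclid d \<rightarrow>\<^sub>M euclid d"
    unfolding sc_def[abs_def]
    by (intro measurable_restrict borel_measurable_divide borel_measurable_const measurable_component_singleton)
  have ipsc: "ip d (sc x) v = ip d x v / q" for x v
    by (simp add: sc_def ip_def sum_divide_distrib)
  define P where "P = distr M (euclid d) (\<lambda>\<omega>. sc (X \<omega>))"
  define Ys where "Ys i \<omega> = sc (Xs i \<omega>)" for i \<omega>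
  have Y: "(\<lambda>\<omega>. sc (X \<omega>)) \<in> M \<rightarrow>\<^sub>M euclid d" by (rule measurable_compose[OF measurable_X sc])
  have ident: "(\<lambda>x. x) \<in> euclid d \<rightarrow>\<^sub>M euclid d" by (rule measurable_ident_sets[OF refl])
  have sq: "(\<integral>x. (ip d x v)\<^sup>2 \<partial>P) = (\<integral>\<omega>. (ip d (X \<omega>) v)\<^sup>2 \<partial>M) / \<tau>" for v
  proof -
    have "(\<integral>x. (ip d x v)\<^sup>2 \<partial>P) = (\<integral>\<omega>. (ip d (sc (X \<omega>)) v)\<^sup>2 \<partial>M)"
      unfolding P_def by (intro integral_distr[OF Y] borel_measurable_power measurable_ip_const(1) ident)
    then show ?thesis by (simp add: ipsc power_divide q)
  qed
  interpret P: prob_space P unfolding P_def by (rule prob_space_distr[OF Y])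
  have iid': "indep_vars (\<lambda>_. euclid d) Xs {1..N}" "\<And>i. i \<in> {1..N} \<Longrightarrow> distr M (euclid d) (Xs i) = distr M (euclid d) X"
    using iid by (auto simp: iid_copies_def)
  have Xs: "Xs i \<in> M \<rightarrow>\<^sub>M euclid d" if "i \<in> {1..N}" for i
    by (rule indep_vars_measurable[OF iid'(1) that])
  interpret Y: subgaussian_sample P d K r M N Ys
  proof unfold_locales
    show "sets P = sets (euclid d)" by (simp add: P_def)
    show "(\<integral>x. (ip d x v)\<^sup>2 \<partial>P) \<le> ip d v v" for v
    proof -
      have "(\<integral>\<omega>. (ip d (X \<omega>) v)\<^sup>2 \<partial>M) \<le> \<tau> * ip d v v"
        using variance_le_op_norm[of v] mult_right_mono[OF tau(2) ip_self_nonneg[of d v]] by linarith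
      then show ?thesis unfolding sq using tau by (simp add: pos_divide_le_eq mult.commute)
    qed
    have "(\<Sum>i<d. \<integral>x. (x i)\<^sup>2 \<partial>P) = trace_mat d \<Sigma> / \<tau>"
    proof -
      have "(\<integral>x. (x i)\<^sup>2 \<partial>P) = \<Sigma> i i / \<tau>" if i: "i < d" for i
      proof -
        have "(\<integral>x. (x i)\<^sup>2 \<partial>P) = (\<integral>\<omega>. (sc (X \<omega>) i)\<^sup>2 \<partial>M)"
          unfolding P_def
          by (intro integral_distr[OF Y] borel_measurable_power measurable_component_singleton) (simp add: i)
        then show ?thesis
          using i by (simp add: sc_def power_divide q(2) cov_mat_def flip: power2_eq_square)
      qed
      then show ?thesis by (simp add: trace_mat_def sum_divide_distrib)
    qed
    then show "(\<Sum>i<d. \<integral>x. (x i)\<^sup>2 \<partial>P) \<le> r" using r tau by (simp add: pos_divide_le_eq)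
    show "(\<integral>\<^sup>+x. ennreal (exp ((ip d x v)\<^sup>2 / (K\<^sup>2 * s))) \<partial>P) \<le> 2"
      if s: "0 < s" "(\<integral>x. (ip d x v)\<^sup>2 \<partial>P) < s" for v s
    proof -
      \<comment> \<open>The level \<open>s\<close> for the rescaled law is the level
        \<open>s * \<tau>\<close> for \<open>X\<close>.\<close>
      have st: "0 < s * \<tau>" "(\<integral>\<omega>. (ip d (X \<omega>) v)\<^sup>2 \<partial>M) < s * \<tau>"
        using s tau unfolding sq by (auto simp: pos_divide_less_eq)
      have "(\<integral>\<^sup>+x. ennreal (exp ((ip d x v)\<^sup>2 / (K\<^sup>2 * s))) \<partial>P)
        = (\<integral>\<^sup>+\<omega>. ennreal (exp ((ip d (sc (X \<omega>)) v)\<^sup>2 / (K\<^sup>2 * s))) \<partial>M)"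
        unfolding P_def
        by (rule nn_integral_distr[OF Y], simp only: measurable_distr_eq1)
           (intro measurable_compose[OF _ measurable_ennreal] measurable_compose[OF _ borel_measurable_exp]
             borel_measurable_divide borel_measurable_power measurable_ip_const(1) ident borel_measurable_const)
      also have "\<dots> = (\<integral>\<^sup>+\<omega>. ennreal (exp ((ip d (X \<omega>) v)\<^sup>2 / (K\<^sup>2 * (s * \<tau>)))) \<partial>M)"
        by (simp add: ipsc power_divide q mult_ac)
      also have "\<dots> \<le> 2"
        by (rule subgaussian_exp_square_le[OF sub prob_space_axioms K_pos st])
      finally show ?thesis .
    qed
    show "indep_vars (\<lambda>_. euclid d) Ys {1..N}"
      using indep_vars_compose2[OF iid'(1), of "\<lambda>_. sc" "\<lambda>_. euclid d"] sc unfolding Ys_def[abs_def] by blast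
    show "distr M (euclid d) (Ys i) = P" if i: "i \<in> {1..N}" for i
    proof -
      have "distr M (euclid d) (Ys i) = distr (distr M (euclid d) (Xs i)) (euclid d) sc"
        unfolding distr_distr[OF sc Xs[OF i]] by (simp add: Ys_def[abs_def] comp_def)
      also have "\<dots> = P"
        unfolding iid'(2)[OF i] distr_distr[OF sc measurable_X] by (simp add: P_def comp_def)
      finally show ?thesis .
    qed
  qed (use d_pos K_pos r N in auto)
  obtain B where BM: "B \<in> borel_measurable M" and B: "(\<integral>\<^sup>+\<omega>. B \<omega> \<partial>M) \<le> ennreal (deviation_const K p * (sqrt r ^ p / real N + sqrt (r / real N)))"
    and le: "\<And>\<omega> v. ip d v v = 1 \<Longrightarrow>
      ennreal \<bar>1 / real N * (\<Sum>i=1..N. (ip d (Ys i \<omega>) v) ^ p) - (\<integral>x. (ip d x v) ^ p \<partial>P)\<bar> \<le> B \<omega>"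
    using Y.deviation_envelope[OF p] by blast
  have "(\<integral>\<^sup>+\<omega>. ennreal (tensor_deviation p d N M X Xs \<omega>) \<partial>M) \<le> (\<integral>\<^sup>+\<omega>. ennreal (q ^ p) * B \<omega> \<partial>M)"
    unfolding tensor_deviation_def
  proof (rule nn_integral_SUP_le[OF unit_sphere_nonempty[OF d_pos]])
    fix v \<omega> assume v: "v \<in> unit_sphere d"
    have "(\<integral>x. (ip d x v) ^ p \<partial>P) = (\<integral>\<omega>. (ip d (sc (X \<omega>)) v) ^ p \<partial>M)"
      unfolding P_def by (intro integral_distr[OF Y] borel_measurable_power measurable_ip_const(1) ident)
    then have e: "(\<integral>x. (ip d x v) ^ p \<partial>P) = (\<integral>\<omega>. (ip d (X \<omega>) v) ^ p \<partial>M) / q ^ p"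
      by (simp add: ipsc power_divide)
    have "1 / real N * (\<Sum>i=1..N. (ip d (Xs i \<omega>) v) ^ p) - (\<integral>\<omega>'. (ip d (X \<omega>') v) ^ p \<partial>M)
      = q ^ p * (1 / real N * (\<Sum>i=1..N. (ip d (Ys i \<omega>) v) ^ p) - (\<integral>x. (ip d x v) ^ p \<partial>P))"
      using q(1) unfolding e Ys_def ipsc power_divide sum_divide_distrib[symmetric] by (simp add: field_simps)
    then have "\<bar>1 / real N * (\<Sum>i=1..N. (ip d (Xs i \<omega>) v) ^ p) - (\<integral>\<omega>'. (ip d (X \<omega>') v) ^ p \<partial>M)\<bar>
      = q ^ p * \<bar>1 / real N * (\<Sum>i=1..N. (ip d (Ys i \<omega>) v) ^ p) - (\<integral>x. (ip d x v) ^ p \<partial>P)\<bar>"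
      using q(1) by (simp only: abs_mult) simp
    then have "ennreal \<bar>1 / real N * (\<Sum>i=1..N. (ip d (Xs i \<omega>) v) ^ p) - (\<integral>\<omega>'. (ip d (X \<omega>') v) ^ p \<partial>M)\<bar>
      = ennreal (q ^ p) * ennreal \<bar>1 / real N * (\<Sum>i=1..N. (ip d (Ys i \<omega>) v) ^ p) - (\<integral>x. (ip d x v) ^ p \<partial>P)\<bar>"
      using q(1) by (simp only: ennreal_mult'' abs_ge_zero)
    also have "\<dots> \<le> ennreal (q ^ p) * B \<omega>"
      by (intro mult_left_mono le unit_sphere_ip v) simp
    finally show "ennreal \<bar>1 / real N * (\<Sum>i=1..N. (ip d (Xs i \<omega>) v) ^ p) - (\<integral>\<omega>'. (ip d (X \<omega>') v) ^ p \<partial>M)\<bar> \<le> ennreal (q ^ p) * B \<omega>" .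
  qed simp
  also have "\<dots> \<le> ennreal (q ^ p) * (\<integral>\<^sup>+\<omega>. B \<omega> \<partial>M)"
    by (simp add: nn_integral_cmult[OF BM])
  also have "\<dots> \<le> ennreal (q ^ p) * ennreal (deviation_const K p * (sqrt r ^ p / real N + sqrt (r / real N)))"
    by (rule mult_left_mono[OF B]) simp
  also have "\<dots> = ennreal (q ^ p * (deviation_const K p * (sqrt r ^ p / real N + sqrt (r / real N))))"
    using q(1) by (intro ennreal_mult'[symmetric]) simp
  finally show ?thesis by (simp add: q_def)
qed

end

lemma deviation_const_pos: "0 < deviation_const K p"
  unfolding deviation_const_def using moment_const_nonneg[of K p] peak_const_nonneg[of K p]
  by (intro add_pos_nonneg add_nonneg_pos) auto

lemma tensor_bound_deviation_const:
  assumes p: "2 \<le> p" and K: "0 < K"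
  shows "tensor_bound TYPE('a) p K (deviation_const K p)"
  unfolding tensor_bound_def
proof (intro allI impI)
  fix d N :: nat and M :: "'a measure" and X Xs and \<Sigma> :: "nat \<Rightarrow> nat \<Rightarrow> real"
  assume d: "0 < d" and N: "0 < N" and M: "prob_space M" and X: "X \<in> M \<rightarrow>\<^sub>M euclid d"
    and "mean_zero d M X" and sub: "subgaussian d K M X" and S: "\<Sigma> = cov_mat M X" and iid: "iid_copies d N M X Xs"
  interpret subgaussian_vector M d K X
    using M d K X sub by (simp add: subgaussian_vector_def subgaussian_vector_axioms_def)
  let ?C = "deviation_const K p"
  let ?E = "\<integral>\<^sup>+\<omega>. ennreal (tensor_deviation p d N M X Xs \<omega>) \<partial>M"
  define \<sigma> where "\<sigma> = op_norm d \<Sigma>"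
  show "?E \<le> ennreal (?C * op_norm d \<Sigma> powr (real p / 2) *
      (eff_rank d \<Sigma> powr (real p / 2) / real N + sqrt (eff_rank d \<Sigma> / real N)))"
  proof (cases "\<sigma> = 0")
    case False
    then have \<sigma>: "0 < \<sigma>" using op_norm_nonneg by (simp add: \<sigma>_def S)
    define r where "r = eff_rank d \<Sigma>"
    have r: "r = trace_mat d \<Sigma> / \<sigma>" by (simp add: r_def eff_rank_def \<sigma>_def)
    have r1: "1 \<le> r" unfolding r using op_norm_le_trace \<sigma> by (simp add: \<sigma>_def S)
    have pw: "sqrt t ^ p = t powr (real p / 2)" if "0 < t" for t
    proof -
      have "sqrt t ^ p = (t powr (1 / 2)) powr real p"
        using that by (simp add: powr_half_sqrt powr_realpow)
      also have "\<dots> = t powr (real p / 2)" by (simp add: powr_powr)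
      finally show ?thesis .
    qed
    have "?E \<le> ennreal (sqrt \<sigma> ^ p * (?C * (sqrt r ^ p / real N + sqrt (r / real N))))"
      by (rule tensor_deviation_le_scaled[OF p N iid \<sigma>]) (use r r1 \<sigma> in \<open>auto simp: \<sigma>_def S\<close>)
    also have "sqrt \<sigma> ^ p * (?C * (sqrt r ^ p / real N + sqrt (r / real N)))
      = ?C * \<sigma> powr (real p / 2) * (r powr (real p / 2) / real N + sqrt (r / real N))"
      using pw[of \<sigma>] pw[of r] \<sigma> r1 by (simp add: mult_ac)
    finally show ?thesis by (simp add: \<sigma>_def r_def)
  next
    case True
    have tr: "trace_mat d \<Sigma> \<le> 0"
    proof -
      have "\<Sigma> i i \<le> 0" if i: "i < d" for i
      proof -
        let ?e = "\<lambda>j. if j = i then 1 else 0 :: real"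
        have "\<Sigma> i i = (\<integral>\<omega>. (ip d (X \<omega>) ?e)\<^sup>2 \<partial>M)"
          unfolding ip_indicator[OF i] S cov_mat_def by (simp add: power2_eq_square)
        also have "\<dots> \<le> 0" using variance_le_op_norm[of ?e] True by (simp add: \<sigma>_def S)
        finally show ?thesis .
      qed
      then show ?thesis unfolding trace_mat_def by (intro sum_nonpos) auto
    qed
    define D where "D = ?C * (1 / real N + sqrt (1 / real N))"
    have D: "0 \<le> D" unfolding D_def using deviation_const_pos[of K p] by (intro mult_nonneg_nonneg) auto
    \<comment> \<open>The claimed right-hand side is 0, because \<open>0 powr _\<close> is 0, so the
      mean deviation has to vanish. \<open>tensor_deviation_le_scaled\<close> with \<tau> = q^2 and
      r = 1 bounds it by q^p * D for every small q > 0.\<close>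
    have "?E \<le> 0"
    proof (rule ennreal_le_epsilon)
      fix \<epsilon> :: real assume \<epsilon>: "0 < \<epsilon>"
      \<comment> \<open>q \<le> 1 allows q^p to be replaced by q, and D + 1 keeps the denominator
        positive when D = 0.\<close>
      define q where "q = min 1 (\<epsilon> / (D + 1))"
      have q: "0 < q" "q \<le> 1" "q \<le> \<epsilon> / (D + 1)" using \<epsilon> D by (auto simp: q_def)
      have "?E \<le> ennreal (sqrt (q\<^sup>2) ^ p * (?C * (sqrt 1 ^ p / real N + sqrt (1 / real N))))"
        by (rule tensor_deviation_le_scaled[OF p N iid]) (use q True tr in \<open>auto simp: \<sigma>_def S intro: order_trans\<close>)
      also have "sqrt (q\<^sup>2) ^ p * (?C * (sqrt 1 ^ p / real N + sqrt (1 / real N))) = q ^ p * D"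
        using q by (simp add: D_def)
      also have "q ^ p * D \<le> q * D"
        using D q p power_decreasing[of 1 p q] by (intro mult_right_mono) auto
      also have "\<dots> \<le> \<epsilon> / (D + 1) * D" using q D by (intro mult_right_mono) auto
      also have "\<dots> \<le> \<epsilon>" using \<epsilon> D by (simp add: field_simps)
      finally show "?E \<le> 0 + ennreal \<epsilon>" by (simp add: ennreal_leI)
    qed
    then show ?thesis by simp
  qed
qed

section \<open>Independence of the underlying type\<close>

text \<open>\<open>Sup\<close> on the reals is defined as the least upper bound by a description
  that mentions only the set of upper bounds. Hence equality also holds where the value is
  unspecified, for empty or unbounded sets.\<close>

lemma real_Sup_cong_upper_bounds:
  fixes A B :: "real set"
  assumes "\<And>z. (\<forall>x\<in>A. x \<le> z) \<longleftrightarrow> (\<forall>x\<in>B. x \<le> z)"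
  shows "Sup A = Sup B"
  unfolding Sup_real_def using assms by simp

text \<open>The centring \<open>m\<close> need not be continuous: the supremum is taken over a countable dense subset
  of its graph. If \<open>m\<close> is unbounded, the real supremum is the same junk value at every point.\<close>

lemma measurable_SUP_unit_sphere:
  fixes m :: "(nat \<Rightarrow> real) \<Rightarrow> real" and c :: real
  assumes Xs: "\<And>i. i \<in> I \<Longrightarrow> Xs i \<in> M \<rightarrow>\<^sub>M euclid d"
  shows "(\<lambda>\<omega>. SUP v\<in>unit_sphere d. \<bar>c * (\<Sum>i\<in>I. (ip d (Xs i \<omega>) v) ^ p) - m v\<bar>) \<in> borel_measurable M"
proof -
  have emp: "\<bar>c * (\<Sum>i\<in>I. (ip d (Xs i \<omega>) v) ^ p)\<bar> \<le> \<bar>c\<bar> * (\<Sum>i\<in>I. L2_set (Xs i \<omega>) {..<d} ^ p)"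
    if v: "v \<in> unit_sphere d" for v \<omega>
  proof -
    have "\<bar>(ip d (Xs i \<omega>) v) ^ p\<bar> \<le> L2_set (Xs i \<omega>) {..<d} ^ p" for i
      unfolding power_abs by (intro power_mono abs_ip_le_L2_set unit_sphere_ip v) auto
    then have "\<bar>\<Sum>i\<in>I. (ip d (Xs i \<omega>) v) ^ p\<bar> \<le> (\<Sum>i\<in>I. L2_set (Xs i \<omega>) {..<d} ^ p)"
      by (intro order_trans[OF sum_abs sum_mono])
    then show ?thesis
      unfolding abs_mult by (rule mult_left_mono) simp
  qed
  show ?thesis
  proof (cases "\<exists>B. \<forall>v\<in>unit_sphere d. \<bar>m v\<bar> \<le> B")
    case True
    then obtain B where B: "\<And>v. v \<in> unit_sphere d \<Longrightarrow> \<bar>m v\<bar> \<le> B" by blast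
    define G where "G = (\<lambda>v. (v, m v)) ` unit_sphere d"
    obtain D where D: "countable D" "D \<subseteq> G" "G \<subseteq> closure D"
      by (rule separable)
    define f where "f \<omega> z = \<bar>c * (\<Sum>i\<in>I. (ip d (Xs i \<omega>) (fst z)) ^ p) - snd z\<bar>" for \<omega> and z :: "(nat \<Rightarrow> real) \<times> real"
    have cont: "continuous_on UNIV (f \<omega>)" for \<omega>
      unfolding f_def[abs_def] ip_def
      by (intro continuous_intros continuous_on_product_then_coordinatewise)
    have eq: "(SUP v\<in>unit_sphere d. \<bar>c * (\<Sum>i\<in>I. (ip d (Xs i \<omega>) v) ^ p) - m v\<bar>) = (SUP z\<in>D. f \<omega> z)" for \<omega>
    proof -
      have img: "(\<lambda>v. \<bar>c * (\<Sum>i\<in>I. (ip d (Xs i \<omega>) v) ^ p) - m v\<bar>) ` unit_sphere d = f \<omega> ` G"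
        by (simp add: G_def f_def image_image)
      show ?thesis
        unfolding img
      proof (rule real_Sup_cong_upper_bounds)
        fix z
        have "closed {x. f \<omega> x \<le> z}"
          using closed_Collect_le[OF cont continuous_on_const] by simp
        then have "closure D \<subseteq> {x. f \<omega> x \<le> z}" if "D \<subseteq> {x. f \<omega> x \<le> z}"
          using that by (simp add: closure_minimal)
        then show "(\<forall>x\<in>f \<omega> ` G. x \<le> z) \<longleftrightarrow> (\<forall>x\<in>f \<omega> ` D. x \<le> z)"
          using D by blast
      qed
    qed
    show ?thesis
      unfolding eq
    proof (rule borel_measurable_cSUP[OF D(1)])
      fix z assume "z \<in> D"
      show "(\<lambda>\<omega>. f \<omega> z) \<in> borel_measurable M"
        unfolding f_def
        by (intro borel_measurable_abs borel_measurable_diff borel_measurable_times borel_measurable_const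
          borel_measurable_sum borel_measurable_power measurable_ip_const(1) Xs)
    next
      fix \<omega>
      show "bdd_above ((\<lambda>z. f \<omega> z) ` D)"
      proof (rule bdd_aboveI2)
        fix z assume "z \<in> D"
        then obtain v where v: "v \<in> unit_sphere d" "z = (v, m v)" using D(2) by (auto simp: G_def)
        show "f \<omega> z \<le> \<bar>c\<bar> * (\<Sum>i\<in>I. L2_set (Xs i \<omega>) {..<d} ^ p) + B"
          using B[OF v(1)] emp[OF v(1), of \<omega>] unfolding f_def v(2) fst_conv snd_conv by linarith
      qed
    qed
  next
    case False
    have "(SUP v\<in>unit_sphere d. \<bar>c * (\<Sum>i\<in>I. (ip d (Xs i \<omega>) v) ^ p) - m v\<bar>) = Sup (UNIV :: real set)" for \<omega>
    proof (rule real_Sup_cong_upper_bounds)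
      fix z
      have "\<not> (\<forall>v\<in>unit_sphere d. \<bar>c * (\<Sum>i\<in>I. (ip d (Xs i \<omega>) v) ^ p) - m v\<bar> \<le> z)"
      proof
        assume z: "\<forall>v\<in>unit_sphere d. \<bar>c * (\<Sum>i\<in>I. (ip d (Xs i \<omega>) v) ^ p) - m v\<bar> \<le> z"
        have "\<bar>m v\<bar> \<le> z + \<bar>c\<bar> * (\<Sum>i\<in>I. L2_set (Xs i \<omega>) {..<d} ^ p)" if v: "v \<in> unit_sphere d" for v
          using bspec[OF z v] emp[OF v, of \<omega>] by linarith
        with False show False by blast
      qed
      moreover have "\<not> (\<forall>x\<in>(UNIV :: real set). x \<le> z)" by (auto intro: exI[of _ "z + 1"])
      ultimately show "(\<forall>x\<in>(\<lambda>v. \<bar>c * (\<Sum>i\<in>I. (ip d (Xs i \<omega>) v) ^ p) - m v\<bar>) ` unit_sphere d. x \<le> z) \<longleftrightarrow> (\<forall>x\<in>(UNIV :: real set). x \<le> z)"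
        by blast
    qed
    then show ?thesis by simp
  qed
qed

text \<open>Hypotheses and conclusion depend only on the joint law of X and its copies, and the
  image measure under \<open>T\<close> realises this law on \<open>sample\<close>. Changing
  variables in the mean deviation needs it to be measurable on the new space, which is the purpose
  of \<open>measurable_SUP_unit_sphere\<close>.\<close>

lemma tensor_bound_transfer:
  assumes bound: "tensor_bound TYPE(sample) p K C"
  shows "tensor_bound TYPE('a) p K C"
  unfolding tensor_bound_def
proof (intro allI impI)
  fix d N :: nat and M :: "'a measure" and X Xs and \<Sigma> :: "nat \<Rightarrow> nat \<Rightarrow> real"
  assume d: "0 < d" and N: "0 < N" and M: "prob_space M" and X: "X \<in> M \<rightarrow>\<^sub>M euclid d"
    and mz: "mean_zero d M X" and sub: "subgaussian d K M X" and S: "\<Sigma> = cov_mat M X" and iid: "iid_copies d N M X Xs"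
  interpret prob_space M by fact
  have iid': "indep_vars (\<lambda>_. euclid d) Xs {1..N}" "\<And>i. i \<in> {1..N} \<Longrightarrow> distr M (euclid d) (Xs i) = distr M (euclid d) X"
    using iid by (auto simp: iid_copies_def)
  have Xs: "Xs i \<in> M \<rightarrow>\<^sub>M euclid d" if "i \<in> {1..N}" for i
    by (rule indep_vars_measurable[OF iid'(1) that])
  define R :: "sample measure" where "R = PiM {..N} (\<lambda>_. euclid d)"
  \<comment> \<open>Coordinate 0 stores \<open>X\<close>, coordinates 1 to \<open>N\<close> the
    copies; hence the index set \<open>{..N}\<close> of \<open>R\<close>.\<close>
  define T where "T \<omega> = (\<lambda>i\<in>{..N}. if i = 0 then X \<omega> else Xs i \<omega>)" for \<omega>
  have T: "T \<in> M \<rightarrow>\<^sub>M R"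
    unfolding T_def[abs_def] R_def
  proof (rule measurable_restrict)
    fix i assume i: "i \<in> {..N}"
    show "(\<lambda>\<omega>. if i = 0 then X \<omega> else Xs i \<omega>) \<in> M \<rightarrow>\<^sub>M euclid d"
      by (cases "i = 0") (use i X Xs in auto)
  qed
  define M' where "M' = distr M R T"
  define X' :: "sample \<Rightarrow> nat \<Rightarrow> real" where "X' s = s 0" for s
  define Xs' :: "nat \<Rightarrow> sample \<Rightarrow> nat \<Rightarrow> real" where "Xs' i s = s i" for i s
  have XT: "X' (T \<omega>) = X \<omega>" for \<omega> by (simp add: X'_def T_def)
  have XsT: "Xs' i (T \<omega>) = Xs i \<omega>" if "i \<in> {1..N}" for i \<omega> using that by (simp add: Xs'_def T_def)
  have X'R: "X' \<in> R \<rightarrow>\<^sub>M euclid d"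
    unfolding X'_def[abs_def] R_def by (rule measurable_component_singleton) simp
  have Xs'R: "Xs' i \<in> R \<rightarrow>\<^sub>M euclid d" if "i \<in> {1..N}" for i
    unfolding Xs'_def[abs_def] R_def by (rule measurable_component_singleton) (use that in simp)
  have R_eq: "f \<in> M' \<rightarrow>\<^sub>M L \<longleftrightarrow> f \<in> R \<rightarrow>\<^sub>M L" for f and L :: "'c measure"
    unfolding M'_def by (simp only: measurable_distr_eq1)
  have M': "prob_space M'" unfolding M'_def by (rule prob_space_distr[OF T])
  interpret M': prob_space M' by fact
  have int: "(\<integral>s. f (X' s) \<partial>M') = (\<integral>\<omega>. f (X \<omega>) \<partial>M)" if f: "f \<in> borel_measurable (euclid d)" for f :: "(nat \<Rightarrow> real) \<Rightarrow> real"
    unfolding M'_def using integral_distr[OF T measurable_compose[OF X'R f]] by (simp add: XT)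
  have ident: "(\<lambda>x. x) \<in> euclid d \<rightarrow>\<^sub>M euclid d" by (rule measurable_ident_sets[OF refl])
  have coord: "(\<lambda>x. x i) \<in> borel_measurable (euclid d)" if "i < d" for i
    by (rule measurable_component_singleton) (use that in simp)
  have ipm: "(\<lambda>x. ip d x v) \<in> borel_measurable (euclid d)" for v
    by (rule measurable_ip_const(1)[OF ident])
  have mz': "mean_zero d M' X'"
    using mz int[OF coord] by (simp add: mean_zero_def)
  have psi: "psi2_norm M' (\<lambda>s. ip d (X' s) v) = psi2_norm M (\<lambda>\<omega>. ip d (X \<omega>) v)" for v
  proof -
    have "(\<integral>\<^sup>+s. ennreal (exp ((ip d (X' s) v)\<^sup>2 / t\<^sup>2)) \<partial>M') = (\<integral>\<^sup>+\<omega>. ennreal (exp ((ip d (X \<omega>) v)\<^sup>2 / t\<^sup>2)) \<partial>M)" for t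
    proof -
      have m: "(\<lambda>s. ennreal (exp ((ip d (X' s) v)\<^sup>2 / t\<^sup>2))) \<in> borel_measurable R"
        by (intro measurable_compose[OF _ measurable_ennreal] measurable_compose[OF _ borel_measurable_exp]
          borel_measurable_divide borel_measurable_power measurable_ip_const(1) X'R borel_measurable_const)
      show ?thesis
        unfolding M'_def
        by (subst nn_integral_distr[OF T]) (simp_all only: measurable_distr_eq1 m XT)
    qed
    then show ?thesis by (simp add: psi2_norm_def)
  qed
  have l2: "l2_norm M' (\<lambda>s. ip d (X' s) v) = l2_norm M (\<lambda>\<omega>. ip d (X \<omega>) v)" for v
    unfolding l2_norm_def
    by (subst int[of "\<lambda>x. \<bar>ip d x v\<bar>\<^sup>2"]) (intro borel_measurable_power borel_measurable_abs ipm, rule refl)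
  have sub': "subgaussian d K M' X'"
    using sub by (simp add: subgaussian_def psi l2)
  have mom: "(\<integral>s. (ip d (X' s) v) ^ p \<partial>M') = (\<integral>\<omega>. (ip d (X \<omega>) v) ^ p \<partial>M)" for v
    by (rule int[of "\<lambda>x. (ip d x v) ^ p"]) (intro borel_measurable_power ipm)
  have tr: "trace_mat d (cov_mat M' X') = trace_mat d \<Sigma>" and opn: "op_norm d (cov_mat M' X') = op_norm d \<Sigma>"
  proof -
    have c: "cov_mat M' X' i j = \<Sigma> i j" if "i < d" "j < d" for i j
      unfolding S cov_mat_def by (rule int[of "\<lambda>x. x i * x j"]) (intro borel_measurable_times coord that)
    then show "trace_mat d (cov_mat M' X') = trace_mat d \<Sigma>"
      unfolding trace_mat_def by (intro sum.cong) auto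
    have "L2_set (\<lambda>i. \<Sum>j<d. cov_mat M' X' i j * v j) {..<d} = L2_set (\<lambda>i. \<Sum>j<d. \<Sigma> i j * v j) {..<d}" for v
      using c by (intro L2_set_cong sum.cong) auto
    then show "op_norm d (cov_mat M' X') = op_norm d \<Sigma>"
      by (simp add: op_norm_def)
  qed
  have law: "distr M' (euclid d) (Xs' i) = distr M (euclid d) (Xs i)" if i: "i \<in> {1..N}" for i
    unfolding M'_def distr_distr[OF Xs'R[OF i] T] by (rule distr_cong) (use i in \<open>auto simp: XsT\<close>)
  have law0: "distr M' (euclid d) X' = distr M (euclid d) X"
    unfolding M'_def distr_distr[OF X'R T] by (rule distr_cong) (auto simp: XT)
  \<comment> \<open>Independence is restated as the joint law being the product of its marginals, a
    property of laws that the image measure inherits.\<close>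
  have indep': "M'.indep_vars (\<lambda>_. euclid d) Xs' {1..N}"
  proof (subst M'.indep_vars_iff_distr_eq_PiM')
    show "{1..N} \<noteq> {}" using N by simp
    show "Xs' i \<in> M' \<rightarrow>\<^sub>M euclid d" if "i \<in> {1..N}" for i using Xs'R[OF that] R_eq by blast
    have m: "(\<lambda>s. \<lambda>i\<in>{1..N}. Xs' i s) \<in> R \<rightarrow>\<^sub>M PiM {1..N} (\<lambda>_. euclid d)"
      by (rule measurable_restrict) (rule Xs'R)
    have "distr M' (PiM {1..N} (\<lambda>_. euclid d)) (\<lambda>s. \<lambda>i\<in>{1..N}. Xs' i s) = distr M (PiM {1..N} (\<lambda>_. euclid d)) (\<lambda>\<omega>. \<lambda>i\<in>{1..N}. Xs i \<omega>)"
      unfolding M'_def distr_distr[OF m T] by (rule distr_cong) (auto simp: XsT fun_eq_iff)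
    also have "\<dots> = PiM {1..N} (\<lambda>i. distr M (euclid d) (Xs i))"
      by (rule indep_vars_iff_distr_eq_PiM'[THEN iffD1]) (use N Xs iid'(1) in auto)
    also have "\<dots> = PiM {1..N} (\<lambda>i. distr M' (euclid d) (Xs' i))"
      by (rule PiM_cong) (use law in auto)
    finally show "distr M' (PiM {1..N} (\<lambda>_. euclid d)) (\<lambda>s. \<lambda>i\<in>{1..N}. Xs' i s) = PiM {1..N} (\<lambda>i. distr M' (euclid d) (Xs' i))" .
  qed
  have iidM': "iid_copies d N M' X' Xs'"
    unfolding iid_copies_def using indep' law law0 iid'(2) by auto
  have dev: "tensor_deviation p d N M' X' Xs' (T \<omega>) = tensor_deviation p d N M X Xs \<omega>" for \<omega>
  proof -
    have "(\<Sum>i=1..N. (ip d (Xs' i (T \<omega>)) v) ^ p) = (\<Sum>i=1..N. (ip d (Xs i \<omega>) v) ^ p)" for v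
      by (intro sum.cong refl) (simp only: XsT)
    then show ?thesis unfolding tensor_deviation_def mom by (simp only:)
  qed
  have m: "tensor_deviation p d N M' X' Xs' \<in> borel_measurable R"
    unfolding tensor_deviation_def[abs_def] by (rule measurable_SUP_unit_sphere[OF Xs'R])
  have "(\<integral>\<^sup>+\<omega>. ennreal (tensor_deviation p d N M X Xs \<omega>) \<partial>M) = (\<integral>\<^sup>+s. ennreal (tensor_deviation p d N M' X' Xs' s) \<partial>M')"
  proof -
    have "(\<lambda>s. ennreal (tensor_deviation p d N M' X' Xs' s)) \<in> borel_measurable (distr M R T)"
      by (simp only: measurable_distr_eq1 measurable_compose[OF m measurable_ennreal])
    from nn_integral_distr[OF T this] show ?thesis
      unfolding dev M'_def[symmetric] by (rule sym)
  qed
  also have "\<dots> \<le> ennreal (C * op_norm d (cov_mat M' X') powr (real p / 2) *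
      (eff_rank d (cov_mat M' X') powr (real p / 2) / real N + sqrt (eff_rank d (cov_mat M' X') / real N)))"
    using bound X'R R_eq unfolding tensor_bound_def using d N M' mz' sub' iidM' by blast
  finally show "(\<integral>\<^sup>+\<omega>. ennreal (tensor_deviation p d N M X Xs \<omega>) \<partial>M) \<le> ennreal (C * op_norm d \<Sigma> powr (real p / 2) *
      (eff_rank d \<Sigma> powr (real p / 2) / real N + sqrt (eff_rank d \<Sigma> / real N)))"
    by (simp only: eff_rank_def tr opn)
qed

theorem corollary1p2:
  fixes p :: nat and K :: real
  assumes "p \<ge> 2" and "K > 0"
  shows "(\<exists>C>0. tensor_bound TYPE(sample) p K C) \<and>
    (\<forall>C. tensor_bound TYPE(sample) p K C \<longrightarrow> tensor_bound TYPE('a) p K C)"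
proof
  show "\<exists>C>0. tensor_bound TYPE(sample) p K C"
    using deviation_const_pos tensor_bound_deviation_const[OF assms] by blast
  show "\<forall>C. tensor_bound TYPE(sample) p K C \<longrightarrow> tensor_bound TYPE('a) p K C"
    using tensor_bound_transfer by blast
qed

end
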